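(* Let $n,q,m\ge 1$ be integers and let $K$ be a field in which $n!\,q$ is invertible and which contains a primitive $q$th root of $1$. Let $G=G(n,q)\subset GL(n,K)$, $V=K^n$, and put $D=qn(n+1)-2n+2$. Then the kernel of the $K$-algebra surjection $$\mathcal{F}(q,D)\to K[V^m]^{G},\qquad t(w)\mapsto [w],$$ is generated as an ideal by the elements $\Psi(w_1,\ldots,w_{n+1})$, where $w_1,\ldots,w_{n+1}\in\mathcal{M}(q)$ and the degree of the product $w_1\cdots w_{n+1}$ is not greater than $D=qn(n+1)-2n+2$.
   Context: $G(n,q)$ is the subgroup of $GL(n,K)$ consisting of the monomial matrices (exactly one non-zero entry in each row and column) whose non-zero entries are $q$th roots of $1$. It acts naturally on $V=K^n$ and diagonally on $V^m=V\oplus\cdots\oplus V$. $K[V^m]$ is the polynomial ring over $K$ in the $mn$ variables $x(i)_j$ ($1\le i\le m$, $1\le j\le n$), where $x(i)_j$ is the $j$th coordinate of the $i$th vector component, and $K[V^m]^{G}$ is the subalgebra of polynomial invariants for the induced action. Let $x(1),\ldots,x(m)$ be commuting variables; $\mathcal{M}(q)$ is the set of monomials $\neq 1$ in $x(1),\ldots,x(m)$ whose total degree is divisible by $q$. For $w=x(1)^{\alpha_1}\cdots x(m)^{\alpha_m}\in\mathcal{M}(q)$ put $w_{\langle j\rangle}=x(1)_j^{\alpha_1}\cdots x(m)_j^{\alpha_m}$ and $[w]=\sum_{j=1}^n w_{\langle j\rangle}\in K[V^m]^{G(n,q)}$. For a natural number $d$, $\mathcal{F}(q,d)=K[t(w)\mid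 w\in\mathcal{M}(q),\ \deg(w)\le d]$ is the polynomial ring in independent commuting variables $t(w)$, one for each $w\in\mathcal{M}(q)$ of degree at most $d$. For $w_1,\ldots,w_{n+1}\in\mathcal{M}(q)$ (not necessarily distinct), $$\Psi(w_1,\ldots,w_{n+1})=\sum_{\lambda}(-1)^{h(\lambda)}\prod_{i=1}^{h(\lambda)}\Bigl((|\lambda_i|-1)!\cdot t\bigl(\textstyle\prod_{s\in\lambda_i}w_s\bigr)\Bigr),$$ where $\lambda=\lambda_1\cup\cdots\cup\lambda_{h(\lambda)}$ runs over all partitions of the set $\{1,\ldots,n+1\}$ into disjoint non-empty subsets and $h(\lambda)$ is the number of parts; it is an element of $\mathcal{F}(q,d)$ whenever $\deg(w_1\cdots w_{n+1})\le d$. *)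

theory Defs
  imports
    "HOL-Analysis.Finite_Cartesian_Product"
    "HOL-Library.Poly_Mapping"
    "HOL-Library.Disjoint_Sets"
    "HOL-Algebra.QuotRing"
begin

text \<open>A monomial is its exponent vector, so the product of monomials is the sum \<open>+\<close> of
  exponent vectors, and the monomial 1 is \<open>0\<close>. The product of polynomials is the
  convolution product of finitely supported functions on exponent vectors.\<close>

type_synonym 'v monom = "'v \<Rightarrow>\<^sub>0 nat"
type_synonym ('v, 'k) mpoly = "'v monom \<Rightarrow>\<^sub>0 'k"

definition mconst :: "'k \<Rightarrow> ('v, 'k::comm_ring_1) mpoly" where
  "mconst c = Poly_Mapping.single 0 c"

definition mvar :: "'v \<Rightarrow> ('v, 'k::comm_ring_1) mpoly" where
  "mvar v = Poly_Mapping.single (Poly_Mapping.single v 1) 1"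

definition msubst :: "('v \<Rightarrow> ('u, 'k) mpoly) \<Rightarrow> ('v, 'k::comm_ring_1) mpoly \<Rightarrow> ('u, 'k) mpoly" where
  "msubst f p = (\<Sum>e\<in>Poly_Mapping.keys p. mconst (Poly_Mapping.lookup p e) *
                   (\<Prod>v\<in>Poly_Mapping.keys e. f v ^ Poly_Mapping.lookup e v))"

definition ring_on :: "'a::comm_ring_1 set \<Rightarrow> 'a ring" where
  "ring_on S = \<lparr>carrier = S, mult = (*), one = 1, zero = 0, add = (+)\<rparr>"

definition polys_in :: "'v set \<Rightarrow> ('v, 'k::comm_ring_1) mpoly set" where
  "polys_in X = {p. \<forall>e\<in>Poly_Mapping.keys p. Poly_Mapping.keys e \<subseteq> X}"

definition primitive_root_of_one :: "nat \<Rightarrow> 'k::field \<Rightarrow> bool" where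
  "primitive_root_of_one q z \<longleftrightarrow> z ^ q = 1 \<and> (\<forall>k. 0 < k \<and> k < q \<longrightarrow> z ^ k \<noteq> 1)"

text \<open>The group $G(n,q)$, where $n$ is the cardinality of the index type \<open>'n\<close>.\<close>

definition monomial_group :: "nat \<Rightarrow> ('k::field ^ 'n ^ 'n) set" where
  "monomial_group q = {A. invertible A \<and>
     (\<forall>i. \<exists>!j. A $ i $ j \<noteq> 0) \<and> (\<forall>j. \<exists>!i. A $ i $ j \<noteq> 0) \<and>
     (\<forall>i j. A $ i $ j \<noteq> 0 \<longrightarrow> (A $ i $ j) ^ q = 1)}"

text \<open>The variable \<open>(i, j)\<close> is $x(i)_j$. The polynomial \<open>act A f\<close> is $v \mapsto f(Av)$; it is
  defined by substitution because over a finite field polynomials are not determined by their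
  values. For a group of matrices the invariants are the same as for $v \mapsto f(A^{-1}v)$.\<close>

definition act :: "'k::field ^ 'n ^ 'n \<Rightarrow> ('m \<times> 'n, 'k) mpoly \<Rightarrow> ('m \<times> 'n, 'k) mpoly" where
  "act A = msubst (\<lambda>(i, j). \<Sum>k\<in>UNIV. mconst (A $ j $ k) * mvar (i, k))"

definition invariants :: "('k::field ^ 'n ^ 'n) set \<Rightarrow> ('m \<times> 'n, 'k) mpoly set" where
  "invariants G = {f. \<forall>A\<in>G. act A f = f}"

definition mdeg :: "'v monom \<Rightarrow> nat" where
  "mdeg w = (\<Sum>v\<in>Poly_Mapping.keys w. Poly_Mapping.lookup w v)"

definition Mq :: "nat \<Rightarrow> 'm monom set" where
  "Mq q = {w. w \<noteq> 0 \<and> q dvd mdeg w}"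

text \<open>$w_{\langle j\rangle}$ and $[w]$\<close>

definition monom_at :: "'m::finite monom \<Rightarrow> 'n \<Rightarrow> ('m \<times> 'n, 'k::field) mpoly" where
  "monom_at w j = (\<Prod>i\<in>UNIV. mvar (i, j) ^ Poly_Mapping.lookup w i)"

definition bracket :: "'m::finite monom \<Rightarrow> ('m \<times> 'n::finite, 'k::field) mpoly" where
  "bracket w = (\<Sum>j\<in>UNIV. monom_at w j)"

text \<open>The variable indexed by the monomial \<open>w\<close> is $t(w)$.\<close>

definition Fqd :: "nat \<Rightarrow> nat \<Rightarrow> ('m monom, 'k::field) mpoly set" where
  "Fqd q d = polys_in {w \<in> Mq q. mdeg w \<le> d}"

definition Psi :: "nat \<Rightarrow> (nat \<Rightarrow> 'm monom) \<Rightarrow> ('m monom, 'k::field) mpoly" where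
  "Psi n w = (\<Sum>P | partition_on {1..n+1} P.
     (-1) ^ card P * (\<Prod>B\<in>P. of_nat (fact (card B - 1)) * mvar (\<Sum>s\<in>B. w s)))"

end

theory Submission
  imports Defs "HOL-Combinatorics.Transposition"
begin

text \<open>
  Let $e = \sum_{j=1}^n (qj - 1)$, so that $D = 2e + 2$.

  The sum \<open>\<Psi>\<close> is, up to sign, the expression in power sums of the sum of
  $\prod_s (w_s)_{\langle f(s)\rangle}$ over injections $f$ into $\{1,\dots,n\}$, so it maps to
  \<open>0\<close> for $n + 1$ arguments. The same expression with $n$ arguments defines a linear map
  \<open>\<theta>\<close> from polynomials to \<open>\<F>(q, D)\<close>, lifting the Reynolds operator, such that
  $\theta([w] f) - t(w)\,\theta(f)$ is a multiple of some \<open>\<Psi>\<close>. Hence $\theta \circ \phi$ is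
  the identity modulo the elements \<open>\<Psi>\<close> in degrees up to \<open>D\<close>.

  Polarized complete homogeneous symmetric polynomials of the blocks $1,\dots,k$ show that every
  monomial of degree above \<open>e\<close> lies in the ideal generated by the invariants $[w]$ with
  $\deg w \le qn$. As in Derksen's bound on syzygies of invariants, a Koszul argument then
  shows that the syzygies of these $[w]$ in degrees above $2e + 2$ are Koszul syzygies. A
  homogeneous relation of degree above \<open>D\<close> is congruent to $\sum_w t(w) p_w$, where the
  $\phi(p_w)$ form such a syzygy; averaging and lifting its antisymmetric coefficients changes
  the $p_w$ into relations of smaller degree, without changing the sum.
\<close>

section \<open>Sums over set partitions\<close>

text \<open>The lift \<open>theta\<close> controls relations only up to degree \<open>D\<close>:
  comparing theta([w] f) with t(w) theta(f) costs a Psi whose degree is the total degree, and only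
  the Psi of degree at most \<open>D\<close> are available. Relations of larger degree do exist,
  because \<open>D\<close> bounds the variables t(w) and not their products. This forces the descent
  on the degree, in which a syzygy can be absorbed only if it is Koszul. The coefficients of a
  Koszul syzygy are arbitrary polynomials, hence the need to average and lift them before they can
  be subtracted inside \<open>Fqd q D\<close>. The number e counts degrees of irreducible monomials:
  one that admits no rewriting has blocks of degree at most qn - 1, ..., 2q - 1, q - 1. Division by
  factorials enters in the average over n! permutations and in the rewriting rules, whose leading
  coefficients are r! with r at most n. The primitive root is what forces every block of a monomial
  of an invariant to have degree divisible by q.\<close>

text \<open>For $\tau(w) = -t(w)$ this is \<open>\<Psi>\<close>. For a power sum \<open>\<tau>\<close> it is the polarization of
  $r!\,h_r$, and for the negative of a power sum that of $(-1)^r r!\,e_r$, with \<open>r = card A\<close>.\<close>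

definition part_sum :: "('b::comm_monoid_add \<Rightarrow> 'a::comm_ring_1) \<Rightarrow> 'i set \<Rightarrow> ('i \<Rightarrow> 'b) \<Rightarrow> 'a" where
  "part_sum \<tau> A w =
    (\<Sum>P | partition_on A P. \<Prod>B\<in>P. of_nat (fact (card B - 1)) * \<tau> (\<Sum>s\<in>B. w s))"

lemma part_sum_empty [simp]: "part_sum \<tau> {} w = 1"
  by (simp add: part_sum_def partition_on_empty)

lemma partition_on_disjnt_rest:
  assumes P: "partition_on A P" and B: "B \<in> P"
  shows "disjnt B (\<Union>(P - {B}))"
proof -
  have "disjnt B C" if "C \<in> P - {B}" for C
    using pairwiseD[OF partition_onD2[OF P], of B C] B that by auto
  then show ?thesis
    by (simp add: disjnt_Union2)
qed

lemma partition_on_insert_block: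
  assumes P: "partition_on A P" and B: "B \<in> P" and a: "a \<notin> A"
  shows "partition_on (insert a A) (insert (insert a B) (P - {B}))"
proof -
  have 1: "disjnt B (\<Union>(P - {B}))"
    using partition_on_disjnt_rest[OF P B] .
  moreover have "a \<notin> \<Union>P"
    using P a by (simp add: partition_on_def)
  ultimately have "disjnt (insert a B) (\<Union>(P - {B}))"
    by (auto simp: disjnt_iff)
  moreover from 1 have "partition_on (A - B) (P - {B})"
    using partition_on_insert[of B "P - {B}" A] P B by (simp add: insert_absorb)
  moreover have "insert a A - insert a B = A - B" "B \<subseteq> A"
    using assms by (auto simp: partition_on_def)
  ultimately show ?thesis
    by (subst partition_on_insert) auto
qed

lemma partition_on_remove_from_block:
  assumes P: "partition_on (insert a A) P" and a: "a \<notin> A" and C: "C \<in> P" "a \<in> C" "C \<noteq> {a}"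
  shows "partition_on A (insert (C - {a}) (P - {C}))"
proof -
  have 1: "disjnt C (\<Union>(P - {C}))"
    using partition_on_disjnt_rest[OF P C(1)] .
  then have "partition_on (insert a A - C) (P - {C})"
    using partition_on_insert[of C "P - {C}" "insert a A"] P C by (simp add: insert_absorb)
  moreover have "insert a A - C = A - (C - {a})" "C - {a} \<subseteq> A" "C - {a} \<noteq> {}"
    using assms by (auto simp: partition_on_def)
  moreover have "disjnt (C - {a}) (\<Union>(P - {C}))"
    using 1 by (auto simp: disjnt_iff)
  ultimately show ?thesis
    by (subst partition_on_insert) auto
qed

text \<open>The summand with \<open>\<tau> (w a)\<close> collects the partitions in which
  \<open>a\<close> is a block of its own. Otherwise \<open>a\<close> joins a block \<open>B\<close>
  of a partition of \<open>A\<close>; the coefficient of the enlarged block is (card B)! = card B *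
  (card B - 1)!, one copy of the old coefficient for each b in \<open>B\<close> whose argument
  absorbs \<open>w a\<close>. All later inductions on the number of arguments run on this
  recursion.\<close>

lemma part_sum_insert:
  fixes \<tau> :: "'b::comm_monoid_add \<Rightarrow> 'a::comm_ring_1" and A :: "'i set"
  assumes A: "finite A" and a: "a \<notin> A"
  shows "part_sum \<tau> (insert a A) w =
    \<tau> (w a) * part_sum \<tau> A w + (\<Sum>b\<in>A. part_sum \<tau> A (w(b := w b + w a)))"
proof -
  define g where "g w B = of_nat (fact (card B - 1)) * \<tau> (\<Sum>s\<in>B. w s)" for w :: "'i \<Rightarrow> 'b" and B
  define S where "S = {P. partition_on A P}"
  define S' where "S' = {P. partition_on (insert a A) P}"
  have fS: "finite S" and fS': "finite S'"
    using A by (auto simp: S_def S'_def intro: finitely_many_partition_on)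
  have fP: "finite P" if "P \<in> S" for P
    using that A finite_elements by (auto simp: S_def)
  have blk: "B \<subseteq> A" "finite B" "B \<noteq> {}" "a \<notin> B" if "P \<in> S" "B \<in> P" for P B
    using that A a by (auto simp: S_def partition_on_def intro: finite_subset)
  have dj: "disjnt B C" if "P \<in> S" "B \<in> P" "C \<in> P" "B \<noteq> C" for P B C
    using that by (auto simp: S_def partition_on_def pairwise_def)
  have sp: "part_sum \<tau> (insert a A) w =
      (\<Sum>P\<in>{P\<in>S'. {a} \<in> P}. prod (g w) P) + (\<Sum>P\<in>{P\<in>S'. {a} \<notin> P}. prod (g w) P)"
  proof -
    have "S' = {P\<in>S'. {a} \<in> P} \<union> {P\<in>S'. {a} \<notin> P}"
      by blast
    then have "sum (prod (g w)) S' = sum (prod (g w)) ({P\<in>S'. {a} \<in> P} \<union> {P\<in>S'. {a} \<notin> P})"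
      by (rule arg_cong)
    also have "\<dots> = sum (prod (g w)) {P\<in>S'. {a} \<in> P} + sum (prod (g w)) {P\<in>S'. {a} \<notin> P}"
      using fS' by (intro sum.union_disjoint) auto
    finally show ?thesis
      unfolding part_sum_def S'_def g_def .
  qed
  have "(\<Sum>P\<in>{P\<in>S'. {a} \<in> P}. prod (g w) P) = (\<Sum>P\<in>S. \<tau> (w a) * prod (g w) P)"
  proof (rule sum.reindex_bij_witness[of _ "insert {a}" "\<lambda>P. P - {{a}}"])
    fix P assume "P \<in> {P \<in> S'. {a} \<in> P}"
    then have P: "partition_on (insert a A) P" "{a} \<in> P"
      by (auto simp: S'_def)
    then show "insert {a} (P - {{a}}) = P"
      by (simp add: insert_absorb)
    have "disjnt {a} (\<Union>(P - {{a}}))"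
      using partition_on_disjnt_rest[OF P] .
    then have "partition_on (insert a A - {a}) (P - {{a}})"
      using partition_on_insert[of "{a}" "P - {{a}}" "insert a A"] P by (simp add: insert_absorb)
    then show S: "P - {{a}} \<in> S"
      using a by (simp add: S_def)
    have "prod (g w) (insert {a} (P - {{a}})) = g w {a} * prod (g w) (P - {{a}})"
      using fP[OF S] by (subst prod.insert) auto
    then show "\<tau> (w a) * prod (g w) (P - {{a}}) = prod (g w) P"
      using P by (simp add: insert_absorb g_def)
  next
    fix P assume P: "P \<in> S"
    then have "{a} \<notin> P"
      using blk(4)[OF P, of "{a}"] by auto
    then show "insert {a} P - {{a}} = P"
      by auto
    have "disjnt {a} (\<Union>P)"
      using P a by (auto simp: S_def partition_on_def)
    then show "insert {a} P \<in> {P \<in> S'. {a} \<in> P}"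
      using partition_on_insert[of "{a}" P "insert a A"] P a by (auto simp: S_def S'_def)
  qed
  also have "\<dots> = \<tau> (w a) * part_sum \<tau> A w"
    by (simp add: part_sum_def g_def S_def sum_distrib_left)
  finally have 1: "(\<Sum>P\<in>{P\<in>S'. {a} \<in> P}. prod (g w) P) = \<tau> (w a) * part_sum \<tau> A w" .
  \<comment> \<open>A partition in which \<open>a\<close> is not alone corresponds to a partition of
    \<open>A\<close> with a marked block, the one that \<open>a\<close> was removed from.\<close>
  have "(\<Sum>P\<in>{P\<in>S'. {a} \<notin> P}. prod (g w) P) =
      (\<Sum>(P, B)\<in>(SIGMA P:S. P). g w (insert a B) * prod (g w) (P - {B}))"
  proof (rule sum.reindex_bij_witness[of _ "\<lambda>(P, B). insert (insert a B) (P - {B})"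
        "\<lambda>P. let C = (THE C. C \<in> P \<and> a \<in> C) in (insert (C - {a}) (P - {C}), C - {a})"])
    fix P assume "P \<in> {P \<in> S'. {a} \<notin> P}"
    then have P: "partition_on (insert a A) P" "{a} \<notin> P"
      by (auto simp: S'_def)
    have "a \<in> \<Union>P"
      using partition_onD1[OF P(1)] by blast
    then obtain C where C: "C \<in> P" "a \<in> C"
      by blast
    have uniq: "C' = C" if "C' \<in> P" "a \<in> C'" for C'
      using pairwiseD[OF partition_onD2[OF P(1)], of C C'] C that by (auto simp: disjnt_iff)
    have the: "(THE C. C \<in> P \<and> a \<in> C) = C"
    proof (rule the_equality)
      show "C \<in> P \<and> a \<in> C"
        using C by simp
    qed (rule uniq; simp)
    have Ca: "C - {a} \<noteq> {}"
    proof
      assume "C - {a} = {}"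
      then have "C = {a}"
        using C(2) by auto
      then show False
        using C(1) P(2) by simp
    qed
    have S: "insert (C - {a}) (P - {C}) \<in> S"
      using partition_on_remove_from_block[OF P(1) a C] C P(2) by (auto simp: S_def)
    have nin: "C - {a} \<notin> P"
    proof
      assume "C - {a} \<in> P"
      then have "disjnt (C - {a}) C"
        using pairwiseD[OF partition_onD2[OF P(1)], of "C - {a}" C] C by auto
      then have "C - {a} = {}"
        by (auto simp: disjnt_iff)
      then show False using Ca by simp
    qed
    have eq2: "insert (C - {a}) (P - {C}) - {C - {a}} = P - {C}"
      using nin by (simp add: insert_Diff_if)
    then have eq: "insert (insert a (C - {a})) (insert (C - {a}) (P - {C}) - {C - {a}}) = P"
      using C by (simp add: insert_absorb)
    have fin: "finite P"
      using P A finite_elements[of "insert a A" P] by simp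
    show "(case let C = THE C. C \<in> P \<and> a \<in> C in (insert (C - {a}) (P - {C}), C - {a}) of
        (P, B) \<Rightarrow> insert (insert a B) (P - {B})) = P"
      unfolding the Let_def using eq by simp
    show "(let C = THE C. C \<in> P \<and> a \<in> C in (insert (C - {a}) (P - {C}), C - {a})) \<in> (SIGMA P:S. P)"
      unfolding the Let_def using S by simp
    show "(case let C = THE C. C \<in> P \<and> a \<in> C in (insert (C - {a}) (P - {C}), C - {a}) of
        (P, B) \<Rightarrow> g w (insert a B) * prod (g w) (P - {B})) = prod (g w) P"
      unfolding the Let_def using C fin
      by (simp only: prod.case eq2) (simp add: insert_absorb prod.remove[of P C])
  next
    fix x assume "x \<in> (SIGMA P:S. P)"
    then obtain P B where x: "x = (P, B)" and P: "P \<in> S" and B: "B \<in> P"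
      by auto
    have na: "a \<notin> C" if "C \<in> P" for C
      using blk(4)[OF P that] .
    have the: "(THE C. C \<in> insert (insert a B) (P - {B}) \<and> a \<in> C) = insert a B"
      using na by (intro the_equality) auto
    have nin: "insert a B \<notin> P"
      using na[of "insert a B"] by auto
    show "(let C = THE C. C \<in> (case x of (P, B) \<Rightarrow> insert (insert a B) (P - {B})) \<and> a \<in> C in
        (insert (C - {a}) ((case x of (P, B) \<Rightarrow> insert (insert a B) (P - {B})) - {C}), C - {a})) = x"
      unfolding x prod.case the Let_def using na[OF B] nin B by auto
    show "(case x of (P, B) \<Rightarrow> insert (insert a B) (P - {B})) \<in> {P \<in> S'. {a} \<notin> P}"
      using partition_on_insert_block[of A P B a] P B a na blk(3)[OF P B]
      by (auto simp: x S'_def S_def)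
  qed
  also have "\<dots> = (\<Sum>P\<in>S. \<Sum>B\<in>P. g w (insert a B) * prod (g w) (P - {B}))"
    using fS fP by (subst sum.Sigma) auto
  also have "\<dots> = (\<Sum>P\<in>S. \<Sum>b\<in>A. prod (g (w(b := w b + w a))) P)"
  proof (rule sum.cong[OF refl])
    fix P assume P: "P \<in> S"
    have "(\<Sum>b\<in>A. prod (g (w(b := w b + w a))) P) = (\<Sum>b\<in>\<Union>P. prod (g (w(b := w b + w a))) P)"
      using P by (simp add: S_def partition_on_def)
    also have "\<dots> = (\<Sum>B\<in>P. \<Sum>b\<in>B. prod (g (w(b := w b + w a))) P)"
      using blk(2)[OF P] dj[OF P] by (subst sum.Union_disjoint) (auto simp: disjnt_def)
    also have "\<dots> = (\<Sum>B\<in>P. g w (insert a B) * prod (g w) (P - {B}))"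
    proof (rule sum.cong[OF refl])
      fix B assume B: "B \<in> P"
      note bB = blk[OF P B]
      have "prod (g (w(b := w b + w a))) P =
          of_nat (fact (card B - 1)) * \<tau> (\<Sum>s\<in>insert a B. w s) * prod (g w) (P - {B})" if b: "b \<in> B" for b
      proof -
        have "prod (g (w(b := w b + w a))) (P - {B}) = prod (g w) (P - {B})"
        proof (rule prod.cong[OF refl])
          fix C assume C: "C \<in> P - {B}"
          then have "b \<notin> C"
            using dj[OF P B, of C] b by (auto simp: disjnt_iff)
          then have "(\<Sum>s\<in>C. (w(b := w b + w a)) s) = (\<Sum>s\<in>C. w s)"
            by (intro sum.cong) auto
          then show "g (w(b := w b + w a)) C = g w C"
            by (simp add: g_def)
        qed
        moreover have "(\<Sum>s\<in>B. (w(b := w b + w a)) s) = (\<Sum>s\<in>insert a B. w s)"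
        proof -
          have "(\<Sum>s\<in>B. (w(b := w b + w a)) s) = w b + w a + (\<Sum>s\<in>B - {b}. (w(b := w b + w a)) s)"
            using bB b by (subst sum.remove[of B b]) auto
          also have "(\<Sum>s\<in>B - {b}. (w(b := w b + w a)) s) = (\<Sum>s\<in>B - {b}. w s)"
            by (intro sum.cong) auto
          also have "w b + w a + \<dots> = w a + (\<Sum>s\<in>B. w s)"
            using sum.remove[of B b w] bB b by (simp add: ac_simps)
          finally show ?thesis using bB by simp
        qed
        ultimately show ?thesis
          using fP[OF P] B by (subst prod.remove[of P B]) (auto simp: g_def)
      qed
      then have "(\<Sum>b\<in>B. prod (g (w(b := w b + w a))) P) =
          of_nat (card B * fact (card B - 1)) * \<tau> (\<Sum>s\<in>insert a B. w s) * prod (g w) (P - {B})"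
        by (simp add: mult.assoc)
      also have "card B * fact (card B - 1) = fact (card B)"
        using bB by (metis card_gt_0_iff fact_reduce of_nat_id)
      also have "\<dots> = fact (card (insert a B) - 1)"
        using bB by simp
      finally show "(\<Sum>b\<in>B. prod (g (w(b := w b + w a))) P) = g w (insert a B) * prod (g w) (P - {B})"
        by (simp only: g_def[of w "insert a B"])
    qed
    finally show "(\<Sum>B\<in>P. g w (insert a B) * prod (g w) (P - {B})) = (\<Sum>b\<in>A. prod (g (w(b := w b + w a))) P)"
      by simp
  qed
  also have "\<dots> = (\<Sum>b\<in>A. part_sum \<tau> A (w(b := w b + w a)))"
    by (subst sum.swap) (simp add: part_sum_def g_def S_def)
  finally show ?thesis
    using sp 1 by simp
qed

section \<open>Polynomials, substitution and grading\<close>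

lemma mconst_0 [simp]: "mconst 0 = 0"
  by (simp add: mconst_def)

lemma mconst_1 [simp]: "mconst 1 = 1"
  by (simp add: mconst_def)

lemma mconst_add: "mconst (a + b) = mconst a + mconst b"
  by (simp add: mconst_def single_add)

lemma mconst_mult: "mconst (a * b) = mconst a * mconst b"
  by (simp add: mconst_def mult_single)

lemma mconst_of_nat [simp]: "mconst (of_nat k) = of_nat k"
  by (simp add: mconst_def)

lemma mconst_uminus: "mconst (- a) = - mconst a"
  by (simp add: mconst_def single_uminus)

lemma mconst_mult_single: "mconst c * Poly_Mapping.single e d = Poly_Mapping.single e (c * d)"
  by (simp add: mconst_def mult_single)

lemma single_conv_mconst: "Poly_Mapping.single e c = mconst c * Poly_Mapping.single e 1"
  by (simp add: mconst_mult_single)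

lemma lookup_mconst_mult:
  "Poly_Mapping.lookup (mconst c * p) e = c * Poly_Mapping.lookup p e"
proof -
  have "mconst c * p = Poly_Mapping.map ((*) c) p"
    by (simp add: mconst_def mult_map_scale_conv_mult)
  then show ?thesis
    by (simp add: Poly_Mapping.map.rep_eq when_def)
qed

lemma sum_single_lookup:
  "(\<Sum>e\<in>Poly_Mapping.keys p. Poly_Mapping.single e (Poly_Mapping.lookup p e)) = p"
  by (rule poly_mapping_eqI) (auto simp: lookup_sum lookup_single when_def in_keys_iff)

text \<open>The case \<open>single\<close> concerns only monomials that occur in \<open>p\<close>,
  so an assumption on the support of \<open>p\<close> stays usable inside the induction.\<close>

lemma mpoly_induct [case_names zero single add]:
  fixes p :: "'a \<Rightarrow>\<^sub>0 'b::comm_monoid_add"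
  assumes "P 0" "\<And>e c. e \<in> Poly_Mapping.keys p \<Longrightarrow> P (Poly_Mapping.single e c)" "\<And>p q. P p \<Longrightarrow> P q \<Longrightarrow> P (p + q)"
  shows "P p"
proof -
  have "P (\<Sum>e\<in>S. Poly_Mapping.single e (f e))" if "finite S" "S \<subseteq> Poly_Mapping.keys p" for S f
    using that by (induction S) (use assms in auto)
  from this[of "Poly_Mapping.keys p" "Poly_Mapping.lookup p"] show ?thesis
    by (simp add: sum_single_lookup)
qed

text \<open>Linear extension of a map on monomials. Substitution, homogeneous components, the
  homotopy \<open>div_least\<close> and the lift \<open>theta\<close> all have this form, so
  linearity is proved once.\<close>

definition lin :: "('a \<Rightarrow> ('u, 'k) mpoly) \<Rightarrow> ('a \<Rightarrow>\<^sub>0 'k) \<Rightarrow> ('u, 'k::comm_ring_1) mpoly" where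
  "lin g p = (\<Sum>e\<in>Poly_Mapping.keys p. mconst (Poly_Mapping.lookup p e) * g e)"

lemma lin_superset:
  assumes "finite S" "Poly_Mapping.keys p \<subseteq> S"
  shows "lin g p = (\<Sum>e\<in>S. mconst (Poly_Mapping.lookup p e) * g e)"
  unfolding lin_def using assms by (intro sum.mono_neutral_left) (auto simp: in_keys_iff)

lemma lin_zero [simp]: "lin g 0 = 0"
  by (simp add: lin_def)

lemma lin_add: "lin g (p + q) = lin g p + lin g q"
proof -
  let ?S = "Poly_Mapping.keys p \<union> Poly_Mapping.keys q"
  show ?thesis
    using keys_add[of p q]
    by (simp add: lin_superset[of ?S] lookup_add mconst_add distrib_right sum.distrib)
qed

lemma lin_single [simp]: "lin g (Poly_Mapping.single e c) = mconst c * g e"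
  by (cases "c = 0") (simp_all add: lin_def)

lemma lin_uminus: "lin g (- p) = - lin g p"
  using lin_add[of g p "- p"] by (simp add: eq_neg_iff_add_eq_0 add.commute)

lemma lin_diff: "lin g (p - q) = lin g p - lin g q"
  using lin_add[of g p "- q"] by (simp add: lin_uminus)

lemma lin_sum: "lin g (\<Sum>i\<in>I. p i) = (\<Sum>i\<in>I. lin g (p i))"
  by (induction I rule: infinite_finite_induct) (simp_all add: lin_add)

lemma lin_mconst_mult: "lin g (mconst c * p) = mconst c * lin g p"
  by (induction p rule: mpoly_induct)
    (simp_all add: mconst_mult_single mconst_mult mult.assoc distrib_left lin_add)

lemma lin_cong:
  "(\<And>e. e \<in> Poly_Mapping.keys p \<Longrightarrow> g e = h e) \<Longrightarrow> lin g p = lin h p"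
  by (simp add: lin_def)

definition mev :: "('v \<Rightarrow> 'a::comm_monoid_mult) \<Rightarrow> 'v monom \<Rightarrow> 'a" where
  "mev f e = (\<Prod>v\<in>Poly_Mapping.keys e. f v ^ Poly_Mapping.lookup e v)"

lemma mev_superset:
  assumes "finite S" "Poly_Mapping.keys e \<subseteq> S"
  shows "mev f e = (\<Prod>v\<in>S. f v ^ Poly_Mapping.lookup e v)"
  unfolding mev_def using assms by (intro prod.mono_neutral_left) (auto simp: in_keys_iff)

lemma mev_zero [simp]: "mev f 0 = 1"
  by (simp add: mev_def)

lemma mev_add: "mev f (a + b) = mev f a * mev f b"
proof -
  let ?S = "Poly_Mapping.keys a \<union> Poly_Mapping.keys b"
  show ?thesis
    using keys_add[of a b]
    by (simp add: mev_superset[of ?S] lookup_add power_add prod.distrib)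
qed

lemma mev_single [simp]: "mev f (Poly_Mapping.single v k) = f v ^ k"
  by (cases "k = 0") (simp_all add: mev_def)

lemma mev_cong: "(\<And>v. v \<in> Poly_Mapping.keys e \<Longrightarrow> f v = g v) \<Longrightarrow> mev f e = mev g e"
  by (simp add: mev_def)

lemma monom_induct [case_names zero add]:
  fixes e :: "'v monom"
  assumes "P 0" "\<And>v e. P e \<Longrightarrow> P (Poly_Mapping.single v 1 + e)"
  shows "P e"
proof (induction e rule: mpoly_induct)
  case (add a b)
  have *: "P (Poly_Mapping.single v k + e)" if "P e" for v e k
    using that
  proof (induction k)
    case (Suc k)
    then show ?case
      using assms(2)[of "Poly_Mapping.single v k + e" v] single_add[of v 1 k] by (simp add: add.assoc)
  qed simp
  have "P (a + e)" if "P e" for e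
    using that
  proof (induction a arbitrary: e rule: mpoly_induct)
    case (add a b)
    then show ?case by (metis add.assoc)
  qed (use * in simp_all)
  with add show ?case by simp
next
  case (single v k)
  show ?case
  proof (induction k)
    case (Suc k)
    then show ?case
      using assms(2)[of "Poly_Mapping.single v k" v] single_add[of v 1 k] by simp
  qed (use assms in simp)
qed (use assms in simp)

lemma msubst_eq_lin: "msubst f p = lin (mev f) p"
  by (simp add: msubst_def lin_def mev_def)

lemma msubst_single: "msubst f (Poly_Mapping.single e c) = mconst c * mev f e"
  by (simp add: msubst_eq_lin)

lemma msubst_add: "msubst f (p + q) = msubst f p + msubst f q"
  by (simp add: msubst_eq_lin lin_add)

lemma msubst_zero [simp]: "msubst f 0 = 0"
  by (simp add: msubst_eq_lin)

lemma msubst_uminus: "msubst f (- p) = - msubst f p"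
  by (simp add: msubst_eq_lin lin_uminus)

lemma msubst_diff: "msubst f (p - q) = msubst f p - msubst f q"
  by (simp add: msubst_eq_lin lin_diff)

lemma msubst_sum: "msubst f (\<Sum>i\<in>I. p i) = (\<Sum>i\<in>I. msubst f (p i))"
  by (simp add: msubst_eq_lin lin_sum)

lemma msubst_mconst [simp]: "msubst f (mconst c) = mconst c"
  by (simp add: mconst_def msubst_single)

lemma msubst_one [simp]: "msubst f 1 = 1"
  using msubst_mconst[of f 1] by simp

lemma msubst_of_nat [simp]: "msubst f (of_nat k) = of_nat k"
  using msubst_mconst[of f "of_nat k"] by simp

lemma msubst_mvar [simp]: "msubst f (mvar v) = f v"
  by (simp add: mvar_def msubst_single)

lemma msubst_mult: "msubst f (p * q) = msubst f p * msubst f q"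
proof (induction p rule: mpoly_induct)
  case (single e c)
  show ?case
    by (induction q rule: mpoly_induct)
      (simp_all add: mult_single msubst_single mev_add mconst_mult distrib_left msubst_add algebra_simps)
qed (simp_all add: distrib_right msubst_add)

lemma msubst_prod: "msubst f (\<Prod>i\<in>I. p i) = (\<Prod>i\<in>I. msubst f (p i))"
  by (induction I rule: infinite_finite_induct) (simp_all add: msubst_mult)

lemma msubst_power: "msubst f (p ^ k) = msubst f p ^ k"
  by (induction k) (simp_all add: msubst_mult)

lemma msubst_mev: "msubst f (mev g e) = mev (\<lambda>v. msubst f (g v)) e"
  by (simp add: mev_def msubst_prod msubst_power)

lemma mev_mvar: "mev mvar e = Poly_Mapping.single e (1::'k::comm_ring_1)"
proof (induction e rule: monom_induct)
  case (add v e)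
  then show ?case
    by (simp add: mev_add mvar_def mult_single)
qed simp

text \<open>Homogeneity, \<open>polys_in\<close> and the weight bounds of the Hilbert ideal are all
  conditions on the occurring monomials, hence instances of this one.\<close>

definition supp_in :: "'a set \<Rightarrow> ('a \<Rightarrow>\<^sub>0 'k::zero) set" where
  "supp_in S = {p. Poly_Mapping.keys p \<subseteq> S}"

lemma supp_in_zero [simp]: "0 \<in> supp_in S"
  by (simp add: supp_in_def)

lemma supp_in_add: "p \<in> supp_in S \<Longrightarrow> q \<in> supp_in S \<Longrightarrow> p + q \<in> supp_in S"
  using keys_add[of p q] by (auto simp: supp_in_def)

lemma supp_in_uminus: "p \<in> supp_in S \<Longrightarrow> - p \<in> supp_in S"
  for p :: "'a \<Rightarrow>\<^sub>0 'k::ab_group_add"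
  by (auto simp: supp_in_def in_keys_iff)

lemma supp_in_diff: "p \<in> supp_in S \<Longrightarrow> q \<in> supp_in S \<Longrightarrow> p - q \<in> supp_in S"
  for p :: "'a \<Rightarrow>\<^sub>0 'k::ab_group_add"
  using supp_in_add[of p S "- q"] supp_in_uminus[of q S] by simp

lemma supp_in_sum: "(\<And>i. i \<in> I \<Longrightarrow> p i \<in> supp_in S) \<Longrightarrow> (\<Sum>i\<in>I. p i) \<in> supp_in S"
  by (induction I rule: infinite_finite_induct) (simp_all add: supp_in_add)

lemma supp_in_single: "e \<in> S \<Longrightarrow> Poly_Mapping.single e c \<in> supp_in S"
  by (simp add: supp_in_def)

lemma supp_in_mult:
  assumes "p \<in> supp_in S" "q \<in> supp_in T" "\<And>a b. a \<in> S \<Longrightarrow> b \<in> T \<Longrightarrow> a + b \<in> U"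
  shows "p * q \<in> supp_in U"
proof -
  have "Poly_Mapping.keys (p * q) \<subseteq> {a + b |a b. a \<in> Poly_Mapping.keys p \<and> b \<in> Poly_Mapping.keys q}"
    by (rule keys_mult)
  also have "\<dots> \<subseteq> U"
    using assms unfolding supp_in_def by blast
  finally show ?thesis
    by (simp add: supp_in_def)
qed

lemma supp_in_mono: "p \<in> supp_in S \<Longrightarrow> S \<subseteq> T \<Longrightarrow> p \<in> supp_in T"
  by (auto simp: supp_in_def)

lemma supp_in_mconst_mult: "p \<in> supp_in S \<Longrightarrow> mconst c * p \<in> supp_in S"
  by (auto simp: supp_in_def in_keys_iff lookup_mconst_mult subset_iff) (metis mult_zero_right)

lemma supp_in_lin: "(\<And>e. e \<in> Poly_Mapping.keys p \<Longrightarrow> g e \<in> supp_in S) \<Longrightarrow> lin g p \<in> supp_in S"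
  unfolding lin_def by (intro supp_in_sum supp_in_mconst_mult) simp

section \<open>Weighted degrees and homogeneous components\<close>

definition wdeg :: "('v \<Rightarrow> nat) \<Rightarrow> 'v monom \<Rightarrow> nat" where
  "wdeg \<omega> e = (\<Sum>v\<in>Poly_Mapping.keys e. Poly_Mapping.lookup e v * \<omega> v)"

lemma wdeg_superset:
  assumes "finite S" "Poly_Mapping.keys e \<subseteq> S"
  shows "wdeg \<omega> e = (\<Sum>v\<in>S. Poly_Mapping.lookup e v * \<omega> v)"
  unfolding wdeg_def using assms by (intro sum.mono_neutral_left) (auto simp: in_keys_iff)

lemma wdeg_zero [simp]: "wdeg \<omega> 0 = 0"
  by (simp add: wdeg_def)

lemma wdeg_add: "wdeg \<omega> (a + b) = wdeg \<omega> a + wdeg \<omega> b"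
proof -
  let ?S = "Poly_Mapping.keys a \<union> Poly_Mapping.keys b"
  show ?thesis
    using keys_add[of a b]
    by (simp add: wdeg_superset[of ?S] lookup_add distrib_right sum.distrib)
qed

lemma wdeg_single [simp]: "wdeg \<omega> (Poly_Mapping.single v k) = k * \<omega> v"
  by (cases "k = 0") (simp_all add: wdeg_def)

lemma mdeg_eq_wdeg: "mdeg e = wdeg (\<lambda>_. 1) e"
  by (simp add: mdeg_def wdeg_def)

lemma mdeg_zero [simp]: "mdeg 0 = 0"
  by (simp add: mdeg_eq_wdeg)

lemma mdeg_add: "mdeg (a + b) = mdeg a + mdeg b"
  by (simp add: mdeg_eq_wdeg wdeg_add)

lemma mdeg_single [simp]: "mdeg (Poly_Mapping.single v k) = k"
  by (simp add: mdeg_eq_wdeg)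

lemma mdeg_sum: "mdeg (\<Sum>i\<in>I. f i) = (\<Sum>i\<in>I. mdeg (f i))"
  by (induction I rule: infinite_finite_induct) (simp_all add: mdeg_add)

lemma mdeg_eq_0_iff [simp]: "mdeg e = 0 \<longleftrightarrow> e = 0"
  by (auto simp: mdeg_def in_keys_iff poly_mapping_eq_iff fun_eq_iff)

text \<open>Degrees are integers so that a degree may be subtracted freely; the only
  polynomial that is homogeneous of a negative degree is \<open>0\<close>.\<close>

definition homog :: "('v \<Rightarrow> nat) \<Rightarrow> int \<Rightarrow> ('v, 'k::comm_ring_1) mpoly set" where
  "homog \<omega> d = supp_in {e. int (wdeg \<omega> e) = d}"

lemma homog_zero [simp]: "0 \<in> homog \<omega> d"
  by (simp add: homog_def)

lemma homog_add: "p \<in> homog \<omega> d \<Longrightarrow> q \<in> homog \<omega> d \<Longrightarrow> p + q \<in> homog \<omega> d"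
  by (simp add: homog_def supp_in_add)

lemma homog_diff: "p \<in> homog \<omega> d \<Longrightarrow> q \<in> homog \<omega> d \<Longrightarrow> p - q \<in> homog \<omega> d"
  by (simp add: homog_def supp_in_diff)

lemma homog_sum: "(\<And>i. i \<in> I \<Longrightarrow> p i \<in> homog \<omega> d) \<Longrightarrow> (\<Sum>i\<in>I. p i) \<in> homog \<omega> d"
  by (simp add: homog_def supp_in_sum)

lemma homog_mult: "p \<in> homog \<omega> d \<Longrightarrow> q \<in> homog \<omega> d' \<Longrightarrow> p * q \<in> homog \<omega> (d + d')"
  unfolding homog_def by (erule supp_in_mult) (auto simp: wdeg_add)

lemma homog_single: "int (wdeg \<omega> e) = d \<Longrightarrow> Poly_Mapping.single e c \<in> homog \<omega> d"
  by (simp add: homog_def supp_in_single)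

lemma homog_mconst: "mconst c \<in> homog \<omega> 0"
  by (simp add: mconst_def homog_single)

lemma homog_one: "1 \<in> homog \<omega> 0"
  using homog_mconst[of 1] by simp

lemma homog_mvar: "mvar v \<in> homog \<omega> (int (\<omega> v))"
  by (simp add: mvar_def homog_single)

lemma homog_negative: "p \<in> homog \<omega> d \<Longrightarrow> d < 0 \<Longrightarrow> p = 0"
  by (auto simp: homog_def supp_in_def keys_eq_empty)

lemma homog_power: "p \<in> homog \<omega> d \<Longrightarrow> p ^ k \<in> homog \<omega> (int k * d)"
proof (induction k)
  case (Suc k)
  then have "p * p ^ k \<in> homog \<omega> (d + int k * d)"
    by (intro homog_mult) auto
  then show ?case
    by (simp add: algebra_simps)
qed (simp add: homog_one)

lemma homog_prod: "(\<And>i. i \<in> I \<Longrightarrow> p i \<in> homog \<omega> (d i)) \<Longrightarrow> (\<Prod>i\<in>I. p i) \<in> homog \<omega> (\<Sum>i\<in>I. d i)"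
  by (induction I rule: infinite_finite_induct) (simp_all add: homog_one homog_mult)

lemma homog_lin: "(\<And>e. e \<in> Poly_Mapping.keys p \<Longrightarrow> g e \<in> homog \<omega> d) \<Longrightarrow> lin g p \<in> homog \<omega> d"
  unfolding homog_def by (rule supp_in_lin)

lemma homog_msubst:
  assumes "p \<in> homog \<omega> d" and f: "\<And>v. f v \<in> homog \<omega>' (int (\<omega> v))"
  shows "msubst f p \<in> homog \<omega>' d"
  unfolding msubst_eq_lin
proof (rule homog_lin)
  fix e assume "e \<in> Poly_Mapping.keys p"
  then have "int (wdeg \<omega> e) = d"
    using assms by (auto simp: homog_def supp_in_def)
  moreover have "mev f e \<in> homog \<omega>' (\<Sum>v\<in>Poly_Mapping.keys e. int (Poly_Mapping.lookup e v) * int (\<omega> v))"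
    unfolding mev_def by (intro homog_prod homog_power f)
  ultimately show "mev f e \<in> homog \<omega>' d"
    by (simp add: wdeg_def)
qed

definition hcomp :: "('v \<Rightarrow> nat) \<Rightarrow> int \<Rightarrow> ('v, 'k::comm_ring_1) mpoly \<Rightarrow> ('v, 'k) mpoly" where
  "hcomp \<omega> d = lin (\<lambda>e. if int (wdeg \<omega> e) = d then Poly_Mapping.single e 1 else 0)"

lemma hcomp_homog [simp]: "hcomp \<omega> d p \<in> homog \<omega> d"
  unfolding hcomp_def by (rule homog_lin) (auto intro: homog_single)

lemma lin_monomials: "lin (\<lambda>e. Poly_Mapping.single e 1) p = p"
  by (induction p rule: mpoly_induct) (simp_all add: lin_add single_conv_mconst[symmetric])

lemma hcomp_id: "p \<in> homog \<omega> d \<Longrightarrow> hcomp \<omega> d p = p"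
proof -
  assume "p \<in> homog \<omega> d"
  then have "hcomp \<omega> d p = lin (\<lambda>e. Poly_Mapping.single e 1) p"
    unfolding hcomp_def by (intro lin_cong) (auto simp: homog_def supp_in_def)
  then show ?thesis
    by (simp add: lin_monomials)
qed

lemma hcomp_other: "p \<in> homog \<omega> d' \<Longrightarrow> d \<noteq> d' \<Longrightarrow> hcomp \<omega> d p = 0"
proof -
  assume "p \<in> homog \<omega> d'" "d \<noteq> d'"
  then have "hcomp \<omega> d p = lin (\<lambda>e. 0) p"
    unfolding hcomp_def by (intro lin_cong) (auto simp: homog_def supp_in_def)
  then show ?thesis
    by (simp add: lin_def)
qed

lemma hcomp_add: "hcomp \<omega> d (p + q) = hcomp \<omega> d p + hcomp \<omega> d q"
  by (simp add: hcomp_def lin_add)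

lemma hcomp_zero [simp]: "hcomp \<omega> d 0 = 0"
  by (simp add: hcomp_def)

lemma hcomp_diff: "hcomp \<omega> d (p - q) = hcomp \<omega> d p - hcomp \<omega> d q"
  by (simp add: hcomp_def lin_diff)

lemma hcomp_sum: "hcomp \<omega> d (\<Sum>i\<in>I. p i) = (\<Sum>i\<in>I. hcomp \<omega> d (p i))"
  by (simp add: hcomp_def lin_sum)

text \<open>Makes coefficients homogeneous: an identity h = sum f_i * c_i with h and all f_i
  homogeneous survives when each c_i is replaced by its component of the complementary
  degree.\<close>

lemma hcomp_mult:
  assumes f: "f \<in> homog \<omega> k"
  shows "hcomp \<omega> d (f * p) = f * hcomp \<omega> (d - k) p"
proof (induction p rule: mpoly_induct)
  case (single e c)
  let ?m = "Poly_Mapping.single e c"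
  have m: "?m \<in> homog \<omega> (int (wdeg \<omega> e))"
    by (simp add: homog_single)
  show ?case
  proof (cases "int (wdeg \<omega> e) = d - k")
    case True
    then show ?thesis
      using m homog_mult[OF f m] by (simp add: hcomp_id)
  next
    case False
    then show ?thesis
      using hcomp_other[OF m, of "d - k"] hcomp_other[OF homog_mult[OF f m], of d] by auto
  qed
next
  case (add p q)
  then show ?case
    by (simp add: distrib_left hcomp_add)
qed (simp add: hcomp_def)

lemma sum_hcomp:
  "(\<Sum>d\<in>(\<lambda>e. int (wdeg \<omega> e)) ` Poly_Mapping.keys p. hcomp \<omega> d p) = p"
proof -
  let ?I = "(\<lambda>e. int (wdeg \<omega> e)) ` Poly_Mapping.keys p"
  have "(\<Sum>d\<in>?I. hcomp \<omega> d p) = (\<Sum>d\<in>?I. \<Sum>e\<in>Poly_Mapping.keys p. mconst (Poly_Mapping.lookup p e) *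
      (if int (wdeg \<omega> e) = d then Poly_Mapping.single e 1 else 0))"
    by (simp add: hcomp_def lin_def)
  also have "\<dots> = (\<Sum>e\<in>Poly_Mapping.keys p. \<Sum>d\<in>?I. mconst (Poly_Mapping.lookup p e) *
      (if int (wdeg \<omega> e) = d then Poly_Mapping.single e 1 else 0))"
    by (rule sum.swap)
  also have "\<dots> = (\<Sum>e\<in>Poly_Mapping.keys p. mconst (Poly_Mapping.lookup p e) * Poly_Mapping.single e 1)"
    by (intro sum.cong[OF refl]) (simp add: sum_distrib_left[symmetric])
  also have "\<dots> = p"
    using lin_monomials[of p] by (simp add: lin_def)
  finally show ?thesis .
qed

lemma keys_hcomp: "Poly_Mapping.keys (hcomp \<omega> d p) \<subseteq> Poly_Mapping.keys p"
proof -
  have "hcomp \<omega> d p \<in> supp_in (Poly_Mapping.keys p)"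
    unfolding hcomp_def by (intro supp_in_lin) (auto intro: supp_in_single)
  then show ?thesis
    by (simp add: supp_in_def)
qed

section \<open>Polynomials in a given set of variables\<close>

lemma polys_in_eq: "polys_in X = supp_in {e. Poly_Mapping.keys e \<subseteq> X}"
  by (auto simp: polys_in_def supp_in_def)

lemma polys_in_add: "p \<in> polys_in X \<Longrightarrow> q \<in> polys_in X \<Longrightarrow> p + q \<in> polys_in X"
  by (simp add: polys_in_eq supp_in_add)

lemma polys_in_uminus: "p \<in> polys_in X \<Longrightarrow> - p \<in> polys_in X"
  by (simp add: polys_in_eq supp_in_uminus)

lemma polys_in_diff: "p \<in> polys_in X \<Longrightarrow> q \<in> polys_in X \<Longrightarrow> p - q \<in> polys_in X"
  by (simp add: polys_in_eq supp_in_diff)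

lemma polys_in_sum: "(\<And>i. i \<in> I \<Longrightarrow> p i \<in> polys_in X) \<Longrightarrow> (\<Sum>i\<in>I. p i) \<in> polys_in X"
  by (simp add: polys_in_eq supp_in_sum)

lemma polys_in_mult:
  fixes p q :: "('v, 'k::comm_ring_1) mpoly"
  shows "p \<in> polys_in X \<Longrightarrow> q \<in> polys_in X \<Longrightarrow> p * q \<in> polys_in X"
  unfolding polys_in_eq
proof (erule supp_in_mult)
  fix a b :: "'v monom"
  assume "a \<in> {e. Poly_Mapping.keys e \<subseteq> X}" "b \<in> {e. Poly_Mapping.keys e \<subseteq> X}"
  then show "a + b \<in> {e. Poly_Mapping.keys e \<subseteq> X}"
    using keys_add[of a b] by auto
qed

lemma polys_in_mconst: "mconst c \<in> polys_in X"
  by (simp add: polys_in_eq mconst_def supp_in_single)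

lemma polys_in_zero: "0 \<in> polys_in X"
  by (simp add: polys_in_eq)

lemma polys_in_one: "1 \<in> polys_in X"
  using polys_in_mconst[of 1] by simp

lemma polys_in_mvar: "v \<in> X \<Longrightarrow> mvar v \<in> polys_in X"
  by (simp add: polys_in_eq mvar_def supp_in_single)

lemma polys_in_hcomp: "p \<in> polys_in X \<Longrightarrow> hcomp \<omega> d p \<in> polys_in X"
  using keys_hcomp[of \<omega> d p] by (auto simp: polys_in_def)

section \<open>Polarized symmetric functions\<close>

lemma part_sum_cong:
  assumes "\<And>s. s \<in> A \<Longrightarrow> w s = w' s"
  shows "part_sum \<tau> A w = part_sum \<tau> A w'"
  unfolding part_sum_def
proof (intro sum.cong prod.cong refl)
  fix P B assume "P \<in> {P. partition_on A P}" "B \<in> P"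
  then have "B \<subseteq> A"
    by (auto simp: partition_on_def)
  then have "(\<Sum>s\<in>B. w s) = (\<Sum>s\<in>B. w' s)"
    using assms by (intro sum.cong) auto
  then show "of_nat (fact (card B - 1)) * \<tau> (\<Sum>s\<in>B. w s) = of_nat (fact (card B - 1)) * \<tau> (\<Sum>s\<in>B. w' s)"
    by simp
qed

text \<open>\<open>T d\<close> models the part of degree d of a graded or filtered ring. Merging two
  arguments as in \<open>part_sum_insert\<close> keeps the total degree, so \<open>\<tau>\<close> is
  evaluated only at sums of arguments, of degree at most \<open>N\<close>; hence the form of the
  assumption on \<open>\<tau>\<close>.\<close>

lemma part_sum_mem_graded:
  fixes T :: "nat \<Rightarrow> 'a::comm_ring_1 set" and deg :: "'b::comm_monoid_add \<Rightarrow> nat"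
  assumes one: "1 \<in> T 0"
    and zero: "\<And>d. 0 \<in> T d"
    and add: "\<And>d p p'. p \<in> T d \<Longrightarrow> p' \<in> T d \<Longrightarrow> p + p' \<in> T d"
    and mult: "\<And>d d' p p'. p \<in> T d \<Longrightarrow> p' \<in> T d' \<Longrightarrow> p * p' \<in> T (d + d')"
    and deg: "\<And>u v. deg (u + v) = deg u + deg v"
    and U: "\<And>u v. u \<in> U \<Longrightarrow> v \<in> U \<Longrightarrow> u + v \<in> U"
    and \<tau>: "\<And>u. u \<in> U \<Longrightarrow> deg u \<le> N \<Longrightarrow> \<tau> u \<in> T (deg u)"
    and A: "finite A" "\<And>s. s \<in> A \<Longrightarrow> w s \<in> U" "(\<Sum>s\<in>A. deg (w s)) \<le> N"
  shows "part_sum \<tau> A w \<in> T (\<Sum>s\<in>A. deg (w s))"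
  using A
proof (induction A arbitrary: w rule: finite_induct)
  case empty
  then show ?case by (simp add: one)
next
  case (insert a A)
  have "part_sum \<tau> A w \<in> T (\<Sum>s\<in>A. deg (w s))"
    using insert by (intro insert.IH) auto
  then have 1: "\<tau> (w a) * part_sum \<tau> A w \<in> T (deg (w a) + (\<Sum>s\<in>A. deg (w s)))"
    using insert by (intro mult \<tau>) auto
  have 2: "part_sum \<tau> A (w(b := w b + w a)) \<in> T (deg (w a) + (\<Sum>s\<in>A. deg (w s)))" if b: "b \<in> A" for b
  proof -
    have "(\<Sum>s\<in>A. deg ((w(b := w b + w a)) s)) = deg (w b + w a) + (\<Sum>s\<in>A - {b}. deg (w s))"
      using insert.hyps b by (subst sum.remove[of A b]) (auto intro!: sum.cong)
    also have "\<dots> = deg (w a) + (\<Sum>s\<in>A. deg (w s))"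
      using insert.hyps b by (simp add: deg sum.remove[of A b "\<lambda>s. deg (w s)"])
    finally have eq: "(\<Sum>s\<in>A. deg ((w(b := w b + w a)) s)) = deg (w a) + (\<Sum>s\<in>A. deg (w s))" .
    have "part_sum \<tau> A (w(b := w b + w a)) \<in> T (\<Sum>s\<in>A. deg ((w(b := w b + w a)) s))"
      using insert.prems insert.hyps b eq by (intro insert.IH) (auto intro: U)
    then show ?thesis by (simp only: eq)
  qed
  have "(\<Sum>b\<in>B. part_sum \<tau> A (w(b := w b + w a))) \<in> T (deg (w a) + (\<Sum>s\<in>A. deg (w s)))" if "B \<subseteq> A" for B
    using finite_subset[OF that insert.hyps(1)] that
    by (induction B rule: finite_induct) (auto intro: zero add 2)
  with 1 show ?case
    using insert.hyps by (simp add: part_sum_insert add)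
qed

text \<open>A partition of a nonempty set has a block, so every product contains a factor
  \<open>\<tau> u\<close>, and merging keeps the degree of u below \<open>N\<close>.\<close>

lemma part_sum_mem_ideal:
  fixes deg :: "'b::comm_monoid_add \<Rightarrow> nat"
  assumes zero: "0 \<in> I" and add: "\<And>p p'. p \<in> I \<Longrightarrow> p' \<in> I \<Longrightarrow> p + p' \<in> I"
    and mult: "\<And>p r. p \<in> I \<Longrightarrow> p * r \<in> I"
    and deg: "\<And>u v. deg (u + v) = deg u + deg v"
    and U: "\<And>u v. u \<in> U \<Longrightarrow> v \<in> U \<Longrightarrow> u + v \<in> U"
    and \<tau>: "\<And>u. u \<in> U \<Longrightarrow> deg u \<le> N \<Longrightarrow> \<tau> u \<in> I"
    and A: "finite A" "A \<noteq> {}" "\<And>s. s \<in> A \<Longrightarrow> w s \<in> U" "(\<Sum>s\<in>A. deg (w s)) \<le> N"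
  shows "part_sum \<tau> A w \<in> I"
  using A
proof (induction A arbitrary: w rule: finite_induct)
  case (insert a A)
  have 1: "\<tau> (w a) * part_sum \<tau> A w \<in> I"
    using insert by (intro mult \<tau>) auto
  have 2: "part_sum \<tau> A (w(b := w b + w a)) \<in> I" if b: "b \<in> A" for b
  proof -
    have "(\<Sum>s\<in>A. deg ((w(b := w b + w a)) s)) = deg (w b + w a) + (\<Sum>s\<in>A - {b}. deg (w s))"
      using insert.hyps b by (subst sum.remove[of A b]) (auto intro!: sum.cong)
    also have "\<dots> = deg (w a) + (\<Sum>s\<in>A. deg (w s))"
      using insert.hyps b by (simp add: deg sum.remove[of A b "\<lambda>s. deg (w s)"])
    finally have eq: "(\<Sum>s\<in>A. deg ((w(b := w b + w a)) s)) = deg (w a) + (\<Sum>s\<in>A. deg (w s))" .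
    show ?thesis
      using insert.prems insert.hyps b eq by (intro insert.IH) (auto intro: U)
  qed
  have "(\<Sum>b\<in>B. part_sum \<tau> A (w(b := w b + w a))) \<in> I" if "B \<subseteq> A" for B
    using finite_subset[OF that insert.hyps(1)] that
    by (induction B rule: finite_induct) (auto intro: zero add 2)
  with 1 show ?case
    using insert.hyps by (simp add: part_sum_insert add)
qed simp

text \<open>The case \<open>\<tau> u = \<Sum>j<k. \<xi> j u\<close> polarizes the recurrence
  $h_r(x_1,\dots,x_{k+1}) = h_r(x_1,\dots,x_k) + x_{k+1} h_{r-1}(x_1,\dots,x_{k+1})$
  of the complete homogeneous symmetric polynomials.\<close>

lemma part_sum_add_character:
  fixes \<tau> \<xi> :: "'b::comm_monoid_add \<Rightarrow> 'a::comm_ring_1"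
  assumes \<xi>: "\<And>u v. \<xi> (u + v) = \<xi> u * \<xi> v" and A: "finite A"
  shows "part_sum (\<lambda>u. \<tau> u + \<xi> u) A w =
    part_sum \<tau> A w + (\<Sum>i\<in>A. \<xi> (w i) * part_sum (\<lambda>u. \<tau> u + \<xi> u) (A - {i}) w)"
  using A
proof (induction A arbitrary: w rule: finite_induct)
  case (insert a A)
  let ?H = "part_sum \<tau>" and ?H' = "part_sum (\<lambda>u. \<tau> u + \<xi> u)"
  define v where "v b = w(b := w b + w a)" for b
  have rec: "?H' (insert a (A - {i})) w =
      (\<tau> (w a) + \<xi> (w a)) * ?H' (A - {i}) w + (\<Sum>b\<in>A - {i}. ?H' (A - {i}) (v b))" for i
    using insert.hyps by (subst part_sum_insert) (auto simp: v_def)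
  have "(\<Sum>b\<in>A. ?H' A (v b)) = (\<Sum>b\<in>A. ?H A (v b)) + (\<Sum>b\<in>A. \<Sum>i\<in>A. \<xi> (v b i) * ?H' (A - {i}) (v b))"
    by (subst insert.IH) (simp add: sum.distrib)
  also have "(\<Sum>b\<in>A. \<Sum>i\<in>A. \<xi> (v b i) * ?H' (A - {i}) (v b)) =
      (\<Sum>i\<in>A. \<Sum>b\<in>A. \<xi> (v b i) * ?H' (A - {i}) (v b))"
    by (rule sum.swap)
  \<comment> \<open>For b = i the merge is invisible on \<open>A - {i}\<close> and multiplicativity
    splits off \<open>\<xi> (w a)\<close>; for the other b the factor \<open>\<xi> (w i)\<close> is
    unchanged. The expression in parentheses is \<open>rec\<close> without its summand in
    \<open>\<tau> (w a)\<close>.\<close>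
  also have "\<dots> = (\<Sum>i\<in>A. \<xi> (w i) * (\<xi> (w a) * ?H' (A - {i}) w + (\<Sum>b\<in>A - {i}. ?H' (A - {i}) (v b))))"
  proof (rule sum.cong[OF refl])
    fix i assume i: "i \<in> A"
    have "?H' (A - {i}) (v i) = ?H' (A - {i}) w"
      by (rule part_sum_cong) (auto simp: v_def)
    moreover have "(\<Sum>b\<in>A - {i}. \<xi> (v b i) * ?H' (A - {i}) (v b)) = (\<Sum>b\<in>A - {i}. \<xi> (w i) * ?H' (A - {i}) (v b))"
      by (intro sum.cong) (auto simp: v_def)
    ultimately show "(\<Sum>b\<in>A. \<xi> (v b i) * ?H' (A - {i}) (v b)) =
        \<xi> (w i) * (\<xi> (w a) * ?H' (A - {i}) w + (\<Sum>b\<in>A - {i}. ?H' (A - {i}) (v b)))"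
      using insert.hyps i
      by (subst sum.remove[of A i]) (simp_all add: v_def \<xi> sum_distrib_left algebra_simps)
  qed
  finally have 1: "(\<Sum>b\<in>A. ?H' A (v b)) = (\<Sum>b\<in>A. ?H A (v b)) +
      (\<Sum>i\<in>A. \<xi> (w i) * (\<xi> (w a) * ?H' (A - {i}) w + (\<Sum>b\<in>A - {i}. ?H' (A - {i}) (v b))))" .
  have 2: "(\<Sum>i\<in>A. \<xi> (w i) * ?H' (insert a A - {i}) w) =
     \<tau> (w a) * (\<Sum>i\<in>A. \<xi> (w i) * ?H' (A - {i}) w) +
     (\<Sum>i\<in>A. \<xi> (w i) * (\<xi> (w a) * ?H' (A - {i}) w + (\<Sum>b\<in>A - {i}. ?H' (A - {i}) (v b))))"
  proof -
    have "insert a A - {i} = insert a (A - {i})" if "i \<in> A" for i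
      using that insert.hyps by auto
    then have "(\<Sum>i\<in>A. \<xi> (w i) * ?H' (insert a A - {i}) w) = (\<Sum>i\<in>A. \<xi> (w i) * ?H' (insert a (A - {i})) w)"
      by (intro sum.cong) auto
    then show ?thesis
      by (simp add: rec sum_distrib_left sum.distrib algebra_simps)
  qed
  have "?H' (insert a A) w = (\<tau> (w a) + \<xi> (w a)) * ?H' A w + (\<Sum>b\<in>A. ?H' A (v b))"
    using insert.hyps by (simp add: part_sum_insert v_def)
  also have "\<dots> = \<tau> (w a) * ?H A w + (\<Sum>b\<in>A. ?H A (v b)) + \<xi> (w a) * ?H' A w +
      (\<Sum>i\<in>A. \<xi> (w i) * ?H' (insert a A - {i}) w)"
    unfolding 1 2 distrib_right by (subst (1) insert.IH) (simp add: algebra_simps)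
  also have "\<dots> = ?H (insert a A) w + (\<Sum>i\<in>insert a A. \<xi> (w i) * ?H' (insert a A - {i}) w)"
    using insert.hyps by (simp add: part_sum_insert v_def)
  finally show ?case .
qed simp

text \<open>For finite \<open>A\<close>, (|B| - 1)! counts the cycles with support B, so this is the
  sum over the permutations of \<open>A\<close> of the sign times the product of
  \<open>\<tau>\<close> over the cycles.\<close>

definition inj_sum :: "('b::comm_monoid_add \<Rightarrow> 'a::comm_ring_1) \<Rightarrow> 'i set \<Rightarrow> ('i \<Rightarrow> 'b) \<Rightarrow> 'a" where
  "inj_sum \<tau> A w = (-1) ^ card A * part_sum (\<lambda>u. - \<tau> u) A w"

lemma inj_sum_empty [simp]: "inj_sum \<tau> {} w = 1"
  by (simp add: inj_sum_def)

text \<open>Inclusion-exclusion, if \<open>\<tau>\<close> is read as a sum of characters: the image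
  of \<open>a\<close> is chosen freely, then the choices that hit the image of some b are removed,
  and these amount to merging the arguments of a and b.\<close>

lemma inj_sum_insert:
  assumes "finite A" "a \<notin> A"
  shows "inj_sum \<tau> (insert a A) w =
    \<tau> (w a) * inj_sum \<tau> A w - (\<Sum>b\<in>A. inj_sum \<tau> A (w(b := w b + w a)))"
  using assms by (simp add: inj_sum_def part_sum_insert sum_distrib_left algebra_simps sum_negf)

lemma inj_sum_cong: "(\<And>s. s \<in> A \<Longrightarrow> w s = w' s) \<Longrightarrow> inj_sum \<tau> A w = inj_sum \<tau> A w'"
  by (simp add: inj_sum_def cong: part_sum_cong)

lemma Psi_eq_inj_sum: "Psi n w = (-1) ^ (n + 1) * inj_sum mvar {1..n+1} w"
proof -
  have "Psi n w = part_sum (\<lambda>u. - mvar u) {1..n+1} w"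
    unfolding Psi_def part_sum_def
    by (intro sum.cong refl) (simp add: prod.distrib[symmetric] prod_constant[symmetric] del: prod_constant)
  then show ?thesis
    by (simp add: inj_sum_def mult.assoc[symmetric] power_add[symmetric])
qed

lemma msubst_inj_sum:
  assumes "finite A"
  shows "msubst f (inj_sum \<tau> A w) = inj_sum (\<lambda>u. msubst f (\<tau> u)) A w"
  using assms
  by (induction A arbitrary: w rule: finite_induct)
    (simp_all add: inj_sum_insert msubst_diff msubst_mult msubst_sum)

lemma inj_sum_agree:
  assumes "finite A" "\<And>s. s \<in> A \<Longrightarrow> w s \<in> U" "\<And>u v. u \<in> U \<Longrightarrow> v \<in> U \<Longrightarrow> u + v \<in> U"
    and "\<And>u. u \<in> U \<Longrightarrow> \<tau> u = \<tau>' u"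
  shows "inj_sum \<tau> A w = inj_sum \<tau>' A w"
  using assms(1,2)
proof (induction A arbitrary: w rule: finite_induct)
  case (insert a A)
  have "inj_sum \<tau> A (w(b := w b + w a)) = inj_sum \<tau>' A (w(b := w b + w a))" if "b \<in> A" for b
    using insert that assms(3) by (intro insert.IH) auto
  with insert show ?case
    by (simp add: inj_sum_insert assms(4))
qed simp

lemma inj_sum_mem_graded:
  fixes T :: "nat \<Rightarrow> 'a::comm_ring_1 set" and deg :: "'b::comm_monoid_add \<Rightarrow> nat"
  assumes one: "1 \<in> T 0"
    and diff: "\<And>d p p'. p \<in> T d \<Longrightarrow> p' \<in> T d \<Longrightarrow> p - p' \<in> T d" and zero: "\<And>d. 0 \<in> T d"
    and mult: "\<And>d d' p p'. p \<in> T d \<Longrightarrow> p' \<in> T d' \<Longrightarrow> p * p' \<in> T (d + d')"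
    and deg: "\<And>u v. deg (u + v) = deg u + deg v"
    and U: "\<And>u v. u \<in> U \<Longrightarrow> v \<in> U \<Longrightarrow> u + v \<in> U"
    and \<tau>: "\<And>u. u \<in> U \<Longrightarrow> deg u \<le> N \<Longrightarrow> \<tau> u \<in> T (deg u)"
    and A: "finite A" "\<And>s. s \<in> A \<Longrightarrow> w s \<in> U" "(\<Sum>s\<in>A. deg (w s)) \<le> N"
  shows "inj_sum \<tau> A w \<in> T (\<Sum>s\<in>A. deg (w s))"
proof -
  have neg: "- p \<in> T d" if "p \<in> T d" for p d
    using diff[OF zero that] by simp
  have add: "p + p' \<in> T d" if "p \<in> T d" "p' \<in> T d" for p p' d
    using diff[OF that(1) neg[OF that(2)]] by simp
  have "part_sum (\<lambda>u. - \<tau> u) A w \<in> T (\<Sum>s\<in>A. deg (w s))"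
    by (rule part_sum_mem_graded[where U = U and N = N]) (use assms neg add in auto)
  moreover have "(-1) ^ k * p \<in> T d" if "p \<in> T d" for k p d
    by (induction k) (use that neg in auto)
  ultimately show ?thesis
    by (simp add: inj_sum_def)
qed

text \<open>Merging with a zero argument changes nothing, so the recursion yields the factor
  \<open>\<tau> 0 - (card A - 1)\<close>. For n + 1 arguments and \<open>\<tau> 0 = n\<close> this
  disposes of the expressions with an argument 1, which are not among the Psi.\<close>

lemma inj_sum_weight_zero:
  assumes "finite A" "a \<in> A" "w a = 0" "\<tau> 0 = of_nat (card A - 1)"
  shows "inj_sum \<tau> A w = 0"
proof -
  have "inj_sum \<tau> (insert a (A - {a})) w = 0"
    using assms by (subst inj_sum_insert) auto
  with assms show ?thesis by (simp add: insert_absorb)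
qed

text \<open>The value is the falling factorial n (n - 1) ... (n - card A + 1), written without
  division. It is what normalizes \<open>theta\<close>.\<close>

lemma inj_sum_all_zero:
  fixes \<tau> :: "'b::comm_monoid_add \<Rightarrow> 'a::comm_ring_1" and A :: "'i set"
  assumes "finite A" "\<tau> 0 = of_nat n" "card A \<le> n"
  shows "inj_sum \<tau> A (\<lambda>_. 0) * of_nat (fact (n - card A)) = of_nat (fact n)"
  using assms
proof (induction A rule: finite_induct)
  case (insert a A)
  have upd: "(\<lambda>_. 0 :: 'b)(b := 0 + 0) = (\<lambda>_. 0)" for b :: 'i
    by auto
  have "inj_sum \<tau> (insert a A) (\<lambda>_. 0) = (of_nat n - of_nat (card A)) * inj_sum \<tau> A (\<lambda>_. 0)"
    using insert upd by (simp add: inj_sum_insert algebra_simps fun_upd_idem)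
  also have "of_nat n - of_nat (card A) = (of_nat (n - card A) :: 'a)"
    using insert by (simp add: of_nat_diff)
  finally have "inj_sum \<tau> (insert a A) (\<lambda>_. 0) * of_nat (fact (n - card (insert a A))) =
      inj_sum \<tau> A (\<lambda>_. 0) * of_nat ((n - card A) * fact (n - card (insert a A)))"
    unfolding of_nat_mult by (simp only: ac_simps)
  also have "(n - card A) * fact (n - card (insert a A)) = (fact (n - card A) :: nat)"
    using insert fact_reduce[of "n - card A", where 'a = nat] by (simp add: of_nat_id)
  finally show ?case
    using insert by simp
qed simp

text \<open>An injection on \<open>insert a A\<close> is an injection f on \<open>A\<close> with a
  value j outside its image. Summing over all j and subtracting j = f b gives the recursion of
  \<open>inj_sum_insert\<close>, since \<open>\<xi>\<close> being multiplicative turns the extra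
  factor at f b into a merge of the arguments of a and b.\<close>

lemma inj_sum_eq_sum_injections:
  fixes \<xi> :: "'n::finite \<Rightarrow> 'b::comm_monoid_add \<Rightarrow> 'a::comm_ring_1" and A :: "'i set"
  assumes \<xi>: "\<And>j u v. \<xi> j (u + v) = \<xi> j u * \<xi> j v" and A: "finite A"
  shows "inj_sum (\<lambda>u. \<Sum>j\<in>UNIV. \<xi> j u) A w =
    (\<Sum>f\<in>{f \<in> A \<rightarrow>\<^sub>E UNIV. inj_on f A}. \<Prod>i\<in>A. \<xi> (f i) (w i))"
  using A
proof (induction A arbitrary: w rule: finite_induct)
  case empty
  have "{f \<in> {} \<rightarrow>\<^sub>E (UNIV :: 'n set). inj_on f {}} = {\<lambda>_. undefined}"
    by auto
  then show ?case by simp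
next
  case (insert a A)
  define S where "S = {f \<in> A \<rightarrow>\<^sub>E (UNIV :: 'n set). inj_on f A}"
  have fS: "finite S"
    using insert.hyps by (simp add: S_def finite_PiE)
  define g where "g f = (\<Prod>i\<in>A. \<xi> (f i) (w i))" for f
  have "(\<Sum>f\<in>{f \<in> insert a A \<rightarrow>\<^sub>E UNIV. inj_on f (insert a A)}. \<Prod>i\<in>insert a A. \<xi> (f i) (w i)) =
      (\<Sum>(f, j)\<in>(SIGMA f:S. - f ` A). \<xi> j (w a) * g f)"
  proof (rule sum.reindex_bij_witness[of _ "\<lambda>(f, j). f(a := j)" "\<lambda>f. (f(a := undefined), f a)"])
    fix f :: "'i \<Rightarrow> 'n" assume "f \<in> {f \<in> insert a A \<rightarrow>\<^sub>E UNIV. inj_on f (insert a A)}"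
    then have f: "f \<in> insert a A \<rightarrow>\<^sub>E UNIV" "inj_on f (insert a A)"
      by auto
    show "(case (f(a := undefined), f a) of (f, j) \<Rightarrow> f(a := j)) = f"
      by simp
    have im: "(f(a := undefined)) ` A = f ` A"
      using insert.hyps by (intro image_cong) auto
    have "inj_on (f(a := undefined)) A"
      using f(2) insert.hyps by (auto simp: inj_on_def)
    then show "(f(a := undefined), f a) \<in> (SIGMA f:S. - f ` A)"
      using f insert.hyps im by (auto simp: S_def PiE_def extensional_def)
    have "g (f(a := undefined)) = g f"
      unfolding g_def using insert.hyps by (intro prod.cong) auto
    then show "(case (f(a := undefined), f a) of (f, j) \<Rightarrow> \<xi> j (w a) * g f) = (\<Prod>i\<in>insert a A. \<xi> (f i) (w i))"
      using insert.hyps by (simp add: g_def)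
  next
    fix x assume "x \<in> (SIGMA f:S. - f ` A)"
    then obtain f j where x: "x = (f, j)" and f: "f \<in> A \<rightarrow>\<^sub>E UNIV" "inj_on f A" and j: "j \<notin> f ` A"
      by (auto simp: S_def)
    show "((case x of (f, j) \<Rightarrow> f(a := j))(a := undefined), (case x of (f, j) \<Rightarrow> f(a := j)) a) = x"
      using f insert.hyps by (auto simp: x PiE_def extensional_def fun_eq_iff)
    have "inj_on (f(a := j)) (insert a A)"
      using f j insert.hyps by (auto simp: inj_on_def)
    then show "(case x of (f, j) \<Rightarrow> f(a := j)) \<in> {f \<in> insert a A \<rightarrow>\<^sub>E UNIV. inj_on f (insert a A)}"
      using f by (auto simp: x PiE_def extensional_def)
  qed
  also have "\<dots> = (\<Sum>f\<in>S. \<Sum>j\<in>- f ` A. \<xi> j (w a) * g f)"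
    using fS by (subst sum.Sigma) auto
  also have "\<dots> = (\<Sum>f\<in>S. (\<Sum>j\<in>UNIV. \<xi> j (w a)) * g f - (\<Sum>b\<in>A. \<xi> (f b) (w a) * g f))"
  proof (rule sum.cong[OF refl])
    fix f assume f: "f \<in> S"
    have "(\<Sum>b\<in>A. \<xi> (f b) (w a) * g f) = (\<Sum>j\<in>f ` A. \<xi> j (w a) * g f)"
      using f by (subst sum.reindex) (auto simp: S_def)
    moreover have "(\<Sum>j\<in>UNIV. \<xi> j (w a) * g f) = (\<Sum>j\<in>- f ` A. \<xi> j (w a) * g f) + (\<Sum>j\<in>f ` A. \<xi> j (w a) * g f)"
      by (subst sum.union_disjoint[symmetric]) (auto simp: Compl_partition2)
    ultimately show "(\<Sum>j\<in>- f ` A. \<xi> j (w a) * g f) = (\<Sum>j\<in>UNIV. \<xi> j (w a)) * g f - (\<Sum>b\<in>A. \<xi> (f b) (w a) * g f)"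
      by (simp add: sum_distrib_right)
  qed
  also have "\<dots> = (\<Sum>j\<in>UNIV. \<xi> j (w a)) * (\<Sum>f\<in>S. g f) - (\<Sum>b\<in>A. \<Sum>f\<in>S. \<xi> (f b) (w a) * g f)"
    by (simp add: sum_subtractf sum_distrib_left sum.swap[of _ A S])
  also have "(\<Sum>b\<in>A. \<Sum>f\<in>S. \<xi> (f b) (w a) * g f) =
      (\<Sum>b\<in>A. inj_sum (\<lambda>u. \<Sum>j\<in>UNIV. \<xi> j u) A (w(b := w b + w a)))"
  proof (rule sum.cong[OF refl])
    fix b assume b: "b \<in> A"
    have "\<xi> (f b) (w a) * g f = (\<Prod>i\<in>A. \<xi> (f i) ((w(b := w b + w a)) i))" for f
    proof -
      have "(\<Prod>i\<in>A. \<xi> (f i) ((w(b := w b + w a)) i)) =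
          \<xi> (f b) (w b + w a) * (\<Prod>i\<in>A - {b}. \<xi> (f i) (w i))"
        using insert.hyps b by (subst prod.remove[of A b]) (auto intro!: prod.cong)
      also have "\<dots> = \<xi> (f b) (w a) * g f"
        using insert.hyps b by (simp add: g_def \<xi> prod.remove[of A b "\<lambda>i. \<xi> (f i) (w i)"] ac_simps)
      finally show ?thesis by simp
    qed
    then show "(\<Sum>f\<in>S. \<xi> (f b) (w a) * g f) = inj_sum (\<lambda>u. \<Sum>j\<in>UNIV. \<xi> j u) A (w(b := w b + w a))"
      by (simp add: insert.IH S_def)
  qed
  finally show ?case
    using insert.hyps by (simp add: inj_sum_insert insert.IH S_def g_def)
qed

lemma inj_sum_vanishes:
  fixes \<xi> :: "'n::finite \<Rightarrow> 'b::comm_monoid_add \<Rightarrow> 'a::comm_ring_1" and A :: "'i set"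
  assumes \<xi>: "\<And>j u v. \<xi> j (u + v) = \<xi> j u * \<xi> j v" and A: "finite A" "CARD('n) < card A"
  shows "inj_sum (\<lambda>u. \<Sum>j\<in>UNIV. \<xi> j u) A w = 0"
proof -
  have "\<not> inj_on f A" for f :: "'i \<Rightarrow> 'n"
    using A card_inj_on_le[of f A UNIV] by auto
  then show ?thesis
    using \<xi> A by (simp add: inj_sum_eq_sum_injections)
qed

section \<open>Syzygies and the Koszul complex\<close>

abbreviation xpow :: "'v monom \<Rightarrow> ('v, 'k::comm_ring_1) mpoly" where
  "xpow e \<equiv> Poly_Mapping.single e 1"

lemma mvar_mult_single: "mvar a * Poly_Mapping.single e c = Poly_Mapping.single (Poly_Mapping.single a 1 + e) c"
  by (simp add: mvar_def mult_single)

lemma single_1_add_minus: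
  fixes e :: "'v monom"
  assumes "Poly_Mapping.lookup e a \<noteq> 0"
  shows "Poly_Mapping.single a 1 + (e - Poly_Mapping.single a 1) = e"
  using assms by (intro poly_mapping_eqI) (auto simp: lookup_add lookup_minus lookup_single when_def)

text \<open>Division by the least variable of a monomial, the contracting homotopy of the
  Koszul complex of the variables.\<close>

definition div_least :: "('v \<Rightarrow> nat) \<Rightarrow> 'v \<Rightarrow> ('v, 'k::comm_ring_1) mpoly \<Rightarrow> ('v, 'k) mpoly" where
  "div_least ord a = lin (\<lambda>e.
    if Poly_Mapping.lookup e a \<noteq> 0 \<and> (\<forall>b. ord b < ord a \<longrightarrow> Poly_Mapping.lookup e b = 0)
    then xpow (e - Poly_Mapping.single a 1) else 0)"

text \<open>Checked on a monomial m. A factor \<open>b\<close> does not affect whether a smaller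
  \<open>a\<close> is the least variable, and it prevents any larger \<open>a\<close> from being so.
  For \<open>a = b\<close>, dividing x_b * m returns m unless a smaller variable divides m; in that
  case exactly one c is the least variable of m, and the subtracted sum equals m.\<close>

lemma div_least_mvar_mult:
  fixes ord :: "'v::finite \<Rightarrow> nat" and p :: "('v, 'k::comm_ring_1) mpoly"
  assumes ord: "inj ord"
  shows "div_least ord a (mvar b * p) =
    (if ord a < ord b then mvar b * div_least ord a p
     else if a = b then p - (\<Sum>c | ord c < ord b. mvar c * div_least ord c p) else 0)"
proof (induction p rule: mpoly_induct)
  case zero
  then show ?case by (simp add: div_least_def)
next
  case (add p q)
  then show ?case
    by (simp add: div_least_def distrib_left lin_add sum.distrib)
next
  case (single e k)
  let ?x = "\<lambda>a. Poly_Mapping.single a (1::nat)"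
  define least where "least e a \<longleftrightarrow> Poly_Mapping.lookup e a \<noteq> 0 \<and>
    (\<forall>b. ord b < ord a \<longrightarrow> Poly_Mapping.lookup e b = 0)" for a and e :: "'v monom"
  have D: "div_least ord a (Poly_Mapping.single e k) =
      (if least e a then Poly_Mapping.single (e - ?x a) k else 0)" for a and e :: "'v monom"
    by (auto simp: div_least_def least_def mconst_mult_single)
  have least_unique: "c = c'" if "least e c" "least e c'" for c c'
    using that ord by (metis least_def injD linorder_neqE_nat)
  consider "ord a < ord b" | "a = b" | "ord b < ord a"
    using ord by (metis injD linorder_neqE_nat)
  then show ?case
  proof cases
    case 1
    then have "a \<noteq> b" by auto
    then have "least (?x b + e) a \<longleftrightarrow> least e a"
      using 1 by (auto simp: least_def lookup_add lookup_single when_def)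
    moreover have "?x b + e - ?x a = ?x b + (e - ?x a)" if "least e a"
      using that \<open>a \<noteq> b\<close>
      by (intro poly_mapping_eqI) (auto simp: least_def lookup_add lookup_minus lookup_single when_def)
    ultimately show ?thesis
      using 1 by (auto simp: mvar_mult_single D simp del: One_nat_def)
  next
    case 3
    then have "\<not> least (?x b + e) a"
      by (auto simp: least_def lookup_add lookup_single when_def)
    then show ?thesis
      using 3 by (auto simp: mvar_mult_single D simp del: One_nat_def)
  next
    case 2
    have l: "least (?x b + e) b \<longleftrightarrow> (\<forall>c. ord c < ord b \<longrightarrow> Poly_Mapping.lookup e c = 0)"
      by (auto simp: least_def lookup_add lookup_single when_def)
    have S: "(\<Sum>c | ord c < ord b. mvar c * div_least ord c (Poly_Mapping.single e k)) =
        (if \<exists>c. ord c < ord b \<and> least e c then Poly_Mapping.single e k else 0)"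
    proof (cases "\<exists>c. ord c < ord b \<and> least e c")
      case True
      then obtain c where c: "ord c < ord b" "least e c"
        by blast
      have "mvar d * div_least ord d (Poly_Mapping.single e k) =
          (if d = c then Poly_Mapping.single e k else 0)" for d
      proof (cases "d = c")
        case True
        then show ?thesis
          using c by (simp add: D mvar_mult_single single_1_add_minus least_def del: One_nat_def)
      next
        case False
        then have "\<not> least e d"
          using least_unique c by blast
        then show ?thesis
          using False by (simp add: D)
      qed
      then show ?thesis
        using True c by simp
    next
      case False
      then have "mvar c * div_least ord c (Poly_Mapping.single e k) = 0" if "ord c < ord b" for c
        using that by (auto simp: D)
      then have "(\<Sum>c | ord c < ord b. mvar c * div_least ord c (Poly_Mapping.single e k)) = 0"
        by (intro sum.neutral) simp
      then show ?thesis
        by (simp only: False if_False)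
    qed
    have "least (?x b + e) b \<longleftrightarrow> \<not> (\<exists>c. ord c < ord b \<and> least e c)"
    proof
      assume R: "\<not> (\<exists>c. ord c < ord b \<and> least e c)"
      show "least (?x b + e) b"
      proof (rule ccontr)
        assume "\<not> least (?x b + e) b"
        then obtain c where "ord c < ord b \<and> Poly_Mapping.lookup e c \<noteq> 0"
          using l by auto
        from ex_has_least_nat[of "\<lambda>c. ord c < ord b \<and> Poly_Mapping.lookup e c \<noteq> 0" c ord, OF this]
        obtain c where "ord c < ord b" "Poly_Mapping.lookup e c \<noteq> 0"
          "\<And>d. ord d < ord b \<and> Poly_Mapping.lookup e d \<noteq> 0 \<Longrightarrow> ord c \<le> ord d"
          by blast
        then have "least e c"
          unfolding least_def by (meson leD order.strict_trans)
        then show False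
          using R \<open>ord c < ord b\<close> by blast
      qed
    qed (unfold l, auto simp: least_def)
    moreover have "?x b + e - ?x b = e"
      by simp
    ultimately have "div_least ord b (mvar b * Poly_Mapping.single e k) =
        (if \<exists>c. ord c < ord b \<and> least e c then 0 else Poly_Mapping.single e k)"
      unfolding mvar_mult_single D by (simp only: add_diff_cancel_left' not_not if_not_P split: if_split) blast
    then show ?thesis
      using 2 S by (cases "\<exists>c. ord c < ord b \<and> least e c") simp_all
  qed
qed

text \<open>Applying \<open>div_least ord a\<close> to the relation and solving for
  \<open>g a\<close> gives the coefficients: the quotients of \<open>g a\<close> by the smaller
  variables, minus those of the \<open>g b\<close> with b above a by the variable a. Letting
  \<open>k a b\<close> vanish unless b is below a puts both kinds into one antisymmetric
  difference.\<close>

lemma koszul_exact: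
  fixes g :: "'v::finite \<Rightarrow> ('v, 'k::comm_ring_1) mpoly"
  assumes "(\<Sum>b\<in>UNIV. mvar b * g b) = 0"
  obtains k where "\<And>a. g a = (\<Sum>b\<in>UNIV. mvar b * (k a b - k b a))"
proof -
  obtain ord :: "'v \<Rightarrow> nat" where ord: "inj ord"
    using finite_imp_inj_to_nat_seg[of "UNIV :: 'v set"] by auto
  define k where "k a b = (if ord b < ord a then div_least ord b (g a) else 0)" for a b
  have "g a = (\<Sum>b\<in>UNIV. mvar b * (k a b - k b a))" for a
  proof -
    have lt: "ord b < ord a \<Longrightarrow> \<not> ord a < ord b" for b
      by simp
    have "0 = div_least ord a (\<Sum>b\<in>UNIV. mvar b * g b)"
      by (simp add: assms div_least_def)
    also have "\<dots> = (\<Sum>b\<in>UNIV. div_least ord a (mvar b * g b))"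
      by (simp add: div_least_def lin_sum)
    also have "\<dots> = (\<Sum>b\<in>UNIV. (if ord a < ord b then mvar b * div_least ord a (g b) else 0) +
        (if a = b then g a - (\<Sum>c | ord c < ord a. mvar c * div_least ord c (g a)) else 0))"
      by (intro sum.cong) (auto simp: div_least_mvar_mult[OF ord])
    also have "\<dots> = (\<Sum>b\<in>UNIV. mvar b * k b a) + (g a - (\<Sum>c | ord c < ord a. mvar c * div_least ord c (g a)))"
      by (auto simp: sum.distrib k_def intro!: sum.cong)
    also have "(\<Sum>c | ord c < ord a. mvar c * div_least ord c (g a)) = (\<Sum>b\<in>UNIV. mvar b * k a b)"
      by (intro sum.mono_neutral_cong_left) (auto simp: k_def)
    finally show ?thesis
      by (simp add: right_diff_distrib sum_subtractf algebra_simps)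
  qed
  then show ?thesis by (rule that)
qed

section \<open>Homogeneous syzygies of the generators of an ideal\<close>

definition std :: "'v \<Rightarrow> nat" where
  "std v = 1"

lemma wdeg_std: "wdeg std e = mdeg e"
  by (simp add: wdeg_def mdeg_def std_def)

abbreviation hom_std :: "int \<Rightarrow> ('v, 'k::comm_ring_1) mpoly set" where
  "hom_std \<equiv> homog std"

lemma hom_mvar: "mvar v \<in> hom_std 1"
  using homog_mvar[of v std] by (simp add: std_def)

lemma hom_as_sum_mvar_mult:
  fixes p :: "('v::finite, 'k::comm_ring_1) mpoly"
  assumes p: "p \<in> hom_std d" "d \<ge> 1"
  obtains r where "p = (\<Sum>a\<in>UNIV. mvar a * r a)" "\<And>a. r a \<in> hom_std (d - 1)"
proof -
  define c :: "'v monom \<Rightarrow> 'v" where "c e = (SOME a. Poly_Mapping.lookup e a \<noteq> 0)" for e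
  have c: "Poly_Mapping.lookup e (c e) \<noteq> 0" if "e \<in> Poly_Mapping.keys p" for e
  proof -
    have "int (wdeg std e) = d"
      using p that by (auto simp: homog_def supp_in_def)
    then have "e \<noteq> 0"
      using p by auto
    then have "\<exists>a. Poly_Mapping.lookup e a \<noteq> 0"
      by (metis lookup_zero poly_mapping_eqI)
    then show ?thesis
      unfolding c_def by (rule someI_ex)
  qed
  define r where "r a = lin (\<lambda>e. if a = c e then xpow (e - Poly_Mapping.single a 1) else 0) p" for a
  have "(\<Sum>a\<in>UNIV. mvar a * r a) = (\<Sum>a\<in>UNIV. \<Sum>e\<in>Poly_Mapping.keys p. mconst (Poly_Mapping.lookup p e) *
      (if a = c e then mvar a * xpow (e - Poly_Mapping.single a 1) else 0))"
    by (auto simp: r_def lin_def sum_distrib_left ac_simps intro!: sum.cong)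
  also have "\<dots> = (\<Sum>e\<in>Poly_Mapping.keys p. \<Sum>a\<in>UNIV. mconst (Poly_Mapping.lookup p e) *
      (if a = c e then mvar a * xpow (e - Poly_Mapping.single a 1) else 0))"
    by (rule sum.swap)
  also have "\<dots> = (\<Sum>e\<in>Poly_Mapping.keys p. mconst (Poly_Mapping.lookup p e) * xpow e)"
    using c by (intro sum.cong refl)
      (simp add: sum_distrib_left[symmetric] mvar_mult_single single_1_add_minus del: One_nat_def)
  also have "\<dots> = p"
    using lin_monomials[of p] by (simp add: lin_def)
  finally have eq: "p = (\<Sum>a\<in>UNIV. mvar a * r a)"
    by simp
  have "p = hcomp std d p"
    using p by (simp add: hcomp_id)
  also have "\<dots> = (\<Sum>a\<in>UNIV. mvar a * hcomp std (d - 1) (r a))"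
    by (subst eq) (simp add: hcomp_sum hcomp_mult[OF hom_mvar])
  finally show ?thesis
    by (rule that) simp
qed

text \<open>Lets coefficients be corrected by an antisymmetric combination without changing the sum,
  once for the variables in \<open>syz_step\<close> and once for the t(w) in
  \<open>kernel_homogeneous\<close>.\<close>

lemma sum_sum_antisymmetric:
  fixes x :: "'a \<Rightarrow> 'b::comm_ring_1"
  shows "(\<Sum>a\<in>A. \<Sum>b\<in>A. x a * (x b * (c a b - c b a))) = 0"
proof -
  have "(\<Sum>a\<in>A. \<Sum>b\<in>A. x a * (x b * c b a)) = (\<Sum>b\<in>A. \<Sum>a\<in>A. x a * (x b * c b a))"
    by (rule sum.swap)
  also have "\<dots> = (\<Sum>a\<in>A. \<Sum>b\<in>A. x a * (x b * c a b))"
    by (simp add: ac_simps)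
  finally show ?thesis
    by (simp add: right_diff_distrib sum_subtractf)
qed

text \<open>\<open>e\<close> bounds the degrees of the quotient by the ideal generated by the \<open>f w\<close>.\<close>

locale graded_ideal =
  fixes W :: "'w set" and f :: "'w \<Rightarrow> ('v::finite, 'k::comm_ring_1) mpoly"
    and deg :: "'w \<Rightarrow> int" and e :: int
  assumes finite_W: "finite W"
    and f_hom: "w \<in> W \<Longrightarrow> f w \<in> hom_std (deg w)"
    and deg_le: "w \<in> W \<Longrightarrow> deg w \<le> e + 2"
    and ideal: "h \<in> hom_std d \<Longrightarrow> e < d \<Longrightarrow> \<exists>c. h = (\<Sum>w\<in>W. f w * c w)"
begin

lemma ideal_hom:
  assumes "h \<in> hom_std d" "e < d"
  obtains c where "h = (\<Sum>w\<in>W. f w * c w)" "\<And>w. c w \<in> hom_std (d - deg w)"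
proof -
  obtain c where c: "h = (\<Sum>w\<in>W. f w * c w)"
    using ideal assms by blast
  have "h = hcomp std d h"
    using assms by (simp add: hcomp_id)
  also have "\<dots> = (\<Sum>w\<in>W. f w * hcomp std (d - deg w) (c w))"
    by (subst c) (auto simp: hcomp_sum hcomp_mult[OF f_hom] intro!: sum.cong)
  finally show ?thesis
    by (rule that) simp
qed

definition syz :: "int \<Rightarrow> ('w \<Rightarrow> ('v, 'k) mpoly) set" where
  "syz d = {u. (\<forall>w\<in>W. u w \<in> hom_std (d - deg w)) \<and> (\<Sum>w\<in>W. f w * u w) = 0}"

definition koszul :: "('w \<Rightarrow> ('v, 'k) mpoly) set" where
  "koszul = {u. \<exists>a. \<forall>w\<in>W. u w = (\<Sum>w'\<in>W. (a w w' - a w' w) * f w')}"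

text \<open>The first syzygies are generated in degrees at most \<open>e + 2\<close>, by
  exactness of the Koszul complex of the variables.\<close>

lemma syz_step:
  assumes u: "u \<in> syz d" and d: "e + 3 \<le> d"
  obtains s where "\<And>a. s a \<in> syz (d - 1)" "\<And>w. w \<in> W \<Longrightarrow> u w = (\<Sum>a\<in>UNIV. mvar a * s a w)"
proof -
  have "\<forall>w\<in>W. \<exists>r. u w = (\<Sum>a\<in>UNIV. mvar a * r a) \<and> (\<forall>a. r a \<in> hom_std (d - 1 - deg w))"
  proof
    fix w assume that: "w \<in> W"
    \<comment> \<open>As \<open>deg w \<le> e + 2 < d\<close>, the entry has positive degree and is
      a combination of the variables.\<close>
    have "u w \<in> hom_std (d - deg w)" "d - deg w \<ge> 1"
      using u d that deg_le[OF that] by (auto simp: syz_def)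
    then obtain r where "u w = (\<Sum>a\<in>UNIV. mvar a * r a)" "\<And>a. r a \<in> hom_std (d - deg w - 1)"
      by (rule hom_as_sum_mvar_mult) blast
    moreover have "d - deg w - 1 = d - 1 - deg w"
      by simp
    ultimately show "\<exists>r. u w = (\<Sum>a\<in>UNIV. mvar a * r a) \<and> (\<forall>a. r a \<in> hom_std (d - 1 - deg w))"
      by metis
  qed
  from bchoice[OF this] obtain r where r': "\<forall>w\<in>W. u w = (\<Sum>a\<in>UNIV. mvar a * r w a) \<and>
      (\<forall>a. r w a \<in> hom_std (d - 1 - deg w))" ..
  then have r: "\<And>w. w \<in> W \<Longrightarrow> u w = (\<Sum>a\<in>UNIV. mvar a * r w a)"
    "\<And>w a. w \<in> W \<Longrightarrow> r w a \<in> hom_std (d - 1 - deg w)"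
    by auto
  \<comment> \<open>The failure of the vectors r _ a to be syzygies. Since sum x_a * g a = 0, it is
    Koszul in the variables, with coefficients of degree d - 2 > e; there the ideal is everything,
    so each coefficient is a combination of the \<open>f w\<close>.\<close>
  define g where "g a = (\<Sum>w\<in>W. f w * r w a)" for a
  have g_hom: "g a \<in> hom_std (d - 1)" for a
    unfolding g_def
  proof (rule homog_sum)
    fix w assume "w \<in> W"
    then show "f w * r w a \<in> hom_std (d - 1)"
      using homog_mult[OF f_hom r(2), of w w a] by simp
  qed
  have "(\<Sum>a\<in>UNIV. mvar a * g a) = (\<Sum>w\<in>W. f w * (\<Sum>a\<in>UNIV. mvar a * r w a))"
    unfolding g_def sum_distrib_left by (subst sum.swap) (simp add: ac_simps)
  also have "\<dots> = 0"
    using u r(1) by (simp add: syz_def)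
  finally obtain k' where k': "\<And>a. g a = (\<Sum>b\<in>UNIV. mvar b * (k' a b - k' b a))"
    by (rule koszul_exact) blast
  define k where "k a b = hcomp std (d - 2) (k' a b)" for a b
  have k: "g a = (\<Sum>b\<in>UNIV. mvar b * (k a b - k b a))" for a
  proof -
    have "hcomp std (d - 1) (g a) =
        (\<Sum>b\<in>UNIV. mvar b * hcomp std (d - 2) (k' a b - k' b a))"
      by (subst k') (simp add: hcomp_sum hcomp_mult[OF hom_mvar])
    also have "\<dots> = (\<Sum>b\<in>UNIV. mvar b * (k a b - k b a))"
      by (simp add: k_def hcomp_def lin_diff)
    finally have "hcomp std (d - 1) (g a) = \<dots>" .
    then show ?thesis
      using g_hom by (simp add: hcomp_id)
  qed
  have "\<exists>c. k a b = (\<Sum>w\<in>W. f w * c w) \<and> (\<forall>w. c w \<in> hom_std (d - 2 - deg w))" for a b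
  proof -
    have "k a b \<in> hom_std (d - 2)" "e < d - 2"
      using d by (auto simp: k_def)
    then show ?thesis
      by (rule ideal_hom) blast
  qed
  then obtain c where c: "\<And>a b. k a b = (\<Sum>w\<in>W. f w * c a b w)" "\<And>a b w. c a b w \<in> hom_std (d - 2 - deg w)"
    by metis
  \<comment> \<open>The correction cancels \<open>g a\<close>, and being antisymmetric in a and b it
    does not change sum x_a * r w a.\<close>
  define s where "s a w = r w a - (\<Sum>b\<in>UNIV. mvar b * (c a b w - c b a w))" for a w
  have "s a \<in> syz (d - 1)" for a
  proof -
    have "(\<Sum>w\<in>W. f w * s a w) = g a - (\<Sum>w\<in>W. \<Sum>b\<in>UNIV. f w * (mvar b * (c a b w - c b a w)))"
      by (simp add: s_def g_def right_diff_distrib sum_subtractf sum_distrib_left)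
    also have "(\<Sum>w\<in>W. \<Sum>b\<in>UNIV. f w * (mvar b * (c a b w - c b a w))) =
        (\<Sum>b\<in>UNIV. \<Sum>w\<in>W. f w * (mvar b * (c a b w - c b a w)))"
      by (rule sum.swap)
    also have "\<dots> = (\<Sum>b\<in>UNIV. mvar b * (k a b - k b a))"
      by (simp add: c(1) sum_distrib_left sum_subtractf[symmetric] right_diff_distrib mult.left_commute)
    also have "\<dots> = g a"
      by (simp add: k)
    finally have "(\<Sum>w\<in>W. f w * s a w) = 0"
      by simp
    moreover have "s a w \<in> hom_std (d - 1 - deg w)" if "w \<in> W" for w
    proof -
      have "mvar b * (c a b w - c b a w) \<in> hom_std (1 + (d - 2 - deg w))" for b
        by (intro homog_mult hom_mvar homog_diff c)
      then show ?thesis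
        unfolding s_def using r(2)[OF that]
        by (intro homog_diff homog_sum) (simp_all add: algebra_simps)
    qed
    ultimately show ?thesis
      by (simp add: syz_def)
  qed
  moreover have "u w = (\<Sum>a\<in>UNIV. mvar a * s a w)" if "w \<in> W" for w
  proof -
    have "(\<Sum>a\<in>UNIV. mvar a * s a w) = u w - (\<Sum>a\<in>UNIV. \<Sum>b\<in>UNIV. mvar a * (mvar b * (c a b w - c b a w)))"
      using r(1)[OF that] by (simp add: s_def right_diff_distrib sum_subtractf sum_distrib_left)
    then show ?thesis
      using sum_sum_antisymmetric[of mvar "\<lambda>a b. c a b w" UNIV] by simp
  qed
  ultimately show ?thesis
    by (rule that) simp_all
qed

lemma koszul_sum:
  assumes "\<And>i. i \<in> I \<Longrightarrow> u i \<in> koszul"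
  shows "(\<lambda>w. \<Sum>i\<in>I. u i w) \<in> koszul"
proof -
  have "\<forall>i\<in>I. \<exists>a. \<forall>w\<in>W. u i w = (\<Sum>w'\<in>W. (a w w' - a w' w) * f w')"
    using assms by (auto simp: koszul_def)
  from bchoice[OF this] obtain a where
    a: "\<forall>i\<in>I. \<forall>w\<in>W. u i w = (\<Sum>w'\<in>W. (a i w w' - a i w' w) * f w')" ..
  have *: "(\<Sum>i\<in>I. u i w) = (\<Sum>w'\<in>W. ((\<Sum>i\<in>I. a i w w') - (\<Sum>i\<in>I. a i w' w)) * f w')" if "w \<in> W" for w
  proof -
    have "(\<Sum>i\<in>I. u i w) = (\<Sum>i\<in>I. \<Sum>w'\<in>W. (a i w w' - a i w' w) * f w')"
      using a that by simp
    also have "\<dots> = (\<Sum>w'\<in>W. \<Sum>i\<in>I. (a i w w' - a i w' w) * f w')"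
      by (rule sum.swap)
    finally show ?thesis
      by (simp add: sum_distrib_right[symmetric] sum_subtractf)
  qed
  show ?thesis
    unfolding koszul_def mem_Collect_eq
    by (rule exI[of _ "\<lambda>w w'. \<Sum>i\<in>I. a i w w'"]) (rule ballI, rule *)
qed

text \<open>An ideal annihilates the homology of its Koszul complex: if h = sum f w' * c w',
  subtracting c w * (sum f w' * u w') = 0 from h * u w makes the coefficients antisymmetric.\<close>

lemma ideal_mult_syz_koszul:
  assumes u: "u \<in> syz d" and h: "h \<in> hom_std j" "e < j"
  shows "(\<lambda>w. h * u w) \<in> koszul"
proof -
  obtain c where c: "h = (\<Sum>w\<in>W. f w * c w)"
    using ideal h by blast
  have "h * u w = (\<Sum>w'\<in>W. (c w' * u w - c w * u w') * f w')" for w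
  proof -
    have "(\<Sum>w'\<in>W. (c w' * u w - c w * u w') * f w') = h * u w - c w * (\<Sum>w'\<in>W. f w' * u w')"
    proof -
      have "(\<Sum>w'\<in>W. c w' * u w * f w') = h * u w"
        unfolding c sum_distrib_right by (intro sum.cong refl) (simp only: ac_simps)
      moreover have "(\<Sum>w'\<in>W. c w * u w' * f w') = c w * (\<Sum>w'\<in>W. f w' * u w')"
        unfolding sum_distrib_left by (intro sum.cong refl) (simp only: ac_simps)
      ultimately show ?thesis
        by (simp add: left_diff_distrib sum_subtractf)
    qed
    then show ?thesis
      using u by (simp add: syz_def)
  qed
  then show ?thesis
    unfolding koszul_def by (intro CollectI exI[of _ "\<lambda>w w'. c w' * u w"]) simp
qed

text \<open>Each application of \<open>syz_step\<close> moves one variable from \<open>u\<close> to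
  \<open>h\<close>. After k of them \<open>h\<close> has degree above e, hence lies in the ideal,
  and by then the syzygy still has degree at least e + 2.\<close>

lemma hom_mult_syz_koszul:
  assumes "u \<in> syz d" "e + 2 + int k \<le> d" "h \<in> hom_std j" "e < j + int k"
  shows "(\<lambda>w. h * u w) \<in> koszul"
  using assms
proof (induction k arbitrary: u d h j)
  case 0
  then show ?case
    using ideal_mult_syz_koszul[of u d h j] by simp
next
  case (Suc k)
  have "e + 3 \<le> d"
    using Suc.prems by simp
  with Suc.prems(1) obtain s where s: "\<And>a. s a \<in> syz (d - 1)"
    "\<And>w. w \<in> W \<Longrightarrow> u w = (\<Sum>a\<in>UNIV. mvar a * s a w)"
    by (rule syz_step) blast
  have "(\<lambda>w. (h * mvar a) * s a w) \<in> koszul" for a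
    using Suc.prems by (intro Suc.IH[OF s(1), of "h * mvar a" "j + 1"] homog_mult hom_mvar) auto
  then have "(\<lambda>w. \<Sum>a\<in>UNIV. (h * mvar a) * s a w) \<in> koszul"
    by (intro koszul_sum)
  then show ?case
    by (simp add: koszul_def s(2) sum_distrib_left mult.assoc)
qed

text \<open>Starting from h = 1, it takes e + 1 variables to enter the ideal, and the syzygy must be
  able to lose them without falling below e + 2. The sum (e + 2) + (e + 1) is the first degree above
  \<open>D\<close>.\<close>

theorem syz_koszul:
  assumes "u \<in> syz d" "0 \<le> e" "2 * e + 3 \<le> d"
  shows "u \<in> koszul"
  using hom_mult_syz_koszul[of u d "nat (e + 1)", OF assms(1) _ homog_one] assms by simp

end

section \<open>The Reynolds operator\<close>

definition place :: "'n \<Rightarrow> 'm::finite monom \<Rightarrow> ('m \<times> 'n) monom" where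
  "place j w = (\<Sum>i\<in>UNIV. Poly_Mapping.single (i, j) (Poly_Mapping.lookup w i))"

definition block :: "('m::finite \<times> 'n) monom \<Rightarrow> 'n \<Rightarrow> 'm monom" where
  "block e j = (\<Sum>i\<in>UNIV. Poly_Mapping.single i (Poly_Mapping.lookup e (i, j)))"

lemma lookup_place: "Poly_Mapping.lookup (place j w) (i, k) = (if j = k then Poly_Mapping.lookup w i else 0)"
  by (auto simp: place_def lookup_sum lookup_single when_def)

lemma lookup_block: "Poly_Mapping.lookup (block e j) i = Poly_Mapping.lookup e (i, j)"
  by (simp add: block_def lookup_sum lookup_single when_def)

lemma place_zero [simp]: "place j 0 = 0"
  by (simp add: place_def)

lemma block_zero [simp]: "block 0 j = 0"
  by (simp add: block_def)

lemma place_add: "place j (u + v) = place j u + place j v"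
  by (simp add: place_def lookup_add single_add sum.distrib)

lemma block_add: "block (e + e') j = block e j + block e' j"
  by (simp add: block_def lookup_add single_add sum.distrib)

lemma block_place: "block (place j w) k = (if j = k then w else 0)"
  by (intro poly_mapping_eqI) (simp add: lookup_block lookup_place)

lemma sum_place_block: "(\<Sum>j\<in>UNIV. place j (block e j)) = e"
  for e :: "('m::finite \<times> 'n::finite) monom"
proof (rule poly_mapping_eqI)
  fix x :: "'m \<times> 'n"
  show "Poly_Mapping.lookup (\<Sum>j\<in>UNIV. place j (block e j)) x = Poly_Mapping.lookup e x"
    by (cases x) (simp add: lookup_sum lookup_place lookup_block)
qed

lemma mdeg_place [simp]: "mdeg (place j w) = mdeg w"
proof -
  have "mdeg (place j w) = (\<Sum>i\<in>UNIV. Poly_Mapping.lookup w i)"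
    by (simp add: place_def mdeg_sum)
  also have "\<dots> = mdeg w"
    by (simp add: mdeg_eq_wdeg wdeg_superset[of UNIV])
  finally show ?thesis .
qed

lemma sum_mdeg_block: "(\<Sum>j\<in>UNIV. mdeg (block e j)) = mdeg e"
  for e :: "('m::finite \<times> 'n::finite) monom"
  by (subst (2) sum_place_block[symmetric]) (simp add: mdeg_sum)

lemma xpow_add: "xpow (a + b) = xpow a * xpow b"
  by (simp add: mult_single)

lemma xpow_sum: "xpow (\<Sum>i\<in>I. a i) = (\<Prod>i\<in>I. xpow (a i))"
  by (induction I rule: infinite_finite_induct) (simp_all add: xpow_add)

lemma mvar_power: "mvar v ^ k = xpow (Poly_Mapping.single v k)"
  using mev_mvar[of "Poly_Mapping.single v k"] by simp

lemma monom_at_eq: "monom_at w j = xpow (place j w)"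
  by (simp add: monom_at_def place_def xpow_sum mvar_power)

lemma monom_at_add: "monom_at (u + v) j = monom_at u j * monom_at v j"
  by (simp add: monom_at_eq place_add mult_single)

lemma monom_at_zero [simp]: "monom_at 0 j = 1"
  by (simp add: monom_at_eq)

lemma prod_monom_at_block: "(\<Prod>j\<in>UNIV. monom_at (block e j) j) = xpow e"
  for e :: "('m::finite \<times> 'n::finite) monom"
  by (simp add: monom_at_eq xpow_sum[symmetric] sum_place_block)

lemma bracket_hom_std: "bracket w \<in> hom_std (int (mdeg w))"
  unfolding bracket_def by (intro homog_sum) (simp add: monom_at_eq homog_single wdeg_std)

lemma bracket_zero: "bracket 0 = (of_nat CARD('n) :: ('m::finite \<times> 'n::finite, 'k::field) mpoly)"
  by (simp add: bracket_def)

lemma bracket_mult_xpow: "bracket w * xpow e = (\<Sum>j\<in>UNIV. xpow (place j w + e))"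
  by (simp add: bracket_def monom_at_eq sum_distrib_right mult_single)

lemma inj_sum_bracket:
  assumes "finite A"
  shows "inj_sum bracket A w =
    (\<Sum>f\<in>{f \<in> A \<rightarrow>\<^sub>E UNIV. inj_on f A}. \<Prod>i\<in>A. monom_at (w i) (f i) :: ('m::finite \<times> 'n::finite, 'k::field) mpoly)"
  using inj_sum_eq_sum_injections[of "\<lambda>j u. monom_at u j", OF monom_at_add assms]
  by (simp add: bracket_def[abs_def])

lemma inj_sum_bracket_vanishes:
  assumes "finite A" "CARD('n) < card A"
  shows "inj_sum bracket A w = (0 :: ('m::finite \<times> 'n::finite, 'k::field) mpoly)"
  using inj_sum_vanishes[of "\<lambda>j u. monom_at u j", OF monom_at_add assms]
  by (simp add: bracket_def[abs_def])

lemma msubst_Psi_bracket: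
  assumes "n = CARD('n)"
  shows "msubst (bracket :: 'm monom \<Rightarrow> ('m::finite \<times> 'n::finite, 'k::field) mpoly) (Psi n w) = 0"
proof -
  have "msubst (bracket :: 'm monom \<Rightarrow> ('m \<times> 'n, 'k) mpoly) (inj_sum mvar {1..n+1} w) = inj_sum bracket {1..n+1} w"
    by (simp add: msubst_inj_sum)
  also have "\<dots> = 0"
    using assms by (intro inj_sum_bracket_vanishes) auto
  finally show ?thesis
    by (simp add: Psi_eq_inj_sum msubst_mult msubst_uminus)
qed

lemma Mq_add: "u \<in> Mq q \<Longrightarrow> v \<in> Mq q \<Longrightarrow> u + v \<in> Mq q"
proof -
  assume uv: "u \<in> Mq q" "v \<in> Mq q"
  then have "mdeg (u + v) \<noteq> 0"
    by (simp add: Mq_def mdeg_add)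
  then have "u + v \<noteq> 0"
    by auto
  with uv show ?thesis
    by (auto simp: Mq_def mdeg_add)
qed

text \<open>The degree-zero element \<open>0\<close> of the monoid of exponent vectors, that is the monomial 1,
  stands for $[1] = n$; with this value the weights \<open>0\<close> drop out of \<open>inj_sum\<close>.\<close>

definition tvar :: "nat \<Rightarrow> 'm monom \<Rightarrow> ('m monom, 'k::comm_ring_1) mpoly" where
  "tvar n w = (if w = 0 then of_nat n else mvar w)"

text \<open>The monomials that survive averaging over the diagonal matrices of the group. The
  remaining average over permutations is the work of \<open>inj_sum\<close> in
  \<open>theta\<close>.\<close>

definition qdiv :: "nat \<Rightarrow> ('m::finite \<times> 'n) monom \<Rightarrow> bool" where
  "qdiv q e \<longleftrightarrow> (\<forall>j. q dvd mdeg (block e j))"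

lemma qdiv_place_add: "q dvd mdeg w \<Longrightarrow> qdiv q (place j w + e) \<longleftrightarrow> qdiv q e"
  by (auto simp: qdiv_def block_add block_place mdeg_add dvd_add_right_iff)

text \<open>\<open>I\<close> is later the ideal generated by the Psi, and is described here as an
  ideal that contains them and lies in the kernel. The numbering \<open>nu\<close> matches the
  blocks with the arguments 1, ..., n of \<open>inj_sum\<close>.\<close>

locale vector_invariants =
  fixes q n D :: nat and nu :: "nat \<Rightarrow> 'n::finite"
    and I :: "('m::finite monom, 'k::field) mpoly set"
  assumes n: "n = CARD('n)" and q: "1 \<le> q" and fact_n: "of_nat (fact n) \<noteq> (0::'k)"
    and D: "D = q * n * (n + 1) - 2 * n + 2"
    and nu: "bij_betw nu {1..n} UNIV"
    and I_zero: "0 \<in> I" and I_add: "\<And>p p'. p \<in> I \<Longrightarrow> p' \<in> I \<Longrightarrow> p + p' \<in> I"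
    and I_mult: "\<And>p r. p \<in> I \<Longrightarrow> r \<in> Fqd q D \<Longrightarrow> r * p \<in> I"
    and I_Psi: "\<And>w. (\<forall>s\<in>{1..n+1}. w s \<in> Mq q) \<Longrightarrow> mdeg (\<Sum>s\<in>{1..n+1}. w s) \<le> D \<Longrightarrow> Psi n w \<in> I"
    and I_kernel: "\<And>p. p \<in> I \<Longrightarrow> msubst (bracket :: 'm monom \<Rightarrow> ('m \<times> 'n, 'k) mpoly) p = 0"
begin

abbreviation phi :: "('m monom, 'k) mpoly \<Rightarrow> ('m \<times> 'n, 'k) mpoly" where
  "phi \<equiv> msubst bracket"

text \<open>A linear section of \<open>phi\<close> over the invariants; \<open>phi \<circ> theta\<close> is the Reynolds operator.\<close>

definition theta :: "('m \<times> 'n, 'k) mpoly \<Rightarrow> ('m monom, 'k) mpoly" where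
  "theta = lin (\<lambda>e. if qdiv q e
     then mconst (1 / of_nat (fact n)) * inj_sum (tvar n) {1..n} (\<lambda>s. block e (nu s)) else 0)"

text \<open>Graded so that t(w) has the degree of w. The degree \<open>d\<close> may exceed
  \<open>D\<close>, which bounds only the single variables.\<close>

definition FD :: "int \<Rightarrow> ('m monom, 'k) mpoly set" where
  "FD d = Fqd q D \<inter> homog mdeg d"

lemma Fqd_mconst: "mconst c \<in> Fqd q D"
  by (simp add: Fqd_def polys_in_mconst)

lemma Fqd_mvar: "w \<in> Mq q \<Longrightarrow> mdeg w \<le> D \<Longrightarrow> mvar w \<in> Fqd q D"
  by (simp add: Fqd_def polys_in_mvar)

lemma I_mconst_mult: "p \<in> I \<Longrightarrow> mconst c * p \<in> I"
  by (intro I_mult Fqd_mconst)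

lemma I_uminus: "p \<in> I \<Longrightarrow> - p \<in> I"
  using I_mconst_mult[of p "-1"] by (simp add: mconst_uminus)

lemma I_diff: "p \<in> I \<Longrightarrow> p' \<in> I \<Longrightarrow> p - p' \<in> I"
  using I_add[of p "- p'"] I_uminus[of p'] by simp

lemma I_sum: "(\<And>i. i \<in> S \<Longrightarrow> p i \<in> I) \<Longrightarrow> (\<Sum>i\<in>S. p i) \<in> I"
  by (induction S rule: infinite_finite_induct) (simp_all add: I_zero I_add)

lemma I_lin: "(\<And>e. e \<in> Poly_Mapping.keys p \<Longrightarrow> g e \<in> I) \<Longrightarrow> lin g p \<in> I"
  unfolding lin_def by (intro I_sum I_mconst_mult)

lemma FD_zero: "0 \<in> FD d"
  by (simp add: FD_def Fqd_def polys_in_zero)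

lemma FD_add: "p \<in> FD d \<Longrightarrow> p' \<in> FD d \<Longrightarrow> p + p' \<in> FD d"
  by (simp add: FD_def Fqd_def polys_in_add homog_add)

lemma FD_diff: "p \<in> FD d \<Longrightarrow> p' \<in> FD d \<Longrightarrow> p - p' \<in> FD d"
  by (simp add: FD_def Fqd_def polys_in_diff homog_diff)

lemma FD_mult: "p \<in> FD d \<Longrightarrow> p' \<in> FD d' \<Longrightarrow> p * p' \<in> FD (d + d')"
  by (simp add: FD_def Fqd_def polys_in_mult homog_mult)

lemma FD_sum: "(\<And>i. i \<in> S \<Longrightarrow> p i \<in> FD d) \<Longrightarrow> (\<Sum>i\<in>S. p i) \<in> FD d"
  by (induction S rule: infinite_finite_induct) (simp_all add: FD_zero FD_add)

lemma FD_mconst: "mconst c \<in> FD 0"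
  by (simp add: FD_def Fqd_def polys_in_mconst homog_mconst)

lemma FD_mvar: "w \<in> Mq q \<Longrightarrow> mdeg w \<le> D \<Longrightarrow> mvar w \<in> FD (int (mdeg w))"
  by (simp add: FD_def Fqd_mvar homog_mvar)

lemma phi_FD: "p \<in> FD d \<Longrightarrow> phi p \<in> hom_std d"
  unfolding FD_def by (rule homog_msubst[of _ mdeg]) (auto intro: bracket_hom_std)

lemma theta_add: "theta (p + p') = theta p + theta p'"
  by (simp add: theta_def lin_add)

lemma theta_diff: "theta (p - p') = theta p - theta p'"
  by (simp add: theta_def lin_diff)

lemma theta_sum: "theta (\<Sum>i\<in>S. p i) = (\<Sum>i\<in>S. theta (p i))"
  by (simp add: theta_def lin_sum)

lemma theta_mconst_mult: "theta (mconst c * p) = mconst c * theta p"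
  by (simp add: theta_def lin_mconst_mult)

lemma theta_xpow: "theta (xpow e) = (if qdiv q e
     then mconst (1 / of_nat (fact n)) * inj_sum (tvar n) {1..n} (\<lambda>s. block e (nu s)) else 0)"
  by (simp add: theta_def)

lemma mconst_fact: "mconst (1 / of_nat (fact n) :: 'k) * of_nat (fact n) = 1"
  by (metis fact_n mconst_1 mconst_mult mconst_of_nat nonzero_divide_eq_eq)

lemma theta_one: "theta 1 = 1"
proof -
  have "inj_sum (tvar n) {1..n} (\<lambda>_. 0 :: 'm monom) = (of_nat (fact n) :: ('m monom, 'k) mpoly)"
    using inj_sum_all_zero[of "{1..n}" "tvar n" n] by (simp add: tvar_def)
  then show ?thesis
    using theta_xpow[of 0] mconst_fact by (simp add: qdiv_def)
qed

lemma sum_mdeg_block_nu: "(\<Sum>s\<in>{1..n}. mdeg (block e (nu s))) = mdeg e"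
  for e :: "('m \<times> 'n) monom"
  using sum.reindex_bij_betw[OF nu, of "\<lambda>j. mdeg (block e j)"] by (simp add: sum_mdeg_block)

lemma theta_xpow_FD:
  assumes "mdeg e \<le> D"
  shows "theta (xpow e) \<in> FD (int (mdeg e))"
proof (cases "qdiv q e")
  case True
  have "inj_sum (tvar n) {1..n} (\<lambda>s. block e (nu s)) \<in>
      (\<lambda>d. FD (int d)) (\<Sum>s\<in>{1..n}. mdeg (block e (nu s)))"
  proof (rule inj_sum_mem_graded[where T = "\<lambda>d. FD (int d)" and U = "{w. q dvd mdeg w}" and N = D])
    show "tvar n u \<in> FD (int (mdeg u))" if "u \<in> {w. q dvd mdeg w}" "mdeg u \<le> D" for u
    proof (cases "u = 0")
      case True
      then show ?thesis
        using FD_mconst[of "of_nat n"] by (simp add: tvar_def)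
    next
      case False
      then show ?thesis
        using that by (simp add: tvar_def FD_mvar Mq_def)
    qed
    show "1 \<in> FD (int 0)"
      using FD_mconst[of 1] by simp
    show "(\<Sum>s\<in>{1..n}. mdeg (block e (nu s))) \<le> D"
      using assms by (simp only: sum_mdeg_block_nu)
  qed (use True in \<open>auto intro: FD_diff FD_zero FD_mult simp: mdeg_add qdiv_def\<close>)
  then have "mconst (1 / of_nat (fact n)) * inj_sum (tvar n) {1..n} (\<lambda>s. block e (nu s)) \<in> FD (0 + int (mdeg e))"
    by (intro FD_mult FD_mconst) (simp only: sum_mdeg_block_nu)
  with True show ?thesis
    by (simp add: theta_xpow)
qed (simp add: theta_xpow FD_zero)

lemma FD_lin: "(\<And>e. e \<in> Poly_Mapping.keys p \<Longrightarrow> g e \<in> FD d) \<Longrightarrow> lin g p \<in> FD d"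
  unfolding lin_def using FD_mult[OF FD_mconst] by (intro FD_sum) force

lemma theta_eq_lin: "theta p = lin (\<lambda>e. theta (xpow e)) p"
  by (simp add: theta_xpow) (simp add: theta_def)

lemma theta_FD:
  assumes "p \<in> hom_std d" "d \<le> int D"
  shows "theta p \<in> FD d"
  unfolding theta_eq_lin[of p]
proof (rule FD_lin)
  fix e assume "e \<in> Poly_Mapping.keys p"
  then have "int (mdeg e) = d"
    using assms by (auto simp: homog_def supp_in_def wdeg_std)
  then show "theta (xpow e) \<in> FD d"
    using theta_xpow_FD[of e] assms by simp
qed

text \<open>Multiplying by [u] adds u to one block at a time, which is exactly a merge of the
  argument u with the argument of that block; so the recursion for u as argument n + 1 is the
  claim.\<close>

lemma theta_bracket_mult_xpow:
  assumes u: "u \<in> Mq q" and e: "qdiv q e"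
  shows "mvar u * theta (xpow e) - theta (bracket u * xpow e) =
    mconst (1 / of_nat (fact n)) * inj_sum (tvar n) {1..n+1} (\<lambda>s. if s = n + 1 then u else block e (nu s))"
proof -
  let ?c = "mconst (1 / of_nat (fact n) :: 'k) :: ('m monom, 'k) mpoly"
  define w where "w s = block e (nu s)" for s
  define w' where "w' s = (if s = n + 1 then u else w s)" for s
  have qu: "q dvd mdeg u" and u0: "u \<noteq> 0"
    using u by (auto simp: Mq_def)
  have "theta (bracket u * xpow e) = (\<Sum>j\<in>UNIV. ?c * inj_sum (tvar n) {1..n} (\<lambda>s. block (place j u + e) (nu s)))"
    using e qu by (simp add: bracket_mult_xpow theta_sum theta_xpow qdiv_place_add)
  also have "\<dots> = (\<Sum>b\<in>{1..n}. ?c * inj_sum (tvar n) {1..n} (\<lambda>s. block (place (nu b) u + e) (nu s)))"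
    using sum.reindex_bij_betw[OF nu] by (rule sym)
  also have "\<dots> = (\<Sum>b\<in>{1..n}. ?c * inj_sum (tvar n) {1..n} (w'(b := w' b + w' (n + 1))))"
  proof (intro sum.cong refl arg_cong[of _ _ "(*) ?c"] inj_sum_cong)
    fix b s assume "b \<in> {1..n}" "s \<in> {1..n}"
    then have "nu b = nu s \<longleftrightarrow> b = s"
      by (rule inj_on_eq_iff[OF bij_betw_imp_inj_on[OF nu]])
    then show "block (place (nu b) u + e) (nu s) = (w'(b := w' b + w' (n + 1))) s"
      using \<open>s \<in> {1..n}\<close> by (auto simp: block_add block_place w_def w'_def add.commute)
  qed
  finally have 1: "theta (bracket u * xpow e) =
      ?c * (\<Sum>b\<in>{1..n}. inj_sum (tvar n) {1..n} (w'(b := w' b + w' (n + 1))))"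
    by (simp add: sum_distrib_left)
  have 2: "inj_sum (tvar n) {1..n} w' = (inj_sum (tvar n) {1..n} w :: ('m monom, 'k) mpoly)"
    by (rule inj_sum_cong) (simp add: w'_def)
  have "{1..n+1} = insert (n + 1) {1..n}"
    by auto
  then have "inj_sum (tvar n) {1..n+1} w' = (mvar u :: ('m monom, 'k) mpoly) * inj_sum (tvar n) {1..n} w -
      (\<Sum>b\<in>{1..n}. inj_sum (tvar n) {1..n} (w'(b := w' b + w' (n + 1))))"
    using u0 2 by (simp add: inj_sum_insert tvar_def w'_def)
  moreover have "theta (xpow e) = ?c * inj_sum (tvar n) {1..n} w"
    using e by (simp add: theta_xpow w_def[abs_def])
  moreover have "(\<lambda>s. if s = n + 1 then u else block e (nu s)) = w'"
    by (simp add: w'_def w_def fun_eq_iff)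
  ultimately show ?thesis
    using 1 by (simp add: right_diff_distrib mult.left_commute)
qed

lemma inj_sum_tvar_mem_I:
  assumes w: "\<And>s. s \<in> {1..n+1} \<Longrightarrow> q dvd mdeg (w s)" "(\<Sum>s\<in>{1..n+1}. mdeg (w s)) \<le> D"
  shows "inj_sum (tvar n) {1..n+1} w \<in> I"
proof (cases "\<exists>s\<in>{1..n+1}. w s = 0")
  case True
  then obtain s where "s \<in> {1..n+1}" "w s = 0"
    by blast
  then have "inj_sum (tvar n) {1..n+1} w = (0 :: ('m monom, 'k) mpoly)"
    by (intro inj_sum_weight_zero) (auto simp: tvar_def)
  then show ?thesis
    by (simp add: I_zero)
next
  case False
  then have wM: "w s \<in> Mq q" if "s \<in> {1..n+1}" for s
    using w that by (auto simp: Mq_def)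
  have "inj_sum (tvar n) {1..n+1} w = (inj_sum mvar {1..n+1} w :: ('m monom, 'k) mpoly)"
    by (rule inj_sum_agree[where U = "Mq q"]) (use wM Mq_add in \<open>auto simp: tvar_def Mq_def\<close>)
  also have "\<dots> = (-1) ^ (n + 1) * Psi n w"
    by (simp add: Psi_eq_inj_sum mult.assoc[symmetric] power_add[symmetric])
  also have "\<dots> \<in> I"
  proof -
    have "Psi n w \<in> I"
      using w(2) wM by (intro I_Psi ballI) (simp_all only: mdeg_sum)
    moreover have "(-1) ^ k * p \<in> I" if "p \<in> I" for k p
      by (induction k) (use that in \<open>auto intro: I_uminus\<close>)
    ultimately show ?thesis
      by blast
  qed
  finally show ?thesis .
qed

lemma theta_bracket_mult_not_qdiv:
  assumes u: "u \<in> Mq q" and e: "\<not> qdiv q e"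
  shows "theta (bracket u * xpow e) = 0" "theta (xpow e) = 0"
  using assms by (simp_all add: bracket_mult_xpow theta_sum theta_xpow qdiv_place_add Mq_def)

text \<open>Linearity of \<open>theta\<close> over the t(u), modulo \<open>I\<close>. The degree
  condition guarantees that the Psi produced by each monomial is a generator.\<close>

lemma theta_bracket_mult_mem_I:
  assumes u: "u \<in> Mq q" and p: "\<And>e. e \<in> Poly_Mapping.keys p \<Longrightarrow> mdeg u + mdeg e \<le> D"
  shows "mvar u * theta p - theta (bracket u * p) \<in> I"
proof -
  have "mvar u * theta (xpow e) - theta (bracket u * xpow e) \<in> I" if "e \<in> Poly_Mapping.keys p" for e
  proof (cases "qdiv q e")
    case True
    define w where "w s = (if s = n + 1 then u else block e (nu s))" for s
    have "(\<Sum>s\<in>{1..n+1}. mdeg (w s)) = mdeg (w (n + 1)) + (\<Sum>s\<in>{1..n}. mdeg (w s))"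
      by simp
    also have "(\<Sum>s\<in>{1..n}. mdeg (w s)) = (\<Sum>s\<in>{1..n}. mdeg (block e (nu s)))"
      by (intro sum.cong) (auto simp: w_def)
    finally have "(\<Sum>s\<in>{1..n+1}. mdeg (w s)) \<le> D"
      using p[OF that] sum_mdeg_block_nu[of e] by (simp add: w_def)
    then have "inj_sum (tvar n) {1..n+1} w \<in> I"
      using u True by (intro inj_sum_tvar_mem_I) (auto simp: w_def Mq_def qdiv_def)
    then show ?thesis
      using theta_bracket_mult_xpow[OF u True] I_mconst_mult by (simp add: w_def[abs_def])
  next
    case False
    then show ?thesis
      using u by (simp add: theta_bracket_mult_not_qdiv I_zero)
  qed
  then have "lin (\<lambda>e. mvar u * theta (xpow e) - theta (bracket u * xpow e)) p \<in> I"
    by (rule I_lin)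
  also have "lin (\<lambda>e. mvar u * theta (xpow e) - theta (bracket u * xpow e)) p =
      mvar u * theta p - theta (bracket u * p)"
  proof (induction p rule: mpoly_induct)
    case (single e c)
    show ?case
      by (subst (2 3) single_conv_mconst)
        (simp add: theta_mconst_mult mult.left_commute[of _ "mconst c"] right_diff_distrib)
  qed (simp_all add: lin_add theta_add distrib_left theta_def)
  finally show ?thesis .
qed

lemma phi_tvar: "phi (tvar n w) = bracket w"
  by (simp add: tvar_def bracket_zero n)

text \<open>Holds in all degrees: after \<open>phi\<close> the expression in n + 1 arguments
  vanishes by the pigeonhole principle, whether or not it came from \<open>I\<close>. The descent
  above degree \<open>D\<close> relies on this.\<close>

lemma reynolds_bracket_mult:
  assumes u: "u \<in> Mq q"
  shows "phi (theta (bracket u * p)) = bracket u * phi (theta p)"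
proof (induction p rule: mpoly_induct)
  case (single e c)
  have "phi (theta (bracket u * xpow e)) = bracket u * phi (theta (xpow e))"
  proof (cases "qdiv q e")
    case True
    let ?w = "\<lambda>s. if s = n + 1 then u else block e (nu s)"
    have "phi (inj_sum (tvar n) {1..n+1} ?w) = inj_sum bracket {1..n+1} ?w"
      by (subst msubst_inj_sum) (simp_all add: phi_tvar)
    also have "\<dots> = 0"
      using n by (intro inj_sum_bracket_vanishes) auto
    finally have "phi (mvar u * theta (xpow e) - theta (bracket u * xpow e)) = 0"
      unfolding theta_bracket_mult_xpow[OF u True] msubst_mult by simp
    then show ?thesis
      by (simp add: msubst_diff msubst_mult)
  next
    case False
    then show ?thesis
      using u by (simp add: theta_bracket_mult_not_qdiv)
  qed
  then show ?case
    by (subst (1 2) single_conv_mconst)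
      (simp add: theta_mconst_mult mult.left_commute[of _ "mconst c"] msubst_mult)
qed (simp_all add: theta_add distrib_left msubst_add, simp_all add: theta_def)

lemma keys_single_1_add: "Poly_Mapping.keys (Poly_Mapping.single v 1 + e) = insert v (Poly_Mapping.keys e)"
  for e :: "'v monom"
  by (auto simp: in_keys_iff lookup_add lookup_single when_def split: if_splits)

text \<open>One variable t(u) is peeled off at a time; the new difference is t(u) times the old one
  plus the error bounded by \<open>theta_bracket_mult_mem_I\<close>.\<close>

lemma theta_phi_xpow:
  assumes "Poly_Mapping.keys E \<subseteq> {w \<in> Mq q. mdeg w \<le> D}" "wdeg mdeg E \<le> D"
  shows "xpow E - theta (phi (xpow E)) \<in> I"
  using assms
proof (induction E rule: monom_induct)
  case zero
  then show ?case by (simp add: theta_one I_zero)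
next
  case (add u E)
  then have u: "u \<in> Mq q" "mdeg u \<le> D" and E: "Poly_Mapping.keys E \<subseteq> {w \<in> Mq q. mdeg w \<le> D}"
    and d: "mdeg u + wdeg mdeg E \<le> D"
    using keys_single_1_add[of u E] by (auto simp: wdeg_add)
  have "xpow E \<in> FD (int (wdeg mdeg E))"
    using E by (simp add: FD_def Fqd_def polys_in_def homog_single)
  then have "phi (xpow E) \<in> hom_std (int (wdeg mdeg E))"
    by (rule phi_FD)
  then have "mvar u * theta (phi (xpow E)) - theta (bracket u * phi (xpow E)) \<in> I"
    using u d by (intro theta_bracket_mult_mem_I) (auto simp: homog_def supp_in_def wdeg_std)
  moreover have "mvar u * (xpow E - theta (phi (xpow E))) \<in> I"
    using add.IH E d u by (intro I_mult Fqd_mvar) auto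
  ultimately have "mvar u * (xpow E - theta (phi (xpow E))) +
      (mvar u * theta (phi (xpow E)) - theta (bracket u * phi (xpow E))) \<in> I"
    by (rule I_add[rotated])
  then show ?case
    by (simp add: xpow_add mvar_def[symmetric] msubst_mult algebra_simps del: One_nat_def)
qed

lemma theta_phi:
  assumes "p \<in> FD d" "d \<le> int D"
  shows "p - theta (phi p) \<in> I"
proof -
  have "lin (\<lambda>E. xpow E - theta (phi (xpow E))) p \<in> I"
    using assms
    by (intro I_lin theta_phi_xpow) (auto simp: FD_def Fqd_def polys_in_def homog_def supp_in_def)
  also have "lin (\<lambda>E. xpow E - theta (phi (xpow E))) p = p - theta (phi p)"
  proof (induction p rule: mpoly_induct)
    case (single E c)
    show ?case
      by (subst (2 3) single_conv_mconst) (simp add: theta_mconst_mult msubst_mult right_diff_distrib)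
  qed (simp_all add: lin_add theta_add msubst_add theta_def)
  finally show ?thesis .
qed

lemma reynolds_phi:
  assumes "p \<in> Fqd q D"
  shows "phi (theta (phi p)) = phi p"
proof (induction p rule: mpoly_induct)
  case (single E c)
  then have E: "Poly_Mapping.keys E \<subseteq> Mq q"
    using assms by (auto simp: Fqd_def polys_in_def)
  then have "phi (theta (phi (xpow E))) = phi (xpow E)"
  proof (induction E rule: monom_induct)
    case zero
    then show ?case by (simp add: theta_one)
  next
    case (add u E)
    then have "u \<in> Mq q" "Poly_Mapping.keys E \<subseteq> Mq q"
      using keys_single_1_add[of u E] by auto
    with add.IH show ?case
      by (simp add: xpow_add mvar_def[symmetric] msubst_mult reynolds_bracket_mult del: One_nat_def)
  qed
  then show ?case
    by (subst (1 2) single_conv_mconst) (simp add: theta_mconst_mult msubst_mult)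
qed (simp_all add: theta_add msubst_add, simp_all add: theta_def)

end

section \<open>Invariants of the monomial group\<close>

lemma mconst_prod: "mconst (\<Prod>i\<in>A. c i) = (\<Prod>i\<in>A. mconst (c i))"
  by (induction A rule: infinite_finite_induct) (simp_all add: mconst_mult)

lemma mconst_power: "mconst (c ^ k) = mconst c ^ k"
  by (induction k) (simp_all add: mconst_mult)

lemma act_monom_at:
  fixes A :: "'k::field ^ 'n::finite ^ 'n" and w :: "'m::finite monom"
  assumes A: "\<And>k. A $ j $ k = (if k = \<pi> then a else 0)"
  shows "act A (monom_at w j) = mconst (a ^ mdeg w) * monom_at w \<pi>"
proof -
  have "(\<Sum>k\<in>UNIV. mconst (A $ j $ k) * mvar (i, k)) = mconst a * (mvar (i, \<pi>) :: ('m \<times> 'n, 'k) mpoly)" for i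
    by (simp add: A if_distrib[of mconst] if_distrib[of "\<lambda>x. x * _"] cong: if_cong)
  then have "act A (monom_at w j) = (\<Prod>i\<in>UNIV. (mconst a * mvar (i, \<pi>)) ^ Poly_Mapping.lookup w i)"
    by (simp add: act_def monom_at_def msubst_prod msubst_power)
  also have "\<dots> = (\<Prod>i\<in>UNIV. mconst a ^ Poly_Mapping.lookup w i) * monom_at w \<pi>"
    by (simp add: power_mult_distrib prod.distrib monom_at_def)
  also have "(\<Prod>i\<in>UNIV. mconst a ^ Poly_Mapping.lookup w i) = (mconst (a ^ mdeg w) :: ('m \<times> 'n, 'k) mpoly)"
    by (simp add: mdeg_eq_wdeg wdeg_superset[of UNIV] power_sum mconst_power mconst_prod)
  finally show ?thesis .
qed

lemma act_bracket:
  fixes A :: "'k::field ^ 'n::finite ^ 'n" and w :: "'m::finite monom"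
  assumes A: "A \<in> monomial_group q" and w: "q dvd mdeg w"
  shows "act A (bracket w) = (bracket w :: ('m \<times> 'n, 'k) mpoly)"
proof -
  have "\<forall>j. \<exists>!k. A $ j $ k \<noteq> 0" and col: "\<forall>k. \<exists>!j. A $ j $ k \<noteq> 0"
    and root: "\<And>j k. A $ j $ k \<noteq> 0 \<Longrightarrow> (A $ j $ k) ^ q = 1"
    using A by (auto simp: monomial_group_def)
  then obtain \<pi> where \<pi>: "\<And>j k. A $ j $ k \<noteq> 0 \<longleftrightarrow> k = \<pi> j"
    by metis
  have "inj \<pi>"
    using col \<pi> by (metis injI)
  then have bij: "bij \<pi>"
    by (simp add: bij_def finite_UNIV_inj_surj)
  have "act A (monom_at w j) = (monom_at w (\<pi> j) :: ('m \<times> 'n, 'k) mpoly)" for j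
  proof -
    have "act A (monom_at w j) = mconst ((A $ j $ \<pi> j) ^ mdeg w) * (monom_at w (\<pi> j) :: ('m \<times> 'n, 'k) mpoly)"
      using \<pi> by (intro act_monom_at) auto
    moreover have "(A $ j $ \<pi> j) ^ mdeg w = 1"
      using w root[of j "\<pi> j"] \<pi> by (auto simp: power_mult)
    ultimately show ?thesis by simp
  qed
  then have "act A (bracket w) = (\<Sum>j\<in>UNIV. monom_at w (\<pi> j) :: ('m \<times> 'n, 'k) mpoly)"
    by (simp add: bracket_def act_def msubst_sum)
  also have "\<dots> = bracket w"
    unfolding bracket_def using bij by (rule sum.reindex_bij_betw)
  finally show ?thesis .
qed

lemma lookup_lin_diagonal:
  "Poly_Mapping.lookup (lin (\<lambda>e. mconst (h e) * xpow e) p) e = h e * Poly_Mapping.lookup p e"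
  by (induction p rule: mpoly_induct)
    (auto simp: lin_add lookup_add lookup_mconst_mult lookup_single when_def algebra_simps)

lemma act_xpow:
  fixes A :: "'k::field ^ 'n::finite ^ 'n" and e :: "('m::finite \<times> 'n) monom"
  assumes A: "\<And>j k. A $ j $ k = (if k = \<pi> j then a j else 0)"
  shows "act A (xpow e) =
    mconst (\<Prod>j\<in>UNIV. a j ^ mdeg (block e j)) * (\<Prod>j\<in>UNIV. monom_at (block e j) (\<pi> j))"
proof -
  have "act A (xpow e) = (\<Prod>j\<in>UNIV. act A (monom_at (block e j) j))"
    unfolding act_def msubst_prod[symmetric] by (simp add: prod_monom_at_block)
  also have "\<dots> = (\<Prod>j\<in>UNIV. mconst (a j ^ mdeg (block e j)) * monom_at (block e j) (\<pi> j))"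
    using A by (intro prod.cong refl act_monom_at) auto
  finally show ?thesis
    by (simp add: prod.distrib mconst_prod)
qed

lemma monomial_group_memI:
  fixes A :: "'k::field ^ 'n::finite ^ 'n"
  assumes A: "\<And>j k. A $ j $ k = (if k = \<pi> j then a j else 0)" and \<pi>: "bij \<pi>"
    and a: "\<And>j. a j ^ q = 1" "1 \<le> q"
  shows "A \<in> monomial_group q"
proof -
  have a0: "a j \<noteq> 0" for j
    using a(1)[of j] a(2) by (auto simp: power_0_left)
  define B :: "'k ^ 'n ^ 'n" where "B = (\<chi> k j. if k = \<pi> j then inverse (a j) else 0)"
  have "A ** B = mat 1"
  proof -
    have "(\<Sum>k\<in>UNIV. A $ j $ k * B $ k $ l) = (if j = l then 1 else 0)" for j l
    proof -
      have "(\<Sum>k\<in>UNIV. A $ j $ k * B $ k $ l) = (\<Sum>k\<in>UNIV. if k = \<pi> j then a j * B $ k $ l else 0)"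
        by (intro sum.cong) (auto simp: A)
      also have "\<dots> = (if j = l then 1 else 0)"
        using \<pi> a0 by (auto simp: B_def bij_def inj_def)
      finally show ?thesis .
    qed
    then show ?thesis
      by (simp add: matrix_matrix_mult_def mat_def vec_eq_iff)
  qed
  moreover have "B ** A = mat 1"
  proof -
    have "(\<Sum>j\<in>UNIV. B $ k $ j * A $ j $ l) = (if k = l then 1 else 0)" for k l
    proof -
      obtain j0 where j0: "k = \<pi> j0" "\<And>j. k = \<pi> j \<longleftrightarrow> j = j0"
        using \<pi> by (metis bij_pointE)
      have "(\<Sum>j\<in>UNIV. B $ k $ j * A $ j $ l) = (\<Sum>j\<in>UNIV. if j = j0 then inverse (a j) * A $ j $ l else 0)"
        by (intro sum.cong) (auto simp: B_def j0(2))
      also have "\<dots> = (if k = l then 1 else 0)"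
        using a0 by (auto simp: A j0(1))
      finally show ?thesis .
    qed
    then show ?thesis
      by (simp add: matrix_matrix_mult_def mat_def vec_eq_iff)
  qed
  ultimately have "invertible A"
    unfolding invertible_def by blast
  moreover have "\<exists>!k. A $ j $ k \<noteq> 0" for j
    using a0 by (auto simp: A)
  moreover have "\<exists>!j. A $ j $ k \<noteq> 0" for k
    using a0 \<pi> by (auto simp: A) (metis bij_pointE)+
  ultimately show ?thesis
    using a by (auto simp: monomial_group_def A)
qed

lemma primitive_root_power_eq_1:
  assumes z: "primitive_root_of_one q z" and k: "z ^ k = 1" and q: "1 \<le> q"
  shows "q dvd k"
proof (rule ccontr)
  assume "\<not> q dvd k"
  then have "0 < k mod q" "k mod q < q"
    using q by (auto simp: mod_greater_zero_iff_not_dvd)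
  moreover have "z ^ (k mod q) = 1"
  proof -
    have "z ^ k = z ^ (q * (k div q) + k mod q)"
      by simp
    also have "\<dots> = z ^ (k mod q)"
      using z unfolding power_add power_mult by (simp add: primitive_root_of_one_def)
    finally show ?thesis using k by simp
  qed
  ultimately show False
    using z by (auto simp: primitive_root_of_one_def)
qed

lemma msubst_bracket_invariant:
  fixes p :: "('m::finite monom, 'k::field) mpoly"
  assumes "p \<in> Fqd q D"
  shows "(msubst bracket p :: ('m \<times> 'n::finite, 'k) mpoly) \<in> invariants (monomial_group q)"
  unfolding invariants_def
proof (intro CollectI ballI)
  fix A :: "'k ^ 'n ^ 'n" assume A: "A \<in> monomial_group q"
  show "act A (msubst bracket p) = (msubst bracket p :: ('m \<times> 'n, 'k) mpoly)"
  proof (induction p rule: mpoly_induct)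
    case (single E c)
    have "act A (mev bracket E) = mev (\<lambda>w. act A (bracket w)) E"
      by (simp add: act_def msubst_mev)
    also have "\<dots> = mev bracket E"
      using single assms by (intro mev_cong act_bracket[OF A]) (auto simp: Fqd_def polys_in_def Mq_def)
    finally show ?case
      by (simp add: act_def msubst_single msubst_mult)
  qed (simp_all add: act_def msubst_add)
qed

context vector_invariants
begin

text \<open>The diagonal matrix with zeta at place j and 1 elsewhere multiplies a monomial by zeta
  to the degree of its block j, so this power is 1 on every monomial of an invariant.\<close>

lemma invariant_keys_qdiv:
  assumes g: "g \<in> invariants (monomial_group q)" and z: "primitive_root_of_one q (zeta :: 'k)"
    and e: "e \<in> Poly_Mapping.keys (g :: ('m \<times> 'n, 'k) mpoly)"
  shows "qdiv q e"
  unfolding qdiv_def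
proof
  fix j :: 'n
  define a where "a k = (if k = j then zeta else 1)" for k
  define A :: "'k ^ 'n ^ 'n" where "A = (\<chi> k l. if l = k then a k else 0)"
  have A: "A $ k $ l = (if l = id k then a k else 0)" for k l
    by (simp add: A_def)
  have pa: "(\<Prod>k\<in>UNIV. a k ^ mdeg (block e' k)) = zeta ^ mdeg (block e' j)" for e' :: "('m \<times> 'n) monom"
    by (simp add: a_def if_distrib[of "\<lambda>x. x ^ _"] cong: if_cong)
  have "A \<in> monomial_group q"
    using z q by (intro monomial_group_memI[OF A bij_id]) (auto simp: a_def primitive_root_of_one_def)
  then have "g = act A g"
    using g by (simp add: invariants_def)
  also have "act A g = lin (\<lambda>e. mconst (zeta ^ mdeg (block e j)) * xpow e) g"
  proof (induction g rule: mpoly_induct)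
    case (single e c)
    have "act A (xpow e) = mconst (zeta ^ mdeg (block e j)) * xpow e"
      using act_xpow[OF A, of e] by (simp add: pa prod_monom_at_block)
    then show ?case
      by (subst single_conv_mconst) (simp add: act_def msubst_mult lin_mconst_mult)
  qed (simp_all add: act_def msubst_add lin_add)
  finally have "Poly_Mapping.lookup g e = Poly_Mapping.lookup (lin (\<lambda>e. mconst (zeta ^ mdeg (block e j)) * xpow e) g) e"
    by (rule arg_cong)
  then have "Poly_Mapping.lookup g e = zeta ^ mdeg (block e j) * Poly_Mapping.lookup g e"
    unfolding lookup_lin_diagonal .
  then have "zeta ^ mdeg (block e j) = 1"
    using e by (simp add: in_keys_iff)
  then show "q dvd mdeg (block e j)"
    using primitive_root_power_eq_1[OF z _ q] by blast
qed

text \<open>On polynomials whose monomials satisfy \<open>qdiv\<close>, phi o theta is the average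
  over the permutation matrices: an injection of {1..n} becomes a permutation of the index type
  through \<open>nu\<close>.\<close>

lemma reynolds_invariant:
  assumes g: "g \<in> invariants (monomial_group q)" and z: "primitive_root_of_one q (zeta :: 'k)"
  shows "phi (theta g) = g"
proof -
  define S where "S = {f \<in> {1..n} \<rightarrow>\<^sub>E (UNIV :: 'n set). inj_on f {1..n}}"
  define \<sigma> where "\<sigma> f j = f (inv_into {1..n} nu j)" for f :: "nat \<Rightarrow> 'n" and j
  define A :: "(nat \<Rightarrow> 'n) \<Rightarrow> 'k ^ 'n ^ 'n" where "A f = (\<chi> j k. if k = \<sigma> f j then 1 else 0)" for f
  have A: "A f $ j $ k = (if k = \<sigma> f j then 1 else 0)" for f j k
    by (simp add: A_def)
  have nu_inv: "inv_into {1..n} nu (nu s) = s" if "s \<in> {1..n}" for s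
    using nu that by (simp add: bij_betw_inv_into_left)
  have nu_mem: "j \<in> nu ` {1..n}" for j
    using nu by (simp add: bij_betw_def)
  have inv_mem: "inv_into {1..n} nu j \<in> {1..n}" "nu (inv_into {1..n} nu j) = j" for j
    by (rule inv_into_into[OF nu_mem] f_inv_into_f[OF nu_mem])+
  have A_mem: "A f \<in> monomial_group q" if "f \<in> S" for f
  proof (rule monomial_group_memI[OF A])
    have "inj (\<sigma> f)"
    proof (rule injI)
      fix j k assume "\<sigma> f j = \<sigma> f k"
      then have "inv_into {1..n} nu j = inv_into {1..n} nu k"
        using that inv_mem(1) unfolding \<sigma>_def S_def by (auto dest: inj_onD)
      then show "j = k"
        by (metis inv_mem(2))
    qed
    then show "bij (\<sigma> f)"
      by (simp add: bij_def finite_UNIV_inj_surj)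
  qed (use q in auto)
  have avg: "phi (theta p) = mconst (1 / of_nat (fact n)) * (\<Sum>f\<in>S. act (A f) p)"
    if "\<And>e. e \<in> Poly_Mapping.keys p \<Longrightarrow> qdiv q e" for p :: "('m \<times> 'n, 'k) mpoly"
  proof (induction p rule: mpoly_induct)
    case (single e c)
    have "(\<Prod>s\<in>{1..n}. monom_at (block e (nu s)) (f s)) = (act (A f) (xpow e) :: ('m \<times> 'n, 'k) mpoly)" for f
    proof -
      have "(\<Prod>s\<in>{1..n}. monom_at (block e (nu s)) (f s)) =
          (\<Prod>s\<in>{1..n}. monom_at (block e (nu s)) (\<sigma> f (nu s)) :: ('m \<times> 'n, 'k) mpoly)"
        by (intro prod.cong refl) (simp only: \<sigma>_def nu_inv)
      also have "\<dots> = (\<Prod>j\<in>UNIV. monom_at (block e j) (\<sigma> f j))"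
        using nu by (rule prod.reindex_bij_betw)
      finally show ?thesis
        using act_xpow[OF A, of f e] by simp
    qed
    then have "phi (theta (xpow e)) = mconst (1 / of_nat (fact n)) * (\<Sum>f\<in>S. act (A f) (xpow e))"
      using that[OF single] by (simp add: theta_xpow msubst_mult msubst_inj_sum phi_tvar inj_sum_bracket S_def)
    then show ?case
      by (subst (1 2) single_conv_mconst)
        (simp add: theta_mconst_mult msubst_mult act_def sum_distrib_left mult.left_commute[of _ "mconst c"])
  qed (simp_all add: theta_add msubst_add act_def sum.distrib distrib_left, simp add: theta_def)
  \<comment> \<open>Applying the averaging formula to 1, where \<open>theta\<close> is already
    normalized, yields card S / n! = 1 in the field without counting permutations.\<close>
  have "(1 :: ('m \<times> 'n, 'k) mpoly) = phi (theta 1)"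
    by (simp add: theta_one)
  also have "\<dots> = mconst (1 / of_nat (fact n)) * of_nat (card S)"
    by (subst avg) (simp_all add: qdiv_def act_def)
  finally have 1: "mconst (1 / of_nat (fact n)) * of_nat (card S) = (1 :: ('m \<times> 'n, 'k) mpoly)" ..
  have "phi (theta g) = mconst (1 / of_nat (fact n)) * (\<Sum>f\<in>S. act (A f) g)"
    using invariant_keys_qdiv[OF g z] by (rule avg)
  also have "(\<Sum>f\<in>S. act (A f) g) = (\<Sum>f\<in>S. g)"
    using A_mem g by (intro sum.cong) (auto simp: invariants_def)
  also have "\<dots> = of_nat (card S) * g"
    by simp
  also have "mconst (1 / of_nat (fact n)) * (of_nat (card S) * g) = g"
    using 1 by (simp add: mult.assoc[symmetric])
  finally show ?thesis .
qed

end

section \<open>The Hilbert ideal\<close>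

lemma finite_mdeg_le: "finite {w :: 'm::finite monom. mdeg w \<le> N}"
proof (rule inj_on_finite[of Poly_Mapping.lookup _ "PiE UNIV (\<lambda>_. {..N})"])
  show "inj_on Poly_Mapping.lookup {w :: 'm monom. mdeg w \<le> N}"
    by (simp add: inj_on_def poly_mapping.lookup_inject)
  have "Poly_Mapping.lookup w i \<le> mdeg w" for w :: "'m monom" and i
    using member_le_sum[of i UNIV "Poly_Mapping.lookup w"]
    by (simp add: mdeg_eq_wdeg wdeg_superset[of UNIV])
  then show "Poly_Mapping.lookup ` {w :: 'm monom. mdeg w \<le> N} \<subseteq> PiE UNIV (\<lambda>_. {..N})"
    by (auto intro: order_trans)
qed (simp add: finite_PiE)

lemma monom_split_degree:
  fixes w :: "'m monom"
  assumes "q \<le> mdeg w"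
  obtains u v where "w = u + v" "mdeg u = q"
proof -
  have "\<exists>u v. w = u + v \<and> mdeg u = q"
    using assms
  proof (induction w arbitrary: q rule: monom_induct)
    case (add i w)
    show ?case
    proof (cases q)
      case 0
      then show ?thesis
        by (intro exI[of _ 0] exI[of _ "Poly_Mapping.single i 1 + w"]) simp
    next
      case (Suc r)
      then have "r \<le> mdeg w"
        using add.prems by (simp add: mdeg_add)
      then obtain u v where "w = u + v" "mdeg u = r"
        using add.IH by blast
      then show ?thesis
        using Suc by (intro exI[of _ "Poly_Mapping.single i 1 + u"] exI[of _ v]) (simp add: mdeg_add add.assoc)
    qed
  qed simp
  then show ?thesis
    using that by blast
qed

lemma monom_split_degrees:
  fixes w :: "'m monom"
  assumes "q * r \<le> mdeg w"
  obtains u v where "w = (\<Sum>s\<in>{1..r}. u s) + v" "\<And>s. s \<in> {1..r} \<Longrightarrow> mdeg (u s) = q"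
proof -
  have "\<exists>u v. w = (\<Sum>s\<in>{1..r}. u s) + v \<and> (\<forall>s\<in>{1..r}. mdeg (u s) = q)"
    using assms
  proof (induction r)
    case (Suc r)
    then obtain u v where w: "w = (\<Sum>s\<in>{1..r}. u s) + v" and u: "\<forall>s\<in>{1..r}. mdeg (u s) = q"
      by auto
    have "mdeg w = q * r + mdeg v"
      using u by (simp add: w mdeg_add mdeg_sum)
    then have "q \<le> mdeg v"
      using Suc.prems by simp
    then obtain u' v' where v: "v = u' + v'" "mdeg u' = q"
      by (rule monom_split_degree)
    have "w = (\<Sum>s\<in>{1..Suc r}. (u(Suc r := u')) s) + v'"
      by (simp add: w v add.assoc)
    moreover have "\<forall>s\<in>{1..Suc r}. mdeg ((u(Suc r := u')) s) = q"
      using u v by (auto simp: le_Suc_eq)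
    ultimately show ?case
      by blast
  qed auto
  then show ?thesis
    using that by blast
qed

context vector_invariants
begin

text \<open>For arguments of degree q, the bound q * n corresponds to the power sums p_1, ..., p_n,
  which suffice to express all complete homogeneous symmetric polynomials of n quantities.\<close>

definition W0 :: "'m monom set" where
  "W0 = {w \<in> Mq q. mdeg w \<le> q * n}"

definition J :: "('m \<times> 'n, 'k) mpoly set" where
  "J = {p. \<exists>c. p = (\<Sum>w\<in>W0. bracket w * c w)}"

lemma finite_W0: "finite W0"
  by (rule finite_subset[OF _ finite_mdeg_le[of "q * n"]]) (auto simp: W0_def)

lemma J_zero: "0 \<in> J"
  unfolding J_def by (intro CollectI exI[of _ "\<lambda>_. 0"]) simp

lemma J_add: "p \<in> J \<Longrightarrow> p' \<in> J \<Longrightarrow> p + p' \<in> J"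
proof -
  assume "p \<in> J" "p' \<in> J"
  then obtain c c' where "p = (\<Sum>w\<in>W0. bracket w * c w)" "p' = (\<Sum>w\<in>W0. bracket w * c' w)"
    by (auto simp: J_def)
  then show ?thesis
    unfolding J_def
    by (intro CollectI exI[of _ "\<lambda>w. c w + c' w"]) (simp add: distrib_left sum.distrib)
qed

lemma J_mult: "p \<in> J \<Longrightarrow> p * r \<in> J"
proof -
  assume "p \<in> J"
  then obtain c where "p = (\<Sum>w\<in>W0. bracket w * c w)"
    by (auto simp: J_def)
  then show ?thesis
    unfolding J_def
    by (intro CollectI exI[of _ "\<lambda>w. c w * r"]) (simp add: sum_distrib_right mult.assoc)
qed

lemma J_mult_left: "p \<in> J \<Longrightarrow> r * p \<in> J"
  using J_mult[of p r] by (simp add: mult.commute)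

lemma J_diff: "p \<in> J \<Longrightarrow> p' \<in> J \<Longrightarrow> p - p' \<in> J"
  using J_add[of p "p' * (-1)"] J_mult[of p' "-1"] by simp

lemma J_sum: "(\<And>i. i \<in> S \<Longrightarrow> p i \<in> J) \<Longrightarrow> (\<Sum>i\<in>S. p i) \<in> J"
  by (induction S rule: infinite_finite_induct) (simp_all add: J_zero J_add)

lemma J_lin: "(\<And>e. e \<in> Poly_Mapping.keys p \<Longrightarrow> g e \<in> J) \<Longrightarrow> lin g p \<in> J"
  unfolding lin_def by (intro J_sum J_mult_left)

lemma J_bracket_W0: "w \<in> W0 \<Longrightarrow> bracket w \<in> J"
  unfolding J_def
  by (intro CollectI exI[of _ "\<lambda>w'. if w' = w then 1 else 0"])
    (simp add: if_distrib[of "\<lambda>x. _ * x"] finite_W0 cong: if_cong)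

text \<open>The polarized power sums and complete homogeneous symmetric polynomials of
  the blocks \<open>\<nu> 1, \<dots>, \<nu> k\<close>.\<close>

definition psum :: "(nat \<Rightarrow> 'n) \<Rightarrow> nat \<Rightarrow> 'm monom \<Rightarrow> ('m \<times> 'n, 'k) mpoly" where
  "psum \<nu> k u = (\<Sum>j\<in>{1..k}. monom_at u (\<nu> j))"

definition csum :: "(nat \<Rightarrow> 'n) \<Rightarrow> nat \<Rightarrow> nat set \<Rightarrow> (nat \<Rightarrow> 'm monom) \<Rightarrow> ('m \<times> 'n, 'k) mpoly" where
  "csum \<nu> k A w = part_sum (psum \<nu> k) A w"

lemma csum_Suc:
  assumes "finite A"
  shows "csum \<nu> (Suc k) A w = csum \<nu> k A w +
    (\<Sum>i\<in>A. monom_at (w i) (\<nu> (Suc k)) * csum \<nu> (Suc k) (A - {i}) w)"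
proof -
  have "psum \<nu> (Suc k) = (\<lambda>u. psum \<nu> k u + monom_at u (\<nu> (Suc k)))"
    by (simp add: psum_def fun_eq_iff)
  then show ?thesis
    unfolding csum_def
    using part_sum_add_character[of "\<lambda>u. monom_at u (\<nu> (Suc k))" A "psum \<nu> k" w, OF monom_at_add assms]
    by simp
qed

text \<open>Polarized form of $h_r(x_1,\dots,x_k) \in (p_1,\dots,p_n)$ for $k + r > n$.\<close>

lemma csum_mem_J:
  assumes \<nu>: "bij_betw \<nu> {1..n} UNIV"
    and A: "finite A" "m \<le> n" "m < card A" "\<And>s. s \<in> A \<Longrightarrow> w s \<in> Mq q" "(\<Sum>s\<in>A. mdeg (w s)) \<le> q * n"
  shows "csum \<nu> (n - m) A w \<in> J"
  using A
proof (induction m arbitrary: A)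
  case 0
  have "psum \<nu> n u \<in> J" if "u \<in> Mq q" "mdeg u \<le> q * n" for u
  proof -
    have "psum \<nu> n u = bracket u"
      unfolding psum_def bracket_def using \<nu> by (rule sum.reindex_bij_betw)
    then show ?thesis
      using that J_bracket_W0[of u] by (simp add: W0_def)
  qed
  then have "part_sum (psum \<nu> n) A w \<in> J"
    using 0 by (intro part_sum_mem_ideal[where deg = mdeg and U = "Mq q" and N = "q * n"])
      (auto simp: J_zero J_add J_mult mdeg_add Mq_add)
  then show ?case
    by (simp add: csum_def)
next
  case (Suc m)
  have k: "n - m = Suc (n - Suc m)"
    using Suc.prems by simp
  have "csum \<nu> (n - m) A w \<in> J"
    using Suc.prems by (intro Suc.IH) auto
  \<comment> \<open>The recurrence is solved for the sum over one block fewer. The terms with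
    \<open>A - {i}\<close> still have more than m arguments, which is why dropping a block costs one
    argument.\<close>
  moreover have "csum \<nu> (n - m) (A - {i}) w \<in> J" if "i \<in> A" for i
  proof (rule Suc.IH)
    have "(\<Sum>s\<in>A - {i}. mdeg (w s)) \<le> (\<Sum>s\<in>A. mdeg (w s))"
      using Suc.prems by (intro sum_mono2) auto
    then show "(\<Sum>s\<in>A - {i}. mdeg (w s)) \<le> q * n"
      using Suc.prems by simp
  qed (use Suc.prems that in auto)
  then have "(\<Sum>i\<in>A. monom_at (w i) (\<nu> (n - m)) * csum \<nu> (n - m) (A - {i}) w) \<in> J"
    by (intro J_sum J_mult_left)
  ultimately have "csum \<nu> (n - m) A w -
      (\<Sum>i\<in>A. monom_at (w i) (\<nu> (n - m)) * csum \<nu> (n - m) (A - {i}) w) \<in> J"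
    by (rule J_diff)
  moreover have "csum \<nu> (n - m) A w = csum \<nu> (n - Suc m) A w +
      (\<Sum>i\<in>A. monom_at (w i) (\<nu> (n - m)) * csum \<nu> (n - m) (A - {i}) w)"
    using csum_Suc[OF Suc.prems(1), of \<nu> "n - Suc m" w] unfolding k[symmetric] .
  ultimately show ?case
    by (simp only: add_diff_cancel_right')
qed

text \<open>Rewriting with the leading term of \<open>csum\<close> moves degree from a block to blocks
  with a smaller index, hence lowers this weight.\<close>

definition weight :: "(nat \<Rightarrow> 'n) \<Rightarrow> 'm \<times> 'n \<Rightarrow> nat" where
  "weight \<nu> x = inv_into {1..n} \<nu> (snd x)"

lemma wdeg_sum: "wdeg \<omega> (\<Sum>i\<in>A. e i) = (\<Sum>i\<in>A. wdeg \<omega> (e i))"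
  by (induction A rule: infinite_finite_induct) (simp_all add: wdeg_add)

lemma wdeg_place:
  assumes "bij_betw \<nu> {1..n} UNIV" "k \<in> {1..n}"
  shows "wdeg (weight \<nu>) (place (\<nu> k) w) = k * mdeg w"
proof -
  have "inv_into {1..n} \<nu> (\<nu> k) = k"
    using assms by (simp add: bij_betw_inv_into_left)
  then show ?thesis
    by (simp add: place_def wdeg_sum weight_def mdeg_eq_wdeg wdeg_superset[of UNIV] sum_distrib_right[symmetric])
qed

lemma csum_supp:
  fixes w :: "nat \<Rightarrow> 'm monom"
  assumes \<nu>: "bij_betw \<nu> {1..n} UNIV" and k: "k \<le> n" and A: "finite A"
  defines "d \<equiv> \<Sum>s\<in>A. mdeg (w s)"
  shows "csum \<nu> k A w \<in> supp_in {e. mdeg e = d \<and> wdeg (weight \<nu>) e \<le> k * d}"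
proof -
  define T :: "nat \<Rightarrow> ('m \<times> 'n, 'k) mpoly set" where
    "T d = supp_in {e. mdeg e = d \<and> wdeg (weight \<nu>) e \<le> k * d}" for d
  have "part_sum (psum \<nu> k) A w \<in> T (\<Sum>s\<in>A. mdeg (w s))"
  proof (rule part_sum_mem_graded[where U = UNIV and N = d])
    show "1 \<in> T 0"
      using supp_in_single[of 0 "{e. mdeg e = 0 \<and> wdeg (weight \<nu>) e \<le> k * 0}" "1 :: 'k"] by (simp add: T_def)
    show "p * p' \<in> T (d + d')" if "p \<in> T d" "p' \<in> T d'" for p p' d d'
      using that unfolding T_def
      by (rule supp_in_mult) (auto simp: mdeg_add wdeg_add distrib_left intro: add_mono)
    show "psum \<nu> k u \<in> T (mdeg u)" for u
    proof -
      have "monom_at u (\<nu> j) \<in> T (mdeg u)" if "j \<in> {1..k}" for j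
        using that k wdeg_place[OF \<nu>, of j u] unfolding monom_at_eq T_def
        by (intro supp_in_single) auto
      then show ?thesis
        unfolding psum_def T_def by (intro supp_in_sum)
    qed
  qed (use A in \<open>auto simp: T_def supp_in_add mdeg_add d_def\<close>)
  then show ?thesis
    by (simp add: csum_def T_def d_def)
qed

text \<open>In \<open>csum_Suc\<close> every i in \<open>A\<close> contributes (card A - 1)! times
  the same leading monomial, hence the factorial. The part over the first k blocks has weight at
  most k * d, which is below Suc k * d because nonzero arguments make d positive.\<close>

lemma csum_lead:
  fixes w :: "nat \<Rightarrow> 'm monom"
  assumes \<nu>: "bij_betw \<nu> {1..n} UNIV" and k: "Suc k \<le> n"
    and A: "finite A" "\<And>s. s \<in> A \<Longrightarrow> w s \<noteq> 0"
  defines "d \<equiv> \<lambda>A. \<Sum>s\<in>A. mdeg (w s)"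
  shows "csum \<nu> (Suc k) A w - of_nat (fact (card A)) * monom_at (\<Sum>s\<in>A. w s) (\<nu> (Suc k)) \<in>
    supp_in {e. mdeg e = d A \<and> wdeg (weight \<nu>) e < Suc k * d A}"
  using A
proof (induction "card A" arbitrary: A)
  case 0
  then show ?case
    by (simp add: csum_def)
next
  case (Suc r)
  define L where "L A = csum \<nu> (Suc k) A w - of_nat (fact (card A)) * monom_at (\<Sum>s\<in>A. w s) (\<nu> (Suc k))" for A
  define S where "S = {e :: ('m \<times> 'n) monom. mdeg e = d A \<and> wdeg (weight \<nu>) e < Suc k * d A}"
  have d_split: "d A = mdeg (w i) + d (A - {i})" if "i \<in> A" for i
    using Suc.prems that by (simp add: d_def sum.remove[of A i])
  have 1: "csum \<nu> k A w \<in> supp_in S"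
  proof -
    obtain i where "i \<in> A"
      using Suc.hyps by (metis card.empty equals0I nat.distinct(1))
    then have "0 < d A"
      using Suc.prems(2)[of i] d_split[of i] mdeg_eq_0_iff[of "w i"] by linarith
    then show ?thesis
      using csum_supp[OF \<nu> _ Suc.prems(1), of k w] k
      by (auto simp: S_def d_def elim!: supp_in_mono)
  qed
  have 2: "monom_at (w i) (\<nu> (Suc k)) * L (A - {i}) \<in> supp_in S" if i: "i \<in> A" for i
  proof -
    have "L (A - {i}) \<in> supp_in {e. mdeg e = d (A - {i}) \<and> wdeg (weight \<nu>) e < Suc k * d (A - {i})}"
      unfolding L_def using Suc.prems i Suc.hyps(2) by (intro Suc.hyps(1)) auto
    moreover have "monom_at (w i) (\<nu> (Suc k)) \<in>
        supp_in {e. mdeg e = mdeg (w i) \<and> wdeg (weight \<nu>) e = Suc k * mdeg (w i)}"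
      unfolding monom_at_eq using k wdeg_place[OF \<nu>, of "Suc k" "w i"] by (intro supp_in_single) auto
    ultimately show ?thesis
      using d_split[OF i] unfolding S_def
      by (elim supp_in_mult[rotated]) (auto simp: mdeg_add wdeg_add algebra_simps)
  qed
  have 3: "monom_at (w i) (\<nu> (Suc k)) * csum \<nu> (Suc k) (A - {i}) w =
      of_nat (fact r) * monom_at (\<Sum>s\<in>A. w s) (\<nu> (Suc k)) + monom_at (w i) (\<nu> (Suc k)) * L (A - {i})"
    if i: "i \<in> A" for i
  proof -
    have "card (A - {i}) = r"
      using i Suc by (metis Suc.prems(1) card_Diff_singleton diff_Suc_1)
    moreover have "monom_at (\<Sum>s\<in>A. w s) (\<nu> (Suc k)) =
        (monom_at (w i) (\<nu> (Suc k)) * monom_at (\<Sum>s\<in>A - {i}. w s) (\<nu> (Suc k)) :: ('m \<times> 'n, 'k) mpoly)"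
      using Suc.prems i by (simp add: sum.remove[of A i] monom_at_add)
    ultimately show ?thesis
      by (simp add: L_def algebra_simps)
  qed
  have "csum \<nu> (Suc k) A w = csum \<nu> k A w + (of_nat (card A) * (of_nat (fact r) * monom_at (\<Sum>s\<in>A. w s) (\<nu> (Suc k))) +
      (\<Sum>i\<in>A. monom_at (w i) (\<nu> (Suc k)) * L (A - {i})))"
    using Suc.prems by (simp add: csum_Suc[of A \<nu> k] 3 sum.distrib)
  moreover have "of_nat (card A) * (of_nat (fact r) * x) = of_nat (fact (card A)) * x"
    for x :: "('m \<times> 'n, 'k) mpoly"
  proof -
    have "fact (card A) = card A * fact r"
      unfolding Suc.hyps(2)[symmetric] by simp
    then show ?thesis
      by (simp only: of_nat_mult mult.assoc)
  qed
  ultimately have "L A = csum \<nu> k A w + (\<Sum>i\<in>A. monom_at (w i) (\<nu> (Suc k)) * L (A - {i}))"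
    by (simp add: L_def)
  then have "L A \<in> supp_in S"
    using 1 2 by (simp add: supp_in_add supp_in_sum)
  then show ?case
    by (simp add: L_def S_def)
qed

lemma fact_neq_0: "r \<le> n \<Longrightarrow> of_nat (fact r) \<noteq> (0::'k)"
proof
  assume "r \<le> n" "of_nat (fact r) = (0::'k)"
  then obtain k where "fact n = fact r * (k::nat)"
    using fact_dvd[of r n] by (auto simp: dvd_def)
  then have "of_nat (fact n) = of_nat (fact r) * (of_nat k :: 'k)"
    by (metis of_nat_mult)
  then show False
    using \<open>of_nat (fact r) = (0::'k)\<close> fact_n by simp
qed

text \<open>With r = n + 1 - k, the least number of arguments for which k + r > n, r factors of
  degree q are split off from block k. Their \<open>csum\<close> over the first k blocks lies in
  \<open>J\<close>, and its leading term is r! times their product in block k. Dividing by r! and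
  multiplying by the rest of the monomial gives the rewriting rule.\<close>

lemma xpow_reduce:
  assumes \<nu>: "bij_betw \<nu> {1..n} UNIV" and k: "k \<in> {1..n}"
    and e: "q * (n + 1 - k) \<le> mdeg (block e (\<nu> k))"
  obtains p where "p \<in> J"
    "xpow e - p \<in> supp_in {e'. mdeg e' = mdeg e \<and> wdeg (weight \<nu>) e' < wdeg (weight \<nu>) e}"
proof -
  define r where "r = n + 1 - k"
  define A where "A = {1..r}"
  have r: "r \<le> n" "n - (r - 1) = k" "r \<ge> 1"
    using k by (auto simp: r_def)
  obtain w v where wv: "block e (\<nu> k) = (\<Sum>s\<in>A. w s) + v" and w: "\<And>s. s \<in> A \<Longrightarrow> mdeg (w s) = q"
  proof (rule monom_split_degrees[OF e[folded r_def]])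
    fix u v
    assume "block e (\<nu> k) = (\<Sum>s\<in>{1..r}. u s) + v" "\<And>s. s \<in> {1..r} \<Longrightarrow> mdeg (u s) = q"
    then show thesis
      using that[of u v] by (simp add: A_def)
  qed
  define u where "u = (\<Sum>s\<in>A. w s)"
  define d where "d = (\<Sum>s\<in>A. mdeg (w s))"
  have d: "d = mdeg u" "d = r * q"
    using w by (simp_all add: d_def u_def mdeg_sum A_def)
  define e' where "e' = place (\<nu> k) v + (\<Sum>j\<in>- {\<nu> k}. place j (block e j))"
  have "e = (\<Sum>j\<in>UNIV. place j (block e j))"
    by (simp add: sum_place_block)
  also have "\<dots> = place (\<nu> k) (block e (\<nu> k)) + (\<Sum>j\<in>- {\<nu> k}. place j (block e j))"
    by (subst sum.remove[of UNIV "\<nu> k"]) (auto simp: Compl_eq_Diff_UNIV)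
  finally have e_eq: "e = place (\<nu> k) u + e'"
    by (simp add: wv place_add u_def e'_def add.assoc)
  have "w s \<noteq> 0" if "s \<in> A" for s
    using w[OF that] q by auto
  moreover have "w s \<in> Mq q" if "s \<in> A" for s
    using w[OF that] calculation[OF that] by (simp add: Mq_def)
  ultimately have wA: "\<And>s. s \<in> A \<Longrightarrow> w s \<noteq> 0" "\<And>s. s \<in> A \<Longrightarrow> w s \<in> Mq q"
    by auto
  obtain k' where k': "k = Suc k'"
    using k by (cases k) auto
  have cJ: "csum \<nu> k A w \<in> J"
    using csum_mem_J[OF \<nu>, of A "r - 1" w] r wA d by (simp add: A_def d_def mult.commute)
  define l where "l = csum \<nu> k A w - of_nat (fact r) * monom_at u (\<nu> k)"
  have l: "l \<in> supp_in {e. mdeg e = d \<and> wdeg (weight \<nu>) e < k * d}"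
    using csum_lead[OF \<nu>, of k' A w] k k' wA by (simp add: l_def A_def u_def d_def)
  define c :: "('m \<times> 'n, 'k) mpoly" where "c = mconst (1 / of_nat (fact r))"
  have c: "c * of_nat (fact r) = 1"
    using fact_neq_0[OF r(1)] by (metis c_def mconst_1 mconst_mult mconst_of_nat nonzero_divide_eq_eq)
  have "xpow e = c * of_nat (fact r) * monom_at u (\<nu> k) * xpow e'"
    by (simp add: c e_eq monom_at_eq xpow_add)
  also have "\<dots> = c * csum \<nu> k A w * xpow e' - c * (l * xpow e')"
    by (simp add: l_def algebra_simps)
  finally have eq: "xpow e - c * csum \<nu> k A w * xpow e' = - (c * (l * xpow e'))"
    by simp
  have "l * xpow e' \<in> supp_in {e''. mdeg e'' = mdeg e \<and> wdeg (weight \<nu>) e'' < wdeg (weight \<nu>) e}"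
  proof (rule supp_in_mult[OF l])
    show "xpow e' \<in> supp_in {e'}"
      by (simp add: supp_in_single)
    show "a + b \<in> {e''. mdeg e'' = mdeg e \<and> wdeg (weight \<nu>) e'' < wdeg (weight \<nu>) e}"
      if "a \<in> {e. mdeg e = d \<and> wdeg (weight \<nu>) e < k * d}" "b \<in> {e'}" for a b
      using that d(1) wdeg_place[OF \<nu> k, of u] by (simp add: e_eq mdeg_add wdeg_add)
  qed
  then have "xpow e - c * csum \<nu> k A w * xpow e' \<in>
      supp_in {e'. mdeg e' = mdeg e \<and> wdeg (weight \<nu>) e' < wdeg (weight \<nu>) e}"
    unfolding eq by (intro supp_in_uminus) (simp add: c_def supp_in_mconst_mult)
  moreover have "c * csum \<nu> k A w * xpow e' \<in> J"
    by (intro J_mult J_mult_left cJ)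
  ultimately show ?thesis
    using that by blast
qed

text \<open>The e of the overview, summed in the order of the blocks: the largest total degree when
  no block k reaches the degree required by \<open>xpow_reduce\<close>.\<close>

definition topdeg :: nat where
  "topdeg = (\<Sum>k\<in>{1..n}. q * (n + 1 - k) - 1)"

lemma J_supp: "p \<in> supp_in S \<Longrightarrow> (\<And>e. e \<in> S \<Longrightarrow> xpow e \<in> J) \<Longrightarrow> p \<in> J"
  using J_lin[of p xpow] by (auto simp: supp_in_def lin_monomials)

text \<open>In such a degree some block admits a reduction, and the remainder has the same degree
  and smaller weight.\<close>

lemma xpow_mem_J:
  assumes "topdeg < mdeg e"
  shows "xpow e \<in> J"
  using assms
proof (induction "wdeg (weight nu) e" arbitrary: e rule: less_induct)
  case less
  have "\<exists>k\<in>{1..n}. q * (n + 1 - k) \<le> mdeg (block e (nu k))"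
  proof (rule ccontr)
    assume *: "\<not> ?thesis"
    have "mdeg (block e (nu k)) \<le> q * (n + 1 - k) - 1" if "k \<in> {1..n}" for k
    proof -
      have "mdeg (block e (nu k)) < q * (n + 1 - k)"
        using * that by (meson not_le)
      then show ?thesis by linarith
    qed
    then have "(\<Sum>k\<in>{1..n}. mdeg (block e (nu k))) \<le> topdeg"
      unfolding topdeg_def by (rule sum_mono)
    then show False
      using less.prems sum_mdeg_block_nu[of e] by simp
  qed
  then obtain k where "k \<in> {1..n}" "q * (n + 1 - k) \<le> mdeg (block e (nu k))"
    by blast
  then obtain p where p: "p \<in> J"
    "xpow e - p \<in> supp_in {e'. mdeg e' = mdeg e \<and> wdeg (weight nu) e' < wdeg (weight nu) e}"
    by (rule xpow_reduce[OF nu])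
  have "xpow e - p \<in> J"
    using p(2) by (rule J_supp) (use less in auto)
  then have "xpow e - p + p \<in> J"
    using p(1) by (rule J_add)
  then show ?case by simp
qed

text \<open>Needed for the variables t(w) with degree between q * n and \<open>D\<close>. If block j
  is numbered first, a monomial supported there has the least weight possible in its degree, so
  \<open>xpow_reduce\<close> leaves no remainder at all.\<close>

lemma bracket_mem_J:
  assumes w: "w \<in> Mq q"
  shows "bracket w \<in> J"
proof (cases "mdeg w \<le> q * n")
  case True
  then show ?thesis
    using w by (intro J_bracket_W0) (simp add: W0_def)
next
  case False
  have "monom_at w j \<in> J" for j
  proof -
    obtain i where i: "i \<in> {1..n}" "nu i = j"
      using nu by (metis UNIV_I bij_betw_def image_iff)
    define \<nu> where "\<nu> = nu \<circ> Transposition.transpose 1 i"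
    have \<nu>: "bij_betw \<nu> {1..n} UNIV"
      unfolding \<nu>_def
    proof (rule bij_betw_trans[OF _ nu])
      show "bij_betw (Transposition.transpose 1 i) {1..n} {1..n}"
        using i by (intro bij_betw_imageI) auto
    qed
    have \<nu>1: "\<nu> 1 = j"
      using i by (simp add: \<nu>_def)
    have n1: "1 \<in> {1..n}"
      using i by auto
    have "block (place j w) (\<nu> 1) = w"
      by (simp add: block_place \<nu>1 del: One_nat_def)
    then obtain p where p: "p \<in> J"
      "xpow (place j w) - p \<in> supp_in {e'. mdeg e' = mdeg (place j w) \<and>
         wdeg (weight \<nu>) e' < wdeg (weight \<nu>) (place j w)}"
      using xpow_reduce[OF \<nu> n1, of "place j w"] False by auto
    have "mdeg e' \<le> wdeg (weight \<nu>) e'" for e'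
    proof -
      have "1 \<le> weight \<nu> x" for x
        using inv_into_into[of "snd x" \<nu> "{1..n}"] \<nu> by (simp add: weight_def bij_betw_def)
      then show ?thesis
        unfolding mdeg_eq_wdeg wdeg_def by (intro sum_mono) (simp add: mult_le_mono2 del: mult_1_right)
    qed
    moreover have "wdeg (weight \<nu>) (place j w) = mdeg w"
      using wdeg_place[OF \<nu> n1, of w] by (simp add: \<nu>1 del: One_nat_def)
    ultimately have "{e'. mdeg e' = mdeg (place j w) \<and>
         wdeg (weight \<nu>) e' < wdeg (weight \<nu>) (place j w)} = {}"
      by (auto simp: not_less) (metis leD)
    then have "xpow (place j w) - p \<in> supp_in {}"
      using p(2) by (simp only:)
    then have "xpow (place j w) - p = 0"
      by (simp add: supp_in_def keys_eq_empty)
    then show ?thesis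
      using p(1) by (simp add: monom_at_eq)
  qed
  then show ?thesis
    unfolding bracket_def by (rule J_sum)
qed

section \<open>Numerical bounds\<close>

lemma two_topdeg: "2 * topdeg + 2 * n = q * n * (n + 1)"
proof -
  have "2 * (\<Sum>k\<in>{1..m}. q * (m + 1 - k) - 1) + 2 * m = q * m * (m + 1)" for m
  proof (induction m)
    case (Suc m)
    define f where "f k = q * (Suc m + 1 - k) - 1" for k
    have "sum f {1..Suc m} = f 1 + sum f {Suc 1..Suc m}"
      by (rule sum.atLeast_Suc_atMost) simp
    also have "sum f {Suc 1..Suc m} = (\<Sum>k\<in>{1..m}. f (Suc k))"
      by (rule sum.shift_bounds_cl_Suc_ivl)
    finally have "(\<Sum>k\<in>{1..Suc m}. q * (Suc m + 1 - k) - 1) =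
        (q * (Suc m) - 1) + (\<Sum>k\<in>{1..m}. q * (m + 1 - k) - 1)"
      by (simp add: f_def[abs_def] del: sum.cl_ivl_Suc)
    moreover have "1 \<le> q * Suc m"
      using q by simp
    ultimately show ?case
      using Suc.IH by (simp add: algebra_simps)
  qed simp
  then show ?thesis
    by (simp add: topdeg_def)
qed

lemma n_pos: "1 \<le> n"
  using n by (simp add: Suc_le_eq)

lemma D_eq: "D = 2 * topdeg + 2"
  using two_topdeg by (simp add: D)

text \<open>Supplies \<open>deg_le\<close> for the generators in \<open>W0\<close>, and also shows
  that their t(w) are variables of \<open>Fqd q D\<close>.\<close>

lemma qn_le: "q * n \<le> topdeg + 2"
proof -
  have "2 * (q * n) \<le> q * n * (n + 1) - 2 * n + 4"
  proof (cases "n \<le> 2")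
    case True
    then have "n = 1 \<or> n = 2"
      using n_pos by auto
    then show ?thesis
      using q by auto
  next
    case False
    then have "q * n * 2 + n * 2 \<le> q * n * 2 + q * n * (n - 1)"
      using q by (intro add_left_mono mult_mono) auto
    also have "\<dots> = q * n * (n + 1)"
      using n_pos by (simp add: algebra_simps)
    finally show ?thesis
      by linarith
  qed
  then show ?thesis
    using two_topdeg by simp
qed

sublocale hilbert: graded_ideal W0 "bracket :: 'm monom \<Rightarrow> ('m \<times> 'n, 'k) mpoly" "\<lambda>w. int (mdeg w)" "int topdeg"
proof
  show "finite W0"
    by (rule finite_W0)
  show "bracket w \<in> hom_std (int (mdeg w))" for w :: "'m monom"
    by (rule bracket_hom_std)
  show "int (mdeg w) \<le> int topdeg + 2" if "w \<in> W0" for w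
    using that qn_le by (simp add: W0_def)
  show "\<exists>c. h = (\<Sum>w\<in>W0. bracket w * c w)" if "h \<in> hom_std d" "int topdeg < d"
    for h :: "('m \<times> 'n, 'k) mpoly" and d
  proof -
    have "h \<in> J"
      by (rule J_supp[of _ "{e. int (wdeg std e) = d}"])
        (use that xpow_mem_J in \<open>auto simp: homog_def wdeg_std\<close>)
    then show ?thesis
      by (simp add: J_def)
  qed
qed

end

section \<open>Relations of degree above the bound\<close>

context vector_invariants
begin

text \<open>Above degree \<open>D\<close> the value of \<open>theta\<close> may involve variables
  outside \<open>Fqd q D\<close>. There g = sum [w] * c w with w in \<open>W0\<close>, and lifts of
  the averages of the c w, which have smaller degree, are combined with coefficients t(w).\<close>

lemma invariant_lift:
  assumes "g \<in> hom_std d"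
  obtains p where "p \<in> FD d" "phi p = phi (theta g)"
proof -
  \<comment> \<open>Induction on a natural number above the integer degree; in negative degrees g =
    0.\<close>
  have "\<exists>p\<in>FD d. phi p = phi (theta g)" if "d < int k" "g \<in> hom_std d" for k d g
    using that
  proof (induction k arbitrary: d g)
    case 0
    then have "g = 0"
      by (intro homog_negative) auto
    then show ?case
      using FD_zero theta_xpow by (intro bexI[of _ 0]) (simp_all add: theta_def)
  next
    case (Suc k)
    show ?case
    proof (cases "d \<le> int D")
      case True
      then show ?thesis
        using theta_FD Suc.prems by blast
    next
      case False
      then have "int topdeg < d"
        by (simp add: D_eq)
      with Suc.prems(2) obtain c where c: "g = (\<Sum>w\<in>W0. bracket w * c w)"
        "\<And>w. c w \<in> hom_std (d - int (mdeg w))"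
        by (rule hilbert.ideal_hom) blast
      have "\<exists>p\<in>FD (d - int (mdeg w)). phi p = phi (theta (c w))" if "w \<in> W0" for w
      proof (rule Suc.IH)
        have "mdeg w \<noteq> 0"
          using that by (simp add: W0_def Mq_def)
        then show "d - int (mdeg w) < int k"
          using Suc.prems(1) by linarith
      qed (rule c(2))
      then obtain p where p: "\<And>w. w \<in> W0 \<Longrightarrow> p w \<in> FD (d - int (mdeg w))"
        "\<And>w. w \<in> W0 \<Longrightarrow> phi (p w) = phi (theta (c w))"
        by metis
      have "(\<Sum>w\<in>W0. mvar w * p w) \<in> FD d"
      proof (rule FD_sum)
        fix w assume w: "w \<in> W0"
        have "mvar w \<in> FD (int (mdeg w))"
          using w qn_le by (intro FD_mvar) (auto simp: W0_def D_eq)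
        from FD_mult[OF this p(1)[OF w]] show "mvar w * p w \<in> FD d"
          by simp
      qed
      moreover have "phi (\<Sum>w\<in>W0. mvar w * p w) = phi (theta g)"
      proof -
        have "phi (\<Sum>w\<in>W0. mvar w * p w) = (\<Sum>w\<in>W0. phi (theta (bracket w * c w)))"
          unfolding msubst_sum
        proof (rule sum.cong[OF refl])
          fix w assume w: "w \<in> W0"
          then have "w \<in> Mq q"
            by (simp add: W0_def)
          then show "phi (mvar w * p w) = phi (theta (bracket w * c w))"
            using p(2)[OF w] by (simp add: msubst_mult reynolds_bracket_mult)
        qed
        then show ?thesis
          unfolding c(1) theta_sum msubst_sum .
      qed
      ultimately show ?thesis
        by blast
    qed
  qed
  moreover have "d < int (nat d + 1)"
    by linarith
  ultimately show ?thesis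
    using assms that by blast
qed

text \<open>Eliminates the t(u) with u outside \<open>W0\<close> from one factor of each term, so
  that applying \<open>phi\<close> to a relation produces a syzygy of the generators.\<close>

definition reducible :: "int \<Rightarrow> ('m monom, 'k) mpoly set" where
  "reducible d = {p. \<exists>r. (\<forall>w\<in>W0. r w \<in> FD (d - int (mdeg w))) \<and> p - (\<Sum>w\<in>W0. mvar w * r w) \<in> I}"

lemma reducible_zero: "0 \<in> reducible d"
  unfolding reducible_def by (intro CollectI exI[of _ "\<lambda>_. 0"]) (simp add: FD_zero I_zero)

lemma reducible_add:
  assumes "p \<in> reducible d" "p' \<in> reducible d"
  shows "p + p' \<in> reducible d"
proof -
  obtain r r' where r: "\<forall>w\<in>W0. r w \<in> FD (d - int (mdeg w))" "p - (\<Sum>w\<in>W0. mvar w * r w) \<in> I"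
    and r': "\<forall>w\<in>W0. r' w \<in> FD (d - int (mdeg w))" "p' - (\<Sum>w\<in>W0. mvar w * r' w) \<in> I"
    using assms unfolding reducible_def by blast
  have "p + p' - (\<Sum>w\<in>W0. mvar w * (r w + r' w)) =
      (p - (\<Sum>w\<in>W0. mvar w * r w)) + (p' - (\<Sum>w\<in>W0. mvar w * r' w))"
    by (simp add: distrib_left sum.distrib)
  also have "\<dots> \<in> I"
    using r(2) r'(2) by (rule I_add)
  finally show ?thesis
    unfolding reducible_def using r(1) r'(1)
    by (intro CollectI exI[of _ "\<lambda>w. r w + r' w"]) (auto intro: FD_add)
qed

lemma reducible_mult:
  assumes p: "p \<in> reducible d" and p': "p' \<in> FD d'"
  shows "p' * p \<in> reducible (d' + d)"
proof -
  obtain r where r: "\<forall>w\<in>W0. r w \<in> FD (d - int (mdeg w))" "p - (\<Sum>w\<in>W0. mvar w * r w) \<in> I"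
    using p unfolding reducible_def by blast
  have "p' * (p - (\<Sum>w\<in>W0. mvar w * r w)) \<in> I"
    using p' r by (intro I_mult) (auto simp: FD_def)
  moreover have "p' * (p - (\<Sum>w\<in>W0. mvar w * r w)) = p' * p - (\<Sum>w\<in>W0. mvar w * (p' * r w))"
    by (simp add: right_diff_distrib sum_distrib_left mult.left_commute)
  moreover have "p' * r w \<in> FD (d' + d - int (mdeg w))" if "w \<in> W0" for w
    using FD_mult[OF p' r(1)[rule_format, OF that]] by (simp add: algebra_simps)
  ultimately show ?thesis
    unfolding reducible_def by (intro CollectI exI[of _ "\<lambda>w. p' * r w"]) simp
qed

text \<open>Writing [u] = sum [w] * c w gives t(u) = theta([u]) = sum t(w) * theta(c w) modulo
  \<open>I\<close>; both congruences are available because u has degree at most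
  \<open>D\<close>.\<close>

lemma reducible_mvar:
  assumes u: "u \<in> Mq q" "mdeg u \<le> D"
  shows "mvar u \<in> reducible (int (mdeg u))"
proof -
  let ?d = "int (mdeg u)"
  obtain c' :: "'m monom \<Rightarrow> ('m \<times> 'n, 'k) mpoly" where c': "bracket u = (\<Sum>w\<in>W0. bracket w * c' w)"
    using bracket_mem_J[OF u(1)] by (auto simp: J_def)
  define c where "c w = hcomp std (?d - int (mdeg w)) (c' w)" for w
  have c_hom: "c w \<in> hom_std (?d - int (mdeg w))" for w
    by (simp add: c_def)
  have "hcomp std ?d (bracket u) = (\<Sum>w\<in>W0. bracket w * c w)"
    unfolding c' hcomp_sum c_def by (intro sum.cong refl hcomp_mult bracket_hom_std)
  then have c: "bracket u = (\<Sum>w\<in>W0. bracket w * c w)"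
    by (simp add: hcomp_id bracket_hom_std)
  have mv: "mvar u \<in> FD ?d"
    using u by (rule FD_mvar)
  have "mvar u - (\<Sum>w\<in>W0. mvar w * theta (c w)) =
      (mvar u - theta (bracket u)) - (\<Sum>w\<in>W0. mvar w * theta (c w) - theta (bracket w * c w))"
    by (subst c) (simp add: theta_sum sum_subtractf)
  also have "\<dots> \<in> I"
  proof (rule I_diff[OF _ I_sum])
    show "mvar u - theta (bracket u) \<in> I"
      using theta_phi[OF mv] u by simp
    fix w assume w: "w \<in> W0"
    show "mvar w * theta (c w) - theta (bracket w * c w) \<in> I"
    proof (rule theta_bracket_mult_mem_I)
      show "w \<in> Mq q"
        using w by (simp add: W0_def)
      show "mdeg w + mdeg e \<le> D" if "e \<in> Poly_Mapping.keys (c w)" for e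
      proof -
        have "int (mdeg e) = ?d - int (mdeg w)"
          using that c_hom[of w] by (auto simp: homog_def supp_in_def wdeg_std)
        then show ?thesis
          using u by linarith
      qed
    qed
  qed
  finally have "mvar u - (\<Sum>w\<in>W0. mvar w * theta (c w)) \<in> I" .
  moreover have "theta (c w) \<in> FD (?d - int (mdeg w))" for w
    using c_hom u by (intro theta_FD) auto
  ultimately show ?thesis
    unfolding reducible_def by (intro CollectI exI[of _ "\<lambda>w. theta (c w)"]) simp
qed

text \<open>Positive degree ensures that every monomial contains a variable, and it is enough to
  reduce one.\<close>

lemma FD_reducible:
  assumes p: "p \<in> FD d" and d: "0 < d"
  shows "p \<in> reducible d"
proof -
  have E: "xpow E \<in> reducible (int (wdeg mdeg E))"
    if "Poly_Mapping.keys E \<subseteq> {w \<in> Mq q. mdeg w \<le> D}" "E \<noteq> 0" for E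
    using that
  proof (induction E rule: monom_induct)
    case (add u E)
    have u: "u \<in> Mq q" "mdeg u \<le> D" and keys: "Poly_Mapping.keys E \<subseteq> {w \<in> Mq q. mdeg w \<le> D}"
      using add.prems(1) keys_single_1_add[of u E] by auto
    have "xpow E \<in> FD (int (wdeg mdeg E))"
      using keys by (simp add: FD_def Fqd_def polys_in_def homog_single)
    from reducible_mult[OF reducible_mvar[OF u] this] show ?case
      by (simp add: xpow_add mvar_def wdeg_add add.commute mult.commute)
  qed simp
  have terms: "mconst (Poly_Mapping.lookup p E) * xpow E \<in> reducible d" if "E \<in> Poly_Mapping.keys p" for E
  proof -
    have keys: "Poly_Mapping.keys E \<subseteq> {w \<in> Mq q. mdeg w \<le> D}" and deg: "int (wdeg mdeg E) = d"
      using p that by (auto simp: FD_def Fqd_def polys_in_def homog_def supp_in_def)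
    then have "E \<noteq> 0"
      using d by auto
    with keys have "xpow E \<in> reducible (int (wdeg mdeg E))"
      by (rule E)
    then have "xpow E \<in> reducible d"
      by (simp only: deg)
    from reducible_mult[OF this FD_mconst] show ?thesis
      by simp
  qed
  have "(\<Sum>E\<in>S. mconst (Poly_Mapping.lookup p E) * xpow E) \<in> reducible d"
    if "S \<subseteq> Poly_Mapping.keys p" for S
    using finite_subset[OF that finite_keys] that
    by (induction S rule: finite_induct) (auto intro: reducible_zero reducible_add terms)
  from this[OF order_refl] show ?thesis
    using lin_monomials[of p] by (simp add: lin_def)
qed

theorem kernel_homogeneous:
  assumes "p \<in> FD d" "phi p = 0"
  shows "p \<in> I"
proof -
  have "p \<in> I" if "d < int k" "p \<in> FD d" "phi p = 0" for k d p
    using that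
  proof (induction k arbitrary: d p)
    case 0
    then have "p = 0"
      by (intro homog_negative) (auto simp: FD_def)
    then show ?case
      by (simp add: I_zero)
  next
    case (Suc k)
    show ?case
    proof (cases "d \<le> int D")
      case True
      then show ?thesis
        using theta_phi[OF Suc.prems(2)] Suc.prems(3) by (simp add: theta_def)
    next
      case False
      have "p \<in> reducible d"
        using Suc.prems False by (intro FD_reducible) auto
      then obtain r where r: "\<forall>w\<in>W0. r w \<in> FD (d - int (mdeg w))"
        and pr: "p - (\<Sum>w\<in>W0. mvar w * r w) \<in> I"
        unfolding reducible_def by blast
      have "(\<lambda>w. phi (r w)) \<in> hilbert.syz d"
      proof -
        have "0 = phi (\<Sum>w\<in>W0. mvar w * r w)"
          using I_kernel[OF pr] Suc.prems(3) by (simp add: msubst_diff)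
        also have "\<dots> = (\<Sum>w\<in>W0. bracket w * phi (r w))"
          by (simp add: msubst_sum msubst_mult)
        finally show ?thesis
          using r by (simp add: hilbert.syz_def phi_FD)
      qed
      \<comment> \<open>Here d > D = 2 * topdeg + 2, which is the bound of
        \<open>syz_koszul\<close>.\<close>
      then have "(\<lambda>w. phi (r w)) \<in> hilbert.koszul"
        using False by (intro hilbert.syz_koszul) (auto simp: D_eq)
      then obtain a' where a': "\<And>w. w \<in> W0 \<Longrightarrow> phi (r w) = (\<Sum>w'\<in>W0. (a' w w' - a' w' w) * bracket w')"
        unfolding hilbert.koszul_def by blast
      \<comment> \<open>The Koszul coefficients need be neither homogeneous nor invariant: the
        component of the right degree is averaged, then lifted.\<close>
      have "\<exists>a. a \<in> FD (d - int (mdeg w) - int (mdeg w')) \<and>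
          phi a = phi (theta (hcomp std (d - int (mdeg w) - int (mdeg w')) (a' w w')))" for w w'
        by (rule invariant_lift[OF hcomp_homog]) blast
      then obtain a where a: "\<And>w w'. a w w' \<in> FD (d - int (mdeg w) - int (mdeg w'))"
        and phi_a: "\<And>w w'. phi (a w w') = phi (theta (hcomp std (d - int (mdeg w) - int (mdeg w')) (a' w w')))"
        by metis
      define s where "s w = r w - (\<Sum>w'\<in>W0. mvar w' * (a w w' - a w' w))" for w
      have s_I: "s w \<in> I" if w: "w \<in> W0" for w
      proof (rule Suc.IH)
        have "mdeg w \<noteq> 0"
          using w by (simp add: W0_def Mq_def)
        then show "d - int (mdeg w) < int k"
          using Suc.prems(1) by linarith
        have t: "mvar w' * (a w w' - a w' w) \<in> FD (d - int (mdeg w))" if w': "w' \<in> W0" for w'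
        proof -
          have "mvar w' \<in> FD (int (mdeg w'))"
            using w' qn_le by (intro FD_mvar) (auto simp: W0_def D_eq)
          moreover have "a w w' - a w' w \<in> FD (d - int (mdeg w) - int (mdeg w'))"
            using a[of w w'] a[of w' w] by (intro FD_diff) (simp_all add: algebra_simps)
          ultimately show ?thesis
            using FD_mult by fastforce
        qed
        show "s w \<in> FD (d - int (mdeg w))"
          unfolding s_def using r w t by (intro FD_diff FD_sum) auto
        have r_hom: "phi (r w) \<in> hom_std (d - int (mdeg w))"
          using r w by (intro phi_FD) auto
        let ?h = "\<lambda>w w'. hcomp std (d - int (mdeg w) - int (mdeg w')) (a' w w')"
        have "phi (r w) = hcomp std (d - int (mdeg w)) (phi (r w))"
          using r_hom by (simp add: hcomp_id)
        also have "\<dots> = (\<Sum>w'\<in>W0. hcomp std (d - int (mdeg w)) (bracket w' * (a' w w' - a' w' w)))"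
          by (simp add: a'[OF w] hcomp_sum mult.commute)
        also have "\<dots> = (\<Sum>w'\<in>W0. bracket w' * (?h w w' - ?h w' w))"
          by (intro sum.cong refl)
            (simp add: hcomp_mult[OF bracket_hom_std] hcomp_diff diff_right_commute)
        finally have eq: "phi (r w) = (\<Sum>w'\<in>W0. bracket w' * (?h w w' - ?h w' w))" .
        \<comment> \<open>An element in the image of \<open>phi\<close> is its own average, and
          averaging is linear over the [w'], so it may be applied to the coefficients alone.\<close>
        have "phi (r w) = phi (theta (phi (r w)))"
          using r w by (intro reynolds_phi[symmetric]) (auto simp: FD_def)
        also have "\<dots> = (\<Sum>w'\<in>W0. phi (theta (bracket w' * (?h w w' - ?h w' w))))"
          by (subst eq) (simp add: theta_sum msubst_sum)
        also have "\<dots> = (\<Sum>w'\<in>W0. phi (mvar w' * (a w w' - a w' w)))"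
        proof (rule sum.cong[OF refl])
          fix w' assume "w' \<in> W0"
          then have "w' \<in> Mq q"
            by (simp add: W0_def)
          then show "phi (theta (bracket w' * (?h w w' - ?h w' w))) = phi (mvar w' * (a w w' - a w' w))"
            by (simp add: reynolds_bracket_mult theta_diff msubst_diff msubst_mult phi_a)
        qed
        finally show "phi (s w) = 0"
          by (simp add: s_def msubst_diff msubst_sum)
      qed
      \<comment> \<open>The correction of \<open>r\<close> by the lifts is antisymmetric and cancels
        in this sum, while each \<open>s w\<close> is in \<open>I\<close> by induction.\<close>
      have "(\<Sum>w\<in>W0. mvar w * r w) = (\<Sum>w\<in>W0. mvar w * s w)"
        using sum_sum_antisymmetric[of mvar a W0]
        by (simp add: s_def right_diff_distrib sum_distrib_left sum_subtractf)
      also have "\<dots> \<in> I"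
        using qn_le by (intro I_sum I_mult s_I Fqd_mvar) (auto simp: W0_def D_eq)
      finally have "p - (\<Sum>w\<in>W0. mvar w * r w) + (\<Sum>w\<in>W0. mvar w * r w) \<in> I"
        using pr by (intro I_add)
      then show ?thesis
        by simp
    qed
  qed
  moreover have "d < int (nat d + 1)"
    by linarith
  ultimately show ?thesis
    using assms by blast
qed

section \<open>From homogeneous to arbitrary elements\<close>

lemma FD_hcomp: "p \<in> Fqd q D \<Longrightarrow> hcomp mdeg d p \<in> FD d"
  by (simp add: FD_def Fqd_def polys_in_hcomp)

lemma phi_hcomp: "p \<in> Fqd q D \<Longrightarrow> phi (hcomp mdeg d p) = hcomp std d (phi p)"
proof -
  assume p: "p \<in> Fqd q D"
  have "hcomp std d (phi p) = (\<Sum>d'\<in>(\<lambda>e. int (wdeg mdeg e)) ` Poly_Mapping.keys p. hcomp std d (phi (hcomp mdeg d' p)))"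
    by (subst sum_hcomp[of mdeg p, symmetric]) (simp add: msubst_sum hcomp_sum)
  also have "\<dots> = (\<Sum>d'\<in>(\<lambda>e. int (wdeg mdeg e)) ` Poly_Mapping.keys p. if d' = d then phi (hcomp mdeg d p) else 0)"
    using hcomp_id[OF phi_FD[OF FD_hcomp[OF p]]] hcomp_other[OF phi_FD[OF FD_hcomp[OF p]]]
    by (intro sum.cong refl) auto
  also have "\<dots> = phi (hcomp mdeg d p)"
  proof (cases "d \<in> (\<lambda>e. int (wdeg mdeg e)) ` Poly_Mapping.keys p")
    case False
    then have "hcomp mdeg d p = lin (\<lambda>_. 0) p"
      unfolding hcomp_def by (intro lin_cong) auto
    then show ?thesis
      using False by (simp add: lin_def)
  qed simp
  finally show ?thesis ..
qed

theorem kernel_subset: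
  assumes p: "p \<in> Fqd q D" "phi p = 0"
  shows "p \<in> I"
proof -
  have "hcomp mdeg d p \<in> I" for d
    using p by (intro kernel_homogeneous[OF FD_hcomp]) (simp_all add: phi_hcomp)
  then have "(\<Sum>d\<in>(\<lambda>e. int (wdeg mdeg e)) ` Poly_Mapping.keys p. hcomp mdeg d p) \<in> I"
    by (intro I_sum)
  then show ?thesis
    by (simp add: sum_hcomp)
qed

theorem surjective:
  assumes g: "g \<in> invariants (monomial_group q)" and z: "primitive_root_of_one q (zeta :: 'k)"
  obtains p where "p \<in> Fqd q D" "phi p = g"
proof -
  have "\<exists>p\<in>Fqd q D. phi p = phi (theta (hcomp std d g))" for d
    by (rule invariant_lift[OF hcomp_homog[of std d g]]) (auto simp: FD_def)
  then obtain p where p: "\<And>d. p d \<in> Fqd q D" "\<And>d. phi (p d) = phi (theta (hcomp std d g))"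
    by metis
  let ?S = "(\<lambda>e. int (wdeg std e)) ` Poly_Mapping.keys g"
  have "phi (\<Sum>d\<in>?S. p d) = phi (theta (\<Sum>d\<in>?S. hcomp std d g))"
    by (simp add: msubst_sum theta_sum p)
  also have "\<dots> = g"
    by (simp add: sum_hcomp reynolds_invariant[OF g z])
  finally show ?thesis
    using p(1) by (intro that[of "\<Sum>d\<in>?S. p d"]) (simp_all add: Fqd_def polys_in_sum)
qed

end

section \<open>The presentation\<close>

lemma cring_ring_on:
  assumes "0 \<in> S" "1 \<in> S" "\<And>p r. p \<in> S \<Longrightarrow> r \<in> S \<Longrightarrow> p + r \<in> S"
    "\<And>p. p \<in> S \<Longrightarrow> - p \<in> S" "\<And>p r. p \<in> S \<Longrightarrow> r \<in> S \<Longrightarrow> p * r \<in> S"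
  shows "cring (ring_on S)"
proof (rule cringI)
  show "abelian_group (ring_on S)"
  proof (rule abelian_groupI)
    fix x assume "x \<in> carrier (ring_on S)"
    then show "\<exists>y\<in>carrier (ring_on S). y \<oplus>\<^bsub>ring_on S\<^esub> x = \<zero>\<^bsub>ring_on S\<^esub>"
      using assms by (intro bexI[of _ "- x"]) (simp_all add: ring_on_def)
  qed (use assms in \<open>simp_all add: ring_on_def add.assoc add.commute\<close>)
  show "comm_monoid (ring_on S)"
    using assms by (intro comm_monoidI) (simp_all add: ring_on_def mult.assoc mult.commute)
qed (simp add: ring_on_def distrib_right)

theorem theorem3p2:
  fixes n q D :: nat
    and zeta :: "'k::field"
    and G :: "('k ^ 'n::finite ^ 'n) set"
    and F :: "('m::finite monom, 'k) mpoly ring"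
    and R :: "('m \<times> 'n, 'k) mpoly ring"
    and phi :: "('m monom, 'k) mpoly \<Rightarrow> ('m \<times> 'n, 'k) mpoly"
  assumes "n = CARD('n)"
    and "q \<ge> 1"
    and "of_nat (fact n * q) \<noteq> (0::'k)"
    and "primitive_root_of_one q zeta"
    and "D = q * n * (n + 1) - 2 * n + 2"
    and "G = monomial_group q"
    and "F = ring_on (Fqd q D)"
    and "R = ring_on (invariants G)"
    and "phi = msubst bracket"
  shows "phi \<in> ring_hom F R \<and> (\<forall>c. phi (mconst c) = mconst c) \<and>
         (\<forall>w\<in>Mq q. mdeg w \<le> D \<longrightarrow> phi (mvar w) = bracket w) \<and>
         phi ` carrier F = carrier R \<and>
         a_kernel F R phi =
           Idl\<^bsub>F\<^esub> {Psi n w | w. (\<forall>s\<in>{1..n+1}. w s \<in> Mq q) \<and> mdeg (\<Sum>s\<in>{1..n+1}. w s) \<le> D}"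
proof -
  let ?P = "{Psi n w | w. (\<forall>s\<in>{1..n+1}. w s \<in> Mq q) \<and> mdeg (\<Sum>s\<in>{1..n+1}. w s) \<le> D}
    :: ('m monom, 'k) mpoly set"
  have fact_n: "of_nat (fact n) \<noteq> (0::'k)"
    using assms(3) by auto
  obtain nu :: "nat \<Rightarrow> 'n" where nu: "bij_betw nu {1..n} UNIV"
    using ex_bij_betw_nat_finite_1[of "UNIV :: 'n set"] assms(1) by auto
  have F_carrier: "carrier F = Fqd q D" and R_carrier: "carrier R = invariants G"
    by (simp_all add: assms(7,8) ring_on_def)
  have F_mult: "x \<otimes>\<^bsub>F\<^esub> y = x * y" and F_add: "x \<oplus>\<^bsub>F\<^esub> y = x + y" and F_zero: "\<zero>\<^bsub>F\<^esub> = 0" for x y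
    by (simp_all add: assms(7) ring_on_def)
  interpret F: cring F
    unfolding assms(7) Fqd_def
    by (intro cring_ring_on polys_in_zero polys_in_one polys_in_add polys_in_uminus polys_in_mult)
  interpret R: cring R
    unfolding assms(8)
    by (rule cring_ring_on) (auto simp: invariants_def act_def msubst_add msubst_mult msubst_uminus)
  have kernel: "a_kernel F R phi = {p \<in> Fqd q D. msubst bracket p = (0 :: ('m \<times> 'n, 'k) mpoly)}"
    by (simp add: a_kernel_def kernel_def F_carrier assms(8,9) ring_on_def)
  have Psi_mem: "(Psi n w :: ('m monom, 'k) mpoly) \<in> Fqd q D"
    if w: "\<forall>s\<in>{1..n+1}. w s \<in> Mq q" "mdeg (\<Sum>s\<in>{1..n+1}. w s) \<le> D" for w :: "nat \<Rightarrow> 'm monom"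
  proof -
    \<comment> \<open>The family is constant in d: the degree bookkeeping only has to ensure that
      merged arguments remain of degree at most \<open>D\<close>.\<close>
    have "inj_sum mvar {1..n+1} w \<in> (\<lambda>d. Fqd q D :: ('m monom, 'k) mpoly set) (\<Sum>s\<in>{1..n+1}. mdeg (w s))"
      by (rule inj_sum_mem_graded[where T = "\<lambda>_. Fqd q D" and U = "Mq q" and N = D])
        (use w in \<open>auto simp: Fqd_def polys_in_zero polys_in_one polys_in_mult mdeg_add mdeg_sum Mq_add
          intro: polys_in_diff polys_in_mvar\<close>)
    moreover have "(-1) ^ k * p \<in> Fqd q D" if "p \<in> Fqd q D" for k and p :: "('m monom, 'k) mpoly"
      by (induction k) (use that in \<open>auto simp: Fqd_def polys_in_uminus\<close>)
    ultimately show ?thesis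
      by (simp only: Psi_eq_inj_sum)
  qed
  then have P_sub: "?P \<subseteq> carrier F"
    by (auto simp: F_carrier)
  have ideal: "ideal (Idl\<^bsub>F\<^esub> ?P) F"
    using P_sub by (rule F.genideal_ideal)
  interpret Idl: ideal "Idl\<^bsub>F\<^esub> ?P" F
    by (rule ideal)
  have phi_invariant: "phi p \<in> invariants G" if "p \<in> Fqd q D" for p
    unfolding assms(6,9) using that by (rule msubst_bracket_invariant)
  have hom: "phi \<in> ring_hom F R"
    using phi_invariant unfolding assms(7,8,9)
    by (intro ring_hom_memI) (simp_all add: ring_on_def msubst_mult msubst_add)
  interpret hom: ring_hom_ring F R phi
    using hom by (intro ring_hom_ringI2 F.ring_axioms R.ring_axioms)
  have kernel_ideal: "ideal (a_kernel F R phi) F"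
    by (rule hom.kernel_is_ideal)
  have "?P \<subseteq> a_kernel F R phi"
    unfolding kernel using Psi_mem msubst_Psi_bracket[OF assms(1)] by blast
  then have sub: "Idl\<^bsub>F\<^esub> ?P \<subseteq> a_kernel F R phi"
    by (rule F.genideal_minimal[OF kernel_ideal])
  \<comment> \<open>The inclusion \<open>sub\<close> of the generated ideal in the kernel is itself
    an assumption of the locale; the interpretation then provides the opposite inclusion.\<close>
  interpret V: vector_invariants q n D nu "Idl\<^bsub>F\<^esub> ?P"
  proof
    show "0 \<in> Idl\<^bsub>F\<^esub> ?P"
      using Idl.zero_closed by (simp add: F_zero)
    show "p + p' \<in> Idl\<^bsub>F\<^esub> ?P" if "p \<in> Idl\<^bsub>F\<^esub> ?P" "p' \<in> Idl\<^bsub>F\<^esub> ?P" for p p'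
      using Idl.a_closed[OF that] by (simp add: F_add)
    show "r * p \<in> Idl\<^bsub>F\<^esub> ?P" if "p \<in> Idl\<^bsub>F\<^esub> ?P" "r \<in> Fqd q D" for p r
      using Idl.I_l_closed[of p r] that by (simp add: F_mult F_carrier)
    show "Psi n w \<in> Idl\<^bsub>F\<^esub> ?P" if "\<forall>s\<in>{1..n+1}. w s \<in> Mq q" "mdeg (\<Sum>s\<in>{1..n+1}. w s) \<le> D" for w
      using F.genideal_self[OF P_sub] that by blast
    show "msubst bracket p = (0 :: ('m \<times> 'n, 'k) mpoly)" if "p \<in> Idl\<^bsub>F\<^esub> ?P" for p
      using sub that unfolding kernel by blast
  qed (fact assms fact_n nu)+
  have "a_kernel F R phi = Idl\<^bsub>F\<^esub> ?P"
    using sub V.kernel_subset unfolding kernel by blast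
  moreover have "phi ` carrier F = carrier R"
  proof
    show "phi ` carrier F \<subseteq> carrier R"
      using phi_invariant by (auto simp: F_carrier R_carrier)
    show "carrier R \<subseteq> phi ` carrier F"
    proof
      fix g assume "g \<in> carrier R"
      then have "g \<in> invariants (monomial_group q)"
        by (simp add: R_carrier assms(6))
      then obtain p where "p \<in> Fqd q D" "msubst bracket p = g"
        using V.surjective assms(4) by blast
      then show "g \<in> phi ` carrier F"
        by (auto simp: F_carrier assms(9))
    qed
  qed
  ultimately show ?thesis
    using hom by (simp add: assms(9))
qed

end
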